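(* Consider a Poisson manifold $(M,\Xi)$, a function $H:M\rightarrow\mathbb{R}$ with Hamiltonian vector field $X_H$, and a fibration $\Pi:M\rightarrow N$. 1. Suppose that there is an isotropic complete solution $\Sigma:N\times\Lambda\rightarrow M$ of the $\Pi$-HJE for $(M,X_{H})$ with $(\Sigma^{\ast}\Xi)^{\sharp}\left((TN\times0)^{0}\right)$ integrable. Then, for every $m\in M$, there exists an open neighborhood $U$ of $m$ such that $(U,X_{H}|_{U})$ is non-commutative integrable (NCI). 2. If $(M,X_{H})$ is NCI by means of $F$, with $F$ and $\Pi$ transverse (i.e. $TM=\operatorname{Ker}\Pi_*\oplus\operatorname{Ker}F_*$), then, for each $m\in M$, there exist an open neighborhood $U$ of $m$ and an isotropic complete solution $\Sigma$ of the $\Pi|_{U}$-HJE for $(U,X_{H}|_{U})$ with $(\Sigma^{\ast}\Xi)^{\sharp}\left((\Pi_{\ast}(TU)\times0)^{0}\right)$ integrable. 3. If $(M,X_{H})$ is NCI, then, for each $m\in M$, there exist an open neighborhood $U$ of $m$, a fibration $\pi:U\rightarrow\pi(U)$ and an isotropic complete solution $\Sigma$ of the $\pi$-HJE for $(U,X_{H}|_{U})$ with $(\Sigma^{\ast}\Xi)^{\sharp}\left((\pi_{\ast}(TU)\times0)^{0}\right)$ integrable.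
   Context: All manifolds are smooth and finite-dimensional and all maps are smooth; $f_*$ denotes the tangent map of $f$; a superscript $0$ denotes annihilator. A fibration is a surjective submersion. A dynamical system $(M,X)$ is a manifold with a vector field. Given a fibration $\Pi:M\to N$, a section $\sigma:N\to M$ of $\Pi$ is a solution of the $\Pi$-Hamilton-Jacobi equation ($\Pi$-HJE) for $(M,X)$ if $\sigma_{\ast}\circ\Pi_{\ast}\circ X\circ\sigma=X\circ\sigma$. A complete solution of the $\Pi$-HJE for $(M,X)$ is a surjective local diffeomorphism $\Sigma:N\times\Lambda\to M$, with $\Lambda$ a manifold of dimension $\dim M-\dim N$, such that for each $\lambda\in\Lambda$ the map $\sigma_\lambda:=\Sigma(\cdot,\lambda)$ is a section of $\Pi$ solving the $\Pi$-HJE. For $U\subset M$ open, $\Pi|_U:U\to\Pi(U)$ is the restricted fibration and the same definitions are applied to $(U,X|_U)$. For a Poisson manifold $(M,\Xi)$, $\Xi^\sharp:T^*M\to TM$ is given by $\langle\alpha,\Xi^\sharp(\beta)\rangle=\Xi(\alpha,\beta)$ and $X_H=\Xi^\sharp\circ dH$. A subspace $V\subset T_mM$ is isotropic if $V\cap\operatorname{Im}\Xi^\sharp\subset\Xi^\sharp(V^0)$ and $V\subset\operatorname{Im}\Xi^\sharp$ (equivalently $V\subset\Xi^\sharp(V^0)$). A fibration $F$ is isotropic if each fiber of $\operatorname{Ker}F_*$ is isotropic; a section $\sigma$ is isotropic if each fiber of $\operatorname{Im}\sigma_*$ is isotropic; $\Sigma$ is isotropic if every $\sigma_\lambda$ is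 isotropic. For a local diffeomorphism $\Phi:P\to M$, $\Phi^*\Xi$ is the Poisson structure on $P$ given by $(\alpha,\beta)\mapsto\langle\alpha,\Phi_{*,p}^{-1}\circ\Xi^\sharp_{\Phi(p)}\circ(\Phi_p^* )^{-1}(\beta)\rangle$, $\alpha,\beta\in T_p^*P$. $TN\times 0\subset T(N\times\Lambda)$ is the subbundle with fibers $T_nN\times 0_\lambda$ (and similarly $\Pi_*(TU)\times 0$, $\pi_*(TU)\times 0$). Integrability refers to (possibly non-constant rank) distributions: through each point there passes an integral submanifold. $(M,X_H)$ is non-commutative integrable (NCI) by means of $F$ if $F:M\to\Lambda$ is an isotropic fibration onto some manifold $\Lambda$ such that $\operatorname{Im}X_H\subset\operatorname{Ker}F_*$ and $\Xi^\sharp[(\operatorname{Ker}F_* )^0]$ is integrable; it is NCI if such an $F$ exists. *)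

theory Defs
  imports "HOL-Analysis.Analysis"
begin

section \<open>Smooth functions on open subsets of the n-dimensional Euclidean space\<close>

text \<open>The coordinate space of dimension \<open>n\<close> is \<^const>\<open>Euclidean_space\<close> \<open>n\<close>, whose points are the
  \<open>x :: nat \<Rightarrow> real\<close> with \<open>x i = 0\<close> for all \<open>i \<ge> n\<close>; thus dimensions are numbers, and
  dimension 0 is included.\<close>

definition partial_deriv :: "nat \<Rightarrow> ((nat \<Rightarrow> real) \<Rightarrow> real) \<Rightarrow> (nat \<Rightarrow> real) \<Rightarrow> real"
  where "partial_deriv i f x = deriv (\<lambda>t. f (x(i := t))) (x i)"

fun Ck_on :: "nat \<Rightarrow> nat \<Rightarrow> (nat \<Rightarrow> real) set \<Rightarrow> ((nat \<Rightarrow> real) \<Rightarrow> real) \<Rightarrow> bool"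
  where
    "Ck_on 0 n W f \<longleftrightarrow> continuous_map (subtopology (Euclidean_space n) W) euclideanreal f"
  | "Ck_on (Suc k) n W f \<longleftrightarrow>
       continuous_map (subtopology (Euclidean_space n) W) euclideanreal f \<and>
       (\<forall>i<n. (\<forall>x\<in>W. (\<lambda>t. f (x(i := t))) field_differentiable (at (x i))) \<and>
              Ck_on k n W (partial_deriv i f))"

definition Cinf_on :: "nat \<Rightarrow> (nat \<Rightarrow> real) set \<Rightarrow> ((nat \<Rightarrow> real) \<Rightarrow> real) \<Rightarrow> bool"
  where "Cinf_on n W f \<longleftrightarrow> (\<forall>k. Ck_on k n W f)"


section \<open>Manifolds\<close>

text \<open>The atlas need not be maximal. A chart is a pair of its domain and its coordinate map; the
  latter is only relevant on the domain.\<close>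

record 'a mfd =
  mtop :: "'a topology"
  mdim :: nat
  matlas :: "('a set \<times> ('a \<Rightarrow> nat \<Rightarrow> real)) set"

abbreviation mcarrier :: "'a mfd \<Rightarrow> 'a set"
  where "mcarrier M \<equiv> topspace (mtop M)"

definition chart :: "'a topology \<Rightarrow> nat \<Rightarrow> 'a set \<Rightarrow> ('a \<Rightarrow> nat \<Rightarrow> real) \<Rightarrow> bool"
  where "chart T n V \<phi> \<longleftrightarrow> openin T V \<and> openin (Euclidean_space n) (\<phi> ` V) \<and>
    homeomorphic_map (subtopology T V) (subtopology (Euclidean_space n) (\<phi> ` V)) \<phi>"

definition manifold :: "'a mfd \<Rightarrow> bool"
  where "manifold M \<longleftrightarrow>
    Hausdorff_space (mtop M) \<and> second_countable (mtop M) \<and>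
    (\<forall>(V, \<phi>)\<in>matlas M. chart (mtop M) (mdim M) V \<phi>) \<and>
    (\<Union>(V, \<phi>)\<in>matlas M. V) = mcarrier M \<and>
    (\<forall>(V, \<phi>)\<in>matlas M. \<forall>(W, \<psi>)\<in>matlas M. \<forall>i<mdim M.
        Cinf_on (mdim M) (\<phi> ` (V \<inter> W)) (\<lambda>x. \<psi> (inv_into V \<phi> x) i))"

definition open_mfd :: "'a mfd \<Rightarrow> 'a set \<Rightarrow> 'a mfd"
  where "open_mfd M U = \<lparr>mtop = subtopology (mtop M) U, mdim = mdim M,
    matlas = (\<lambda>(V, \<phi>). (V \<inter> U, \<phi>)) ` matlas M\<rparr>"

definition concat_coords :: "nat \<Rightarrow> (nat \<Rightarrow> real) \<Rightarrow> (nat \<Rightarrow> real) \<Rightarrow> nat \<Rightarrow> real"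
  where "concat_coords n x y = (\<lambda>i. if i < n then x i else y (i - n))"

definition prod_mfd :: "'a mfd \<Rightarrow> 'b mfd \<Rightarrow> ('a \<times> 'b) mfd"
  where "prod_mfd M N = \<lparr>mtop = prod_topology (mtop M) (mtop N), mdim = mdim M + mdim N,
    matlas = (\<lambda>((V, \<phi>), (W, \<psi>)). (V \<times> W, \<lambda>(p, q). concat_coords (mdim M) (\<phi> p) (\<psi> q)))
      ` (matlas M \<times> matlas N)\<rparr>"


section \<open>Smooth maps\<close>

definition smooth_fun_on :: "'a mfd \<Rightarrow> 'a set \<Rightarrow> ('a \<Rightarrow> real) \<Rightarrow> bool"
  where "smooth_fun_on M U f \<longleftrightarrow>
    (\<forall>(V, \<phi>)\<in>matlas M. Cinf_on (mdim M) (\<phi> ` (V \<inter> U)) (\<lambda>x. f (inv_into V \<phi> x)))"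

definition smooth_near :: "'a mfd \<Rightarrow> 'a \<Rightarrow> ('a \<Rightarrow> real) \<Rightarrow> bool"
  where "smooth_near M p f \<longleftrightarrow> (\<exists>U. openin (mtop M) U \<and> p \<in> U \<and> smooth_fun_on M U f)"

definition smooth_map :: "'a mfd \<Rightarrow> 'b mfd \<Rightarrow> ('a \<Rightarrow> 'b) \<Rightarrow> bool"
  where "smooth_map M N f \<longleftrightarrow>
    continuous_map (mtop M) (mtop N) f \<and>
    (\<forall>(V, \<phi>)\<in>matlas M. \<forall>(W, \<psi>)\<in>matlas N. \<forall>i<mdim N.
        Cinf_on (mdim M) (\<phi> ` (V \<inter> f -` W)) (\<lambda>x. \<psi> (f (inv_into V \<phi> x)) i))"

definition diffeo :: "'a mfd \<Rightarrow> 'b mfd \<Rightarrow> ('a \<Rightarrow> 'b) \<Rightarrow> bool"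
  where "diffeo M N f \<longleftrightarrow> bij_betw f (mcarrier M) (mcarrier N) \<and>
    smooth_map M N f \<and> smooth_map N M (inv_into (mcarrier M) f)"

definition local_diffeo :: "'a mfd \<Rightarrow> 'b mfd \<Rightarrow> ('a \<Rightarrow> 'b) \<Rightarrow> bool"
  where "local_diffeo M N f \<longleftrightarrow>
    (\<forall>p\<in>mcarrier M. \<exists>U. openin (mtop M) U \<and> p \<in> U \<and> openin (mtop N) (f ` U) \<and>
        diffeo (open_mfd M U) (open_mfd N (f ` U)) f)"


section \<open>Tangent and cotangent spaces\<close>

text \<open>A tangent vector at \<open>p\<close> is a derivation at \<open>p\<close> of the algebra of functions that are smooth on
  some neighbourhood of \<open>p\<close>, extended by 0 to the remaining functions. A derivation only depends on
  the germ: if \<open>f\<close> vanishes on an open neighbourhood \<open>U\<close> of \<open>p\<close>, then \<open>f = h * f\<close> with \<open>h\<close> the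
  indicator function of the complement of \<open>U\<close>, so that \<open>v f = 0\<close>. The tangent space of an open
  submanifold at \<open>p\<close> is literally the tangent space of the manifold (\<open>tangent_open_mfd\<close> below).\<close>

type_synonym 'a tvec = "('a \<Rightarrow> real) \<Rightarrow> real"
type_synonym 'a covec = "'a tvec \<Rightarrow> real"

definition tangent :: "'a mfd \<Rightarrow> 'a \<Rightarrow> 'a tvec set"
  where "tangent M p = {v.
    (\<forall>f. \<not> smooth_near M p f \<longrightarrow> v f = 0) \<and>
    (\<forall>f g. smooth_near M p f \<longrightarrow> smooth_near M p g \<longrightarrow> v (\<lambda>x. f x + g x) = v f + v g) \<and>
    (\<forall>c f. smooth_near M p f \<longrightarrow> v (\<lambda>x. c * f x) = c * v f) \<and>
    (\<forall>f g. smooth_near M p f \<longrightarrow> smooth_near M p g \<longrightarrow>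
        v (\<lambda>x. f x * g x) = f p * v g + v f * g p)}"

definition tmap :: "'b mfd \<Rightarrow> ('a \<Rightarrow> 'b) \<Rightarrow> 'a \<Rightarrow> 'a tvec \<Rightarrow> 'b tvec"
  where "tmap N f p v = (\<lambda>g. if smooth_near N (f p) g then v (\<lambda>x. g (f x)) else 0)"

definition ker_tmap :: "'a mfd \<Rightarrow> 'b mfd \<Rightarrow> ('a \<Rightarrow> 'b) \<Rightarrow> 'a \<Rightarrow> 'a tvec set"
  where "ker_tmap M N f p = {v\<in>tangent M p. tmap N f p v = (\<lambda>g. 0)}"

text \<open>Covectors are extended by 0 outside the tangent space.\<close>

definition cotangent :: "'a mfd \<Rightarrow> 'a \<Rightarrow> 'a covec set"
  where "cotangent M p = {\<alpha>.
    (\<forall>v. v \<notin> tangent M p \<longrightarrow> \<alpha> v = 0) \<and>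
    (\<forall>v\<in>tangent M p. \<forall>w\<in>tangent M p. \<alpha> (\<lambda>f. v f + w f) = \<alpha> v + \<alpha> w) \<and>
    (\<forall>c. \<forall>v\<in>tangent M p. \<alpha> (\<lambda>f. c * v f) = c * \<alpha> v)}"

definition differential :: "'a mfd \<Rightarrow> ('a \<Rightarrow> real) \<Rightarrow> 'a \<Rightarrow> 'a covec"
  where "differential M f p = (\<lambda>v. if v \<in> tangent M p then v f else 0)"

definition cotmap :: "'a mfd \<Rightarrow> 'b mfd \<Rightarrow> ('a \<Rightarrow> 'b) \<Rightarrow> 'a \<Rightarrow> 'b covec \<Rightarrow> 'a covec"
  where "cotmap M N f p \<beta> = (\<lambda>v. if v \<in> tangent M p then \<beta> (tmap N f p v) else 0)"

definition annihilator :: "'a mfd \<Rightarrow> 'a \<Rightarrow> 'a tvec set \<Rightarrow> 'a covec set"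
  where "annihilator M p V = {\<alpha>\<in>cotangent M p. \<forall>v\<in>V. \<alpha> v = 0}"

definition fibration :: "'a mfd \<Rightarrow> 'b mfd \<Rightarrow> ('a \<Rightarrow> 'b) \<Rightarrow> bool"
  where "fibration M N f \<longleftrightarrow> smooth_map M N f \<and> f ` mcarrier M = mcarrier N \<and>
    (\<forall>p\<in>mcarrier M. tmap N f p ` tangent M p = tangent N (f p))"

definition smooth_section :: "'a mfd \<Rightarrow> 'b mfd \<Rightarrow> ('a \<Rightarrow> 'b) \<Rightarrow> ('b \<Rightarrow> 'a) \<Rightarrow> bool"
  where "smooth_section M N \<pi> \<sigma> \<longleftrightarrow> smooth_map N M \<sigma> \<and> (\<forall>n\<in>mcarrier N. \<pi> (\<sigma> n) = n)"

definition transverse :: "'a mfd \<Rightarrow> 'b mfd \<Rightarrow> 'c mfd \<Rightarrow> ('a \<Rightarrow> 'b) \<Rightarrow> ('a \<Rightarrow> 'c) \<Rightarrow> bool"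
  where "transverse M N L \<pi> F \<longleftrightarrow> (\<forall>p\<in>mcarrier M.
    {(\<lambda>g. v g + w g) |v w. v \<in> ker_tmap M N \<pi> p \<and> w \<in> ker_tmap M L F p} = tangent M p \<and>
    ker_tmap M N \<pi> p \<inter> ker_tmap M L F p = {\<lambda>g. 0})"


section \<open>Distributions\<close>

text \<open>A distribution assigns to each point a subspace of the tangent space, of possibly varying
  dimension. An integral submanifold is an immersed submanifold, i.e. a manifold \<open>S\<close> on a subset
  with a possibly finer topology such that the inclusion is a smooth immersion.\<close>

definition integral_submanifold :: "'a mfd \<Rightarrow> ('a \<Rightarrow> 'a tvec set) \<Rightarrow> 'a mfd \<Rightarrow> bool"
  where "integral_submanifold M D S \<longleftrightarrow>
    manifold S \<and> mcarrier S \<subseteq> mcarrier M \<and> smooth_map S M (\<lambda>x. x) \<and>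
    (\<forall>q\<in>mcarrier S. inj_on (tmap M (\<lambda>x. x) q) (tangent S q) \<and>
       tmap M (\<lambda>x. x) q ` tangent S q = D q)"

definition integrable_dist :: "'a mfd \<Rightarrow> ('a \<Rightarrow> 'a tvec set) \<Rightarrow> bool"
  where "integrable_dist M D \<longleftrightarrow>
    (\<forall>p\<in>mcarrier M. \<exists>S. p \<in> mcarrier S \<and> integral_submanifold M D S)"

text \<open>The subbundle \<open>\<pi>\<^sub>*(TM)\<close> of the tangent bundle of the base of a fibration \<open>\<pi>\<close>.\<close>

definition image_dist :: "'a mfd \<Rightarrow> 'b mfd \<Rightarrow> ('a \<Rightarrow> 'b) \<Rightarrow> 'b \<Rightarrow> 'b tvec set"
  where "image_dist M N \<pi> n = (\<Union>m\<in>{m\<in>mcarrier M. \<pi> m = n}. tmap N \<pi> m ` tangent M m)"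

text \<open>\<open>D \<times> 0\<close> on \<open>N \<times> \<Lambda>\<close>: the pair \<open>(w, 0)\<close> is the image of \<open>w\<close> under the inclusion of the
  slice through \<open>\<lambda>\<close>.\<close>

definition dist_times_zero ::
  "'b mfd \<Rightarrow> 'l mfd \<Rightarrow> ('b \<Rightarrow> 'b tvec set) \<Rightarrow> 'b \<times> 'l \<Rightarrow> ('b \<times> 'l) tvec set"
  where "dist_times_zero N L D = (\<lambda>(n, l). tmap (prod_mfd N L) (\<lambda>x. (x, l)) n ` D n)"


section \<open>Poisson manifolds\<close>

type_synonym 'a bivector = "'a \<Rightarrow> 'a covec \<Rightarrow> 'a covec \<Rightarrow> real"

definition poisson_bracket ::
  "'a mfd \<Rightarrow> 'a bivector \<Rightarrow> ('a \<Rightarrow> real) \<Rightarrow> ('a \<Rightarrow> real) \<Rightarrow> 'a \<Rightarrow> real"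
  where "poisson_bracket M \<Xi> f g p = \<Xi> p (differential M f p) (differential M g p)"

text \<open>A skew-symmetric bilinear form on each cotangent space, smooth (it gives smooth functions on
  pairs of differentials of local functions, in particular of coordinates), whose bracket of local
  functions satisfies the Jacobi identity.\<close>

definition poisson_manifold :: "'a mfd \<Rightarrow> 'a bivector \<Rightarrow> bool"
  where "poisson_manifold M \<Xi> \<longleftrightarrow> manifold M \<and>
    (\<forall>p\<in>mcarrier M. \<forall>\<alpha>\<in>cotangent M p. \<forall>\<beta>\<in>cotangent M p.
        \<Xi> p \<alpha> \<beta> = - \<Xi> p \<beta> \<alpha> \<and>
        (\<forall>\<gamma>\<in>cotangent M p. \<Xi> p (\<lambda>v. \<alpha> v + \<beta> v) \<gamma> = \<Xi> p \<alpha> \<gamma> + \<Xi> p \<beta> \<gamma>) \<and>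
        (\<forall>c. \<Xi> p (\<lambda>v. c * \<alpha> v) \<beta> = c * \<Xi> p \<alpha> \<beta>)) \<and>
    (\<forall>U f g. openin (mtop M) U \<longrightarrow> smooth_fun_on M U f \<longrightarrow> smooth_fun_on M U g \<longrightarrow>
        smooth_fun_on M U (poisson_bracket M \<Xi> f g)) \<and>
    (\<forall>U f g h. openin (mtop M) U \<longrightarrow>
        smooth_fun_on M U f \<longrightarrow> smooth_fun_on M U g \<longrightarrow> smooth_fun_on M U h \<longrightarrow>
        (\<forall>p\<in>U. poisson_bracket M \<Xi> (poisson_bracket M \<Xi> f g) h p
             + poisson_bracket M \<Xi> (poisson_bracket M \<Xi> g h) f p
             + poisson_bracket M \<Xi> (poisson_bracket M \<Xi> h f) g p = 0))"

definition sharp :: "'a mfd \<Rightarrow> 'a bivector \<Rightarrow> 'a \<Rightarrow> 'a covec \<Rightarrow> 'a tvec"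
  where "sharp M \<Xi> p \<beta> =
    (THE v. v \<in> tangent M p \<and> (\<forall>\<alpha>\<in>cotangent M p. \<alpha> v = \<Xi> p \<alpha> \<beta>))"

definition hamiltonian_vf :: "'a mfd \<Rightarrow> 'a bivector \<Rightarrow> ('a \<Rightarrow> real) \<Rightarrow> 'a \<Rightarrow> 'a tvec"
  where "hamiltonian_vf M \<Xi> H p = sharp M \<Xi> p (differential M H p)"

definition pullback_bivector ::
  "'p mfd \<Rightarrow> 'a mfd \<Rightarrow> 'a bivector \<Rightarrow> ('p \<Rightarrow> 'a) \<Rightarrow> 'p bivector"
  where "pullback_bivector P M \<Xi> \<Phi> p \<alpha> \<beta> =
    \<alpha> (inv_into (tangent P p) (tmap M \<Phi> p)
        (sharp M \<Xi> (\<Phi> p) (inv_into (cotangent M (\<Phi> p)) (cotmap P M \<Phi> p) \<beta>)))"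

text \<open>\<open>\<Xi>\<^sup>\<sharp>(D\<^sup>0)\<close> for a distribution \<open>D\<close>.\<close>

definition sharp_ann ::
  "'a mfd \<Rightarrow> 'a bivector \<Rightarrow> ('a \<Rightarrow> 'a tvec set) \<Rightarrow> 'a \<Rightarrow> 'a tvec set"
  where "sharp_ann M \<Xi> D p = sharp M \<Xi> p ` annihilator M p (D p)"

definition isotropic :: "'a mfd \<Rightarrow> 'a bivector \<Rightarrow> 'a \<Rightarrow> 'a tvec set \<Rightarrow> bool"
  where "isotropic M \<Xi> p V \<longleftrightarrow>
    V \<inter> sharp M \<Xi> p ` cotangent M p \<subseteq> sharp M \<Xi> p ` annihilator M p V \<and>
    V \<subseteq> sharp M \<Xi> p ` cotangent M p"

definition isotropic_fibration :: "'a mfd \<Rightarrow> 'a bivector \<Rightarrow> 'b mfd \<Rightarrow> ('a \<Rightarrow> 'b) \<Rightarrow> bool"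
  where "isotropic_fibration M \<Xi> L F \<longleftrightarrow> fibration M L F \<and>
    (\<forall>p\<in>mcarrier M. isotropic M \<Xi> p (ker_tmap M L F p))"

definition isotropic_section :: "'a mfd \<Rightarrow> 'a bivector \<Rightarrow> 'b mfd \<Rightarrow> ('b \<Rightarrow> 'a) \<Rightarrow> bool"
  where "isotropic_section M \<Xi> N \<sigma> \<longleftrightarrow>
    (\<forall>n\<in>mcarrier N. isotropic M \<Xi> (\<sigma> n) (tmap M \<sigma> n ` tangent N n))"


section \<open>The Hamilton-Jacobi equation\<close>

definition HJE_solution ::
  "'a mfd \<Rightarrow> 'b mfd \<Rightarrow> ('a \<Rightarrow> 'b) \<Rightarrow> ('a \<Rightarrow> 'a tvec) \<Rightarrow> ('b \<Rightarrow> 'a) \<Rightarrow> bool"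
  where "HJE_solution M N \<pi> X \<sigma> \<longleftrightarrow> smooth_section M N \<pi> \<sigma> \<and>
    (\<forall>n\<in>mcarrier N. tmap M \<sigma> n (tmap N \<pi> (\<sigma> n) (X (\<sigma> n))) = X (\<sigma> n))"

definition complete_solution ::
  "'a mfd \<Rightarrow> 'b mfd \<Rightarrow> ('a \<Rightarrow> 'b) \<Rightarrow> ('a \<Rightarrow> 'a tvec) \<Rightarrow> 'l mfd \<Rightarrow> ('b \<times> 'l \<Rightarrow> 'a) \<Rightarrow> bool"
  where "complete_solution M N \<pi> X L \<Sigma> \<longleftrightarrow>
    manifold L \<and> mdim N + mdim L = mdim M \<and>
    local_diffeo (prod_mfd N L) M \<Sigma> \<and> \<Sigma> ` mcarrier (prod_mfd N L) = mcarrier M \<and>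
    (\<forall>l\<in>mcarrier L. HJE_solution M N \<pi> X (\<lambda>n. \<Sigma> (n, l)))"

definition isotropic_complete_solution ::
  "'a mfd \<Rightarrow> 'a bivector \<Rightarrow> 'b mfd \<Rightarrow> ('a \<Rightarrow> 'b) \<Rightarrow> ('a \<Rightarrow> 'a tvec) \<Rightarrow> 'l mfd \<Rightarrow>
   ('b \<times> 'l \<Rightarrow> 'a) \<Rightarrow> bool"
  where "isotropic_complete_solution M \<Xi> N \<pi> X L \<Sigma> \<longleftrightarrow>
    complete_solution M N \<pi> X L \<Sigma> \<and>
    (\<forall>l\<in>mcarrier L. isotropic_section M \<Xi> N (\<lambda>n. \<Sigma> (n, l)))"


section \<open>Non-commutative integrability\<close>

definition nci_by ::
  "'a mfd \<Rightarrow> 'a bivector \<Rightarrow> ('a \<Rightarrow> 'a tvec) \<Rightarrow> 'l mfd \<Rightarrow> ('a \<Rightarrow> 'l) \<Rightarrow> bool"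
  where "nci_by M \<Xi> X L F \<longleftrightarrow>
    manifold L \<and> isotropic_fibration M \<Xi> L F \<and>
    (\<forall>p\<in>mcarrier M. X p \<in> ker_tmap M L F p) \<and>
    integrable_dist M (sharp_ann M \<Xi> (ker_tmap M L F))"

text \<open>HOL does not quantify over the type carrying \<open>\<Lambda>\<close> inside a definition. Manifolds being second
  countable and Hausdorff, each of them is diffeomorphic to one whose points are of type
  \<open>nat \<Rightarrow> real\<close>, so that the following is no restriction (\<open>nci_by_imp_nci\<close> below).\<close>

definition nci :: "'a mfd \<Rightarrow> 'a bivector \<Rightarrow> ('a \<Rightarrow> 'a tvec) \<Rightarrow> bool"
  where "nci M \<Xi> X \<longleftrightarrow> (\<exists>(L :: (nat \<Rightarrow> real) mfd) F. nci_by M \<Xi> X L F)"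


section \<open>Germs\<close>

lemma Ck_on_cong_subset:
  assumes "Ck_on k n W f" "openin (Euclidean_space n) W'" "W' \<subseteq> W" "\<And>x. x \<in> W' \<Longrightarrow> f x = g x"
  shows "Ck_on k n W' g"
  using assms(1,4)
proof (induction k arbitrary: f g)
  have cont: "continuous_map (subtopology (Euclidean_space n) W') euclideanreal g"
    if "continuous_map (subtopology (Euclidean_space n) W) euclideanreal f"
      "\<And>x. x \<in> W' \<Longrightarrow> f x = g x" for f g :: "(nat \<Rightarrow> real) \<Rightarrow> real"
    using continuous_map_eq[OF continuous_map_from_subtopology_mono[OF that(1) assms(3)]] that(2)
    by simp
  {
    case 0
    then show ?case using cont[of f g] by simp
  next
    case (Suc k)
    have near: "\<forall>\<^sub>F t in nhds (x i). x(i := t) \<in> W'" if "x \<in> W'" "i < n" for x i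
    proof -
      have x: "\<forall>j\<ge>n. x j = 0"
        using openin_subset[OF assms(2)] that(1) by (auto simp: topspace_Euclidean_space)
      have "continuous_map euclideanreal (powertop_real UNIV) (\<lambda>t. x(i := t))"
        by (simp add: continuous_map_componentwise_UNIV)
      then have "continuous_map euclideanreal (Euclidean_space n) (\<lambda>t. x(i := t))"
        using x that(2) unfolding Euclidean_space_def
        by (auto simp: continuous_map_in_subtopology image_subset_iff)
      then have "open {t. x(i := t) \<in> W'}"
        using openin_continuous_map_preimage[OF _ assms(2)] by fastforce
      then show ?thesis
        using that(1) by (auto simp: eventually_nhds intro!: exI[of _ "{t. x(i := t) \<in> W'}"])
    qed
    have eq: "\<forall>\<^sub>F t in nhds (x i). f (x(i := t)) = g (x(i := t))" if "x \<in> W'" "i < n" for x i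
      using near[OF that] by eventually_elim (use Suc.prems(2) in auto)
    have "(\<lambda>t. g (x(i := t))) field_differentiable (at (x i))" if "x \<in> W'" "i < n" for x i
    proof -
      have "(\<lambda>t. f (x(i := t))) field_differentiable (at (x i))"
        using Suc.prems(1) that assms(3) by auto
      then show ?thesis
        unfolding field_differentiable_def using DERIV_cong_ev[OF refl eq[OF that] refl] by blast
    qed
    moreover have "Ck_on k n W' (partial_deriv i g)" if "i < n" for i
    proof (rule Suc.IH)
      show "Ck_on k n W (partial_deriv i f)" using Suc.prems(1) that by simp
    qed (use that deriv_cong_ev[OF eq refl] in \<open>auto simp: partial_deriv_def\<close>)
    ultimately show ?case
      using cont[of f g] Suc.prems by auto
  }
qed

lemma Cinf_on_cong_subset:
  assumes "Cinf_on n W f" "openin (Euclidean_space n) W'" "W' \<subseteq> W" "\<And>x. x \<in> W' \<Longrightarrow> f x = g x"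
  shows "Cinf_on n W' g"
  using assms Ck_on_cong_subset unfolding Cinf_on_def by metis

lemma Cinf_on_const: "Cinf_on n W (\<lambda>x. c)"
proof -
  have "Ck_on k n W (\<lambda>x. c)" for k c
  proof (induction k arbitrary: c)
    case (Suc k)
    have "partial_deriv i (\<lambda>x. c) = (\<lambda>x. 0)" for i
      by (simp add: partial_deriv_def fun_eq_iff)
    then show ?case using Suc by simp
  qed simp
  then show ?thesis by (simp add: Cinf_on_def)
qed

lemma Ck_on_Suc: "Ck_on (Suc k) n W f \<Longrightarrow> Ck_on k n W f"
  by (induction k arbitrary: f) auto

lemma Ck_on_add:
  assumes "openin (Euclidean_space n) W" "Ck_on k n W f" "Ck_on k n W g"
  shows "Ck_on k n W (\<lambda>x. f x + g x)"
  using assms(2,3)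
proof (induction k arbitrary: f g)
  case 0
  then show ?case by (auto intro: continuous_map_add)
next
  case (Suc k)
  have "Ck_on k n W (partial_deriv i (\<lambda>x. f x + g x))" if i: "i < n" for i
  proof (rule Ck_on_cong_subset[OF Suc.IH[of "partial_deriv i f" "partial_deriv i g"] assms(1)])
    show "partial_deriv i f x + partial_deriv i g x = partial_deriv i (\<lambda>x. f x + g x) x"
      if "x \<in> W" for x
      using Suc.prems i that by (simp add: partial_deriv_def)
  qed (use Suc.prems i in auto)
  then show ?case
    using Suc.prems by (auto intro: continuous_map_add field_differentiable_add)
qed

lemma Ck_on_mult:
  assumes "openin (Euclidean_space n) W" "Ck_on k n W f" "Ck_on k n W g"
  shows "Ck_on k n W (\<lambda>x. f x * g x)"
  using assms(2,3)
proof (induction k arbitrary: f g)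
  case 0
  then show ?case by (auto intro: continuous_map_real_mult)
next
  case (Suc k)
  have "Ck_on k n W (partial_deriv i (\<lambda>x. f x * g x))" if i: "i < n" for i
  proof (rule Ck_on_cong_subset[OF Ck_on_add[OF assms(1)
          Suc.IH[of f "partial_deriv i g"] Suc.IH[of "partial_deriv i f" g]] assms(1)])
    show "f x * partial_deriv i g x + partial_deriv i f x * g x = partial_deriv i (\<lambda>x. f x * g x) x"
      if "x \<in> W" for x
      using Suc.prems i that by (simp add: partial_deriv_def)
  qed (use Suc.prems i Ck_on_Suc in auto)
  then show ?case
    using Suc.prems by (auto intro: continuous_map_real_mult field_differentiable_mult)
qed

lemma Cinf_on_add:
  "openin (Euclidean_space n) W \<Longrightarrow> Cinf_on n W f \<Longrightarrow> Cinf_on n W g \<Longrightarrow> Cinf_on n W (\<lambda>x. f x + g x)"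
  by (simp add: Cinf_on_def Ck_on_add)

lemma Cinf_on_mult:
  "openin (Euclidean_space n) W \<Longrightarrow> Cinf_on n W f \<Longrightarrow> Cinf_on n W g \<Longrightarrow> Cinf_on n W (\<lambda>x. f x * g x)"
  by (simp add: Cinf_on_def Ck_on_mult)

lemma openin_chart_image:
  assumes "chart T n V \<phi>" "openin T U"
  shows "openin (Euclidean_space n) (\<phi> ` (V \<inter> U))"
proof -
  have "open_map (subtopology T V) (subtopology (Euclidean_space n) (\<phi> ` V)) \<phi>"
    using assms(1) by (simp add: chart_def homeomorphic_imp_open_map)
  moreover have "openin (subtopology T V) (V \<inter> U)"
    using assms(2) by (metis inf_commute openin_subtopology_Int)
  ultimately show ?thesis
    using assms(1) unfolding open_map_def chart_def by (meson openin_trans_full)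
qed

lemma chart_inj: "chart T n V \<phi> \<Longrightarrow> inj_on \<phi> V"
  unfolding chart_def homeomorphic_map_def
  by (metis openin_subset topspace_subtopology_subset)

lemma manifold_chart: "manifold M \<Longrightarrow> (V, \<phi>) \<in> matlas M \<Longrightarrow> chart (mtop M) (mdim M) V \<phi>"
  by (auto simp: manifold_def)

lemma smooth_fun_on_cong_subset:
  assumes "manifold M" "smooth_fun_on M U f" "openin (mtop M) U'" "U' \<subseteq> U"
    "\<And>x. x \<in> U' \<Longrightarrow> f x = g x"
  shows "smooth_fun_on M U' g"
  unfolding smooth_fun_on_def
proof clarify
  fix V \<phi> assume V: "(V, \<phi>) \<in> matlas M"
  note ch = manifold_chart[OF assms(1) V]
  show "Cinf_on (mdim M) (\<phi> ` (V \<inter> U')) (\<lambda>x. g (inv_into V \<phi> x))"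
  proof (rule Cinf_on_cong_subset)
    show "Cinf_on (mdim M) (\<phi> ` (V \<inter> U)) (\<lambda>x. f (inv_into V \<phi> x))"
      using assms(2) V by (auto simp: smooth_fun_on_def)
  qed (use assms(4,5) openin_chart_image[OF ch assms(3)] chart_inj[OF ch] in auto)
qed

lemma smooth_near_cong:
  assumes "manifold M" "openin (mtop M) U" "p \<in> U" "\<And>x. x \<in> U \<Longrightarrow> f x = g x"
    "smooth_near M p f"
  shows "smooth_near M p g"
proof -
  obtain W where W: "openin (mtop M) W" "p \<in> W" "smooth_fun_on M W f"
    using assms(5) by (auto simp: smooth_near_def)
  show ?thesis
    unfolding smooth_near_def
    by (intro exI[of _ "W \<inter> U"] conjI smooth_fun_on_cong_subset[OF assms(1) W(3)])
      (use assms W in auto)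
qed

lemma smooth_near_common:
  assumes "manifold M" "smooth_near M p f" "smooth_near M p g"
  obtains U where "openin (mtop M) U" "p \<in> U" "smooth_fun_on M U f" "smooth_fun_on M U g"
proof -
  obtain U V where UV: "openin (mtop M) U" "p \<in> U" "smooth_fun_on M U f"
      "openin (mtop M) V" "p \<in> V" "smooth_fun_on M V g"
    using assms(2,3) by (auto simp: smooth_near_def)
  then have "smooth_fun_on M (U \<inter> V) f" "smooth_fun_on M (U \<inter> V) g"
    using smooth_fun_on_cong_subset[OF assms(1)] by (metis Int_lower1 Int_lower2 openin_Int)+
  then show ?thesis using UV that[of "U \<inter> V"] by auto
qed

lemma smooth_near_add:
  assumes "manifold M" "smooth_near M p f" "smooth_near M p g"
  shows "smooth_near M p (\<lambda>x. f x + g x)"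
proof -
  obtain U where U: "openin (mtop M) U" "p \<in> U" "smooth_fun_on M U f" "smooth_fun_on M U g"
    using smooth_near_common[OF assms] .
  then have "smooth_fun_on M U (\<lambda>x. f x + g x)"
    using openin_chart_image[OF manifold_chart[OF assms(1)] U(1)]
    by (fastforce simp: smooth_fun_on_def intro!: Cinf_on_add)
  then show ?thesis using U by (auto simp: smooth_near_def)
qed

lemma smooth_near_mult:
  assumes "manifold M" "smooth_near M p f" "smooth_near M p g"
  shows "smooth_near M p (\<lambda>x. f x * g x)"
proof -
  obtain U where U: "openin (mtop M) U" "p \<in> U" "smooth_fun_on M U f" "smooth_fun_on M U g"
    using smooth_near_common[OF assms] .
  then have "smooth_fun_on M U (\<lambda>x. f x * g x)"
    using openin_chart_image[OF manifold_chart[OF assms(1)] U(1)]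
    by (fastforce simp: smooth_fun_on_def intro!: Cinf_on_mult)
  then show ?thesis using U by (auto simp: smooth_near_def)
qed

lemma smooth_near_const:
  assumes "p \<in> mcarrier M"
  shows "smooth_near M p (\<lambda>x. c)"
  using assms unfolding smooth_near_def smooth_fun_on_def
  by (auto intro!: exI[of _ "mcarrier M"] Cinf_on_const)

lemma smooth_near_cmult:
  assumes "manifold M" "p \<in> mcarrier M" "smooth_near M p f"
  shows "smooth_near M p (\<lambda>x. c * f x)"
  using smooth_near_mult[OF assms(1) smooth_near_const[OF assms(2)] assms(3)] .

lemma tangent_cong:
  assumes "manifold M" "openin (mtop M) U" "p \<in> U" "\<And>x. x \<in> U \<Longrightarrow> f x = g x" "v \<in> tangent M p"
  shows "v f = v g"
proof (cases "smooth_near M p f")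
  case False
  then have "\<not> smooth_near M p g"
    using smooth_near_cong[OF assms(1-3), of g f] assms(4) by metis
  then show ?thesis using False assms(5) by (simp add: tangent_def)
next
  case True
  define h :: "'a \<Rightarrow> real" where "h = (\<lambda>x. if x \<in> U then 0 else 1)"
  have near0: "smooth_near M p k" if "\<And>x. x \<in> U \<Longrightarrow> k x = 0" for k
  proof (rule smooth_near_cong[OF assms(1-3), of "\<lambda>x. 0"])
    show "smooth_near M p (\<lambda>x. 0)"
      using assms(2,3) unfolding smooth_near_def smooth_fun_on_def
      by (auto intro!: exI[of _ U] Cinf_on_const)
  qed (use that in auto)
  have h: "smooth_near M p h" by (rule near0) (simp add: h_def)
  have red: "v k = v (\<lambda>x. (1 - h x) * k x)" if k: "smooth_near M p k" for k
  proof -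
    have 1: "smooth_near M p (\<lambda>x. h x * k x)" by (rule near0) (simp add: h_def)
    have 2: "smooth_near M p (\<lambda>x. (1 - h x) * k x)"
      by (rule smooth_near_cong[OF assms(1-3) _ k]) (simp add: h_def)
    have "v (\<lambda>x. h x * h x) = h p * v h + v h * h p"
      using assms(5) h by (simp add: tangent_def)
    moreover have "(\<lambda>x. h x * h x) = h" "h p = 0"
      using assms(3) by (auto simp: h_def)
    ultimately have "v h = 0" by simp
    moreover have "v (\<lambda>x. h x * k x) = h p * v k + v h * k p"
      using assms(5) h k by (simp add: tangent_def)
    ultimately have "v (\<lambda>x. h x * k x) = 0" using \<open>h p = 0\<close> by simp
    moreover have "v (\<lambda>x. h x * k x + (1 - h x) * k x) = v (\<lambda>x. h x * k x) + v (\<lambda>x. (1 - h x) * k x)"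
      using assms(5) 1 2 by (simp add: tangent_def)
    moreover have "(\<lambda>x. h x * k x + (1 - h x) * k x) = k" by (simp add: algebra_simps)
    ultimately show ?thesis by simp
  qed
  have "(\<lambda>x. (1 - h x) * f x) = (\<lambda>x. (1 - h x) * g x)"
    using assms(4) by (auto simp: h_def)
  then show ?thesis
    using red[OF True] red[of g] smooth_near_cong[OF assms(1-3), of f g] assms(4) True by simp
qed

lemma smooth_near_open_mfd:
  assumes "manifold M" "openin (mtop M) U" "p \<in> U"
  shows "smooth_near (open_mfd M U) p f \<longleftrightarrow> smooth_near M p f"
proof -
  have eq: "smooth_fun_on (open_mfd M U) W f \<longleftrightarrow> smooth_fun_on M W f"
    if W: "openin (mtop M) W" "W \<subseteq> U" for W
  proof -
    have "Cinf_on (mdim M) (\<phi> ` (V \<inter> U \<inter> W)) (\<lambda>x. f (inv_into (V \<inter> U) \<phi> x)) \<longleftrightarrow>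
      Cinf_on (mdim M) (\<phi> ` (V \<inter> W)) (\<lambda>x. f (inv_into V \<phi> x))" if V: "(V, \<phi>) \<in> matlas M" for V \<phi>
    proof -
      note ch = manifold_chart[OF assms(1) V]
      have [simp]: "V \<inter> U \<inter> W = V \<inter> W" using W by auto
      have inv: "inv_into (V \<inter> U) \<phi> (\<phi> y) = inv_into V \<phi> (\<phi> y)" if "y \<in> V \<inter> W" for y
        using that W(2) chart_inj[OF ch] by (simp add: inj_on_subset inv_into_f_f subset_iff)
      show ?thesis
        using openin_chart_image[OF ch W(1)] inv
        by (auto elim!: Cinf_on_cong_subset)
    qed
    then show ?thesis
      by (fastforce simp: smooth_fun_on_def open_mfd_def)
  qed
  show ?thesis
  proof
    assume "smooth_near (open_mfd M U) p f"
    then obtain W where W: "openin (subtopology (mtop M) U) W" "p \<in> W"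
      "smooth_fun_on (open_mfd M U) W f"
      by (auto simp: smooth_near_def open_mfd_def)
    then have "openin (mtop M) W" "W \<subseteq> U"
      using assms(2) by (auto simp: openin_open_subtopology)
    then show "smooth_near M p f" using W eq by (auto simp: smooth_near_def)
  next
    assume "smooth_near M p f"
    then obtain W where W: "openin (mtop M) W" "p \<in> W" "smooth_fun_on M W f"
      by (auto simp: smooth_near_def)
    have *: "openin (mtop M) (W \<inter> U)" using W assms by auto
    have "smooth_fun_on (open_mfd M U) (W \<inter> U) f"
      using eq[OF *] smooth_fun_on_cong_subset[OF assms(1) W(3) *] by auto
    moreover have "openin (mtop (open_mfd M U)) (W \<inter> U)"
      using * assms(2) by (simp add: open_mfd_def openin_open_subtopology)
    ultimately show "smooth_near (open_mfd M U) p f"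
      using W(2) assms(3) by (auto simp: smooth_near_def)
  qed
qed

lemma tangent_open_mfd:
  assumes "manifold M" "openin (mtop M) U" "p \<in> U"
  shows "tangent (open_mfd M U) p = tangent M p"
  unfolding tangent_def smooth_near_open_mfd[OF assms] ..


section \<open>Independence of the type carrying the base\<close>

definition transport_mfd :: "('a \<Rightarrow> 'b) \<Rightarrow> 'a mfd \<Rightarrow> 'b mfd"
  where "transport_mfd j M =
    (let g = inv_into (mcarrier M) j in
      \<lparr>mtop = pullback_topology (j ` mcarrier M) g (mtop M), mdim = mdim M,
       matlas = (\<lambda>(V, \<phi>). (j ` V, \<lambda>y. \<phi> (g y))) ` matlas M\<rparr>)"

context
  fixes L :: "'a mfd" and j :: "'a \<Rightarrow> 'b"
  assumes mL: "manifold L" and inj: "inj_on j (mcarrier L)"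
begin

lemma transport_inv: "x \<in> mcarrier L \<Longrightarrow> (inv_into (mcarrier L) j) (j x) = x"
  using inj by simp

lemma openin_transport: "openin (mtop (transport_mfd j L)) S \<longleftrightarrow> (\<exists>U. openin (mtop L) U \<and> S = j ` U)"
proof -
  have "(inv_into (mcarrier L) j) -` U \<inter> j ` mcarrier L = j ` U" if "openin (mtop L) U" for U
    using openin_subset[OF that] inj by (auto simp: subset_iff)
  then show ?thesis
    unfolding transport_mfd_def Let_def by (auto simp: openin_pullback_topology; metis)
qed

lemma mcarrier_transport: "mcarrier (transport_mfd j L) = j ` mcarrier L"
  using inj unfolding transport_mfd_def Let_def by (auto simp: topspace_pullback_topology)

lemma homeo_transport: "homeomorphic_map (mtop L) (mtop (transport_mfd j L)) j"
proof (rule bijective_open_imp_homeomorphic_map)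
  have "{x \<in> mcarrier L. j x \<in> j ` U} = U" if "openin (mtop L) U" for U
    using openin_subset[OF that] inj by (auto simp: inj_on_def)
  then show "continuous_map (mtop L) (mtop (transport_mfd j L)) j"
    unfolding continuous_map_def by (auto simp: mcarrier_transport openin_transport)
  show "open_map (mtop L) (mtop (transport_mfd j L)) j"
    unfolding open_map_def by (auto simp: openin_transport)
qed (use inj in \<open>auto simp: mcarrier_transport\<close>)

lemma homeo_transport_inv: "homeomorphic_map (mtop (transport_mfd j L)) (mtop L) (inv_into (mcarrier L) j)"
proof -
  obtain h where h: "homeomorphic_maps (mtop L) (mtop (transport_mfd j L)) j h"
    using homeo_transport homeomorphic_map_maps by blast
  then have "homeomorphic_map (mtop (transport_mfd j L)) (mtop L) h"
    using homeomorphic_maps_map by blast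
  then show ?thesis
    by (rule homeomorphic_map_eq)
      (use h in \<open>auto simp: mcarrier_transport transport_inv homeomorphic_maps_def\<close>)
qed

lemma chart_subset: "(V, \<phi>) \<in> matlas L \<Longrightarrow> V \<subseteq> mcarrier L"
  using manifold_chart[OF mL] by (auto simp: chart_def dest: openin_subset)

lemma transport_chart_image:
  assumes "(V, \<phi>) \<in> matlas L" "U \<subseteq> mcarrier L"
  shows "(\<lambda>y. \<phi> (inv_into (mcarrier L) j y)) ` (j ` V \<inter> j ` U) = \<phi> ` (V \<inter> U)"
proof -
  have "j ` V \<inter> j ` U = j ` (V \<inter> U)"
    using chart_subset[OF assms(1)] assms(2) inj_on_image_Int[OF inj] by metis
  moreover have "(inv_into (mcarrier L) j) ` j ` (V \<inter> U) = V \<inter> U"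
    using chart_subset[OF assms(1)] inj by (auto simp: image_image subset_iff intro!: image_eqI)
  ultimately show ?thesis by (metis image_image)
qed

lemma transport_chart_inv:
  assumes V: "(V, \<phi>) \<in> matlas L" and x: "x \<in> \<phi> ` V"
  shows "inv_into (j ` V) (\<lambda>y. \<phi> (inv_into (mcarrier L) j y)) x = j (inv_into V \<phi> x)"
proof -
  note ch = chart_inj[OF manifold_chart[OF mL V]]
  have "inj_on (\<lambda>y. \<phi> (inv_into (mcarrier L) j y)) (j ` V)"
    using ch chart_subset[OF V] transport_inv by (auto simp: inj_on_def subset_iff)
  moreover have "\<phi> (inv_into (mcarrier L) j (j (inv_into V \<phi> x))) = x"
    using transport_inv chart_subset[OF V] inv_into_into[OF x] f_inv_into_f[OF x] by (metis subsetD)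
  ultimately show ?thesis
    using inv_into_into[OF x] by (metis (no_types, lifting) imageI inv_into_f_f)
qed

lemma smooth_fun_on_transport:
  assumes "openin (mtop L) U"
  shows "smooth_fun_on (transport_mfd j L) (j ` U) h \<longleftrightarrow> smooth_fun_on L U (\<lambda>x. h (j x))"
proof -
  have "Cinf_on (mdim L) ((\<lambda>y. \<phi> (inv_into (mcarrier L) j y)) ` (j ` V \<inter> j ` U))
          (\<lambda>x. h (inv_into (j ` V) (\<lambda>y. \<phi> (inv_into (mcarrier L) j y)) x)) \<longleftrightarrow>
        Cinf_on (mdim L) (\<phi> ` (V \<inter> U)) (\<lambda>x. h (j (inv_into V \<phi> x)))"
    if V: "(V, \<phi>) \<in> matlas L" for V \<phi>
    unfolding transport_chart_image[OF V openin_subset[OF assms]]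
    using openin_chart_image[OF manifold_chart[OF mL V] assms] transport_chart_inv[OF V]
    by (auto elim!: Cinf_on_cong_subset)
  then show ?thesis
    by (fastforce simp: smooth_fun_on_def transport_mfd_def Let_def)
qed

lemma smooth_near_transport:
  assumes "q \<in> mcarrier L"
  shows "smooth_near (transport_mfd j L) (j q) h \<longleftrightarrow> smooth_near L q (\<lambda>x. h (j x))"
proof -
  have "j q \<in> j ` U \<longleftrightarrow> q \<in> U" if "openin (mtop L) U" for U
    using openin_subset[OF that] inj assms by (auto simp: inj_on_def)
  then show ?thesis
    unfolding smooth_near_def openin_transport by (metis smooth_fun_on_transport)
qed

lemma manifold_transport: "manifold (transport_mfd j L)"
proof -
  have hs: "mtop L homeomorphic_space mtop (transport_mfd j L)"
    using homeo_transport homeomorphic_map_imp_homeomorphic_space by blast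
  have mdim: "mdim (transport_mfd j L) = mdim L" by (simp add: transport_mfd_def Let_def)
  have atl: "matlas (transport_mfd j L) = (\<lambda>(V, \<phi>). (j ` V, \<lambda>y. \<phi> (inv_into (mcarrier L) j y))) ` matlas L"
    by (simp add: transport_mfd_def Let_def)
  have im: "(\<lambda>y. \<phi> (inv_into (mcarrier L) j y)) ` j ` V = \<phi> ` V" if "(V, \<phi>) \<in> matlas L" for V \<phi>
    using transport_chart_image[OF that chart_subset[OF that]] by simp
  have "chart (mtop (transport_mfd j L)) (mdim (transport_mfd j L)) (j ` V) (\<lambda>y. \<phi> (inv_into (mcarrier L) j y))" if V: "(V, \<phi>) \<in> matlas L" for V \<phi>
    unfolding chart_def mdim im[OF V]
  proof (intro conjI)
    note ch = manifold_chart[OF mL V]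
    show "openin (mtop (transport_mfd j L)) (j ` V)" "openin (Euclidean_space (mdim L)) (\<phi> ` V)"
      using ch by (auto simp: chart_def openin_transport)
    have "(inv_into (mcarrier L) j) ` j ` V = V"
      using chart_subset[OF V] inj by (auto simp: image_image subset_iff intro!: image_eqI)
    then have "homeomorphic_map (subtopology (mtop (transport_mfd j L)) (j ` V)) (subtopology (mtop L) V) (inv_into (mcarrier L) j)"
      by (intro homeomorphic_map_subtopologies[OF homeo_transport_inv])
        (use chart_subset[OF V] image_mono[OF chart_subset[OF V], of j] mcarrier_transport in \<open>auto simp: Int_absorb1\<close>)
    from homeomorphic_map_compose[OF this] ch
    show "homeomorphic_map (subtopology (mtop (transport_mfd j L)) (j ` V))
        (subtopology (Euclidean_space (mdim L)) (\<phi> ` V)) (\<lambda>y. \<phi> (inv_into (mcarrier L) j y))"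
      by (auto simp: chart_def o_def)
  qed
  moreover have "Cinf_on (mdim (transport_mfd j L)) ((\<lambda>y. \<phi> (inv_into (mcarrier L) j y)) ` (j ` V \<inter> j ` W))
      (\<lambda>x. \<psi> (inv_into (mcarrier L) j (inv_into (j ` V) (\<lambda>y. \<phi> (inv_into (mcarrier L) j y)) x)) i)"
    if V: "(V, \<phi>) \<in> matlas L" and W: "(W, \<psi>) \<in> matlas L" and i: "i < mdim (transport_mfd j L)" for V \<phi> W \<psi> i
    unfolding transport_chart_image[OF V chart_subset[OF W]] mdim
  proof (rule Cinf_on_cong_subset)
    show "Cinf_on (mdim L) (\<phi> ` (V \<inter> W)) (\<lambda>x. \<psi> (inv_into V \<phi> x) i)"
      using mL V W i unfolding manifold_def mdim by fast
    show "openin (Euclidean_space (mdim L)) (\<phi> ` (V \<inter> W))"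
      using openin_chart_image[OF manifold_chart[OF mL V]] manifold_chart[OF mL W]
      by (simp add: chart_def)
    show "\<psi> (inv_into V \<phi> x) i = \<psi> (inv_into (mcarrier L) j (inv_into (j ` V) (\<lambda>y. \<phi> (inv_into (mcarrier L) j y)) x)) i"
      if "x \<in> \<phi> ` (V \<inter> W)" for x
    proof -
      have x: "x \<in> \<phi> ` V" using that by auto
      show ?thesis
        using transport_chart_inv[OF V x] transport_inv chart_subset[OF V] inv_into_into[OF x]
        by (metis subsetD)
    qed
  qed auto
  moreover have "(\<Union>(V, \<phi>)\<in>matlas (transport_mfd j L). V) = mcarrier (transport_mfd j L)"
  proof -
    have "(\<Union>(V, \<phi>)\<in>matlas (transport_mfd j L). V) = j ` (\<Union>(V, \<phi>)\<in>matlas L. V)"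
      unfolding atl by (auto simp: image_UN case_prod_beta)
    then show ?thesis using mL by (simp add: manifold_def mcarrier_transport)
  qed
  ultimately show ?thesis
    unfolding manifold_def atl
    using mL homeomorphic_Hausdorff_space[OF hs] homeomorphic_space_second_countability[OF hs]
    by (auto simp: manifold_def)
qed

lemma tangent_transport:
  assumes q: "q \<in> mcarrier L"
  shows "tmap (transport_mfd j L) j q ` tangent L q = tangent (transport_mfd j L) (j q)"
proof (intro equalityI subsetI)
  have jq: "j q \<in> mcarrier (transport_mfd j L)" using q by (simp add: mcarrier_transport)
  note near = smooth_near_transport[OF q]
    smooth_near_add[OF mL] smooth_near_mult[OF mL] smooth_near_cmult[OF mL q]
  fix w assume "w \<in> tmap (transport_mfd j L) j q ` tangent L q"
  then obtain v where v: "v \<in> tangent L q" "w = tmap (transport_mfd j L) j q v" by auto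
  then show "w \<in> tangent (transport_mfd j L) (j q)"
    unfolding tangent_def mem_Collect_eq tmap_def by (simp add: near)
next
  have jq: "j q \<in> mcarrier (transport_mfd j L)" using q by (simp add: mcarrier_transport)
  fix w assume w: "w \<in> tangent (transport_mfd j L) (j q)"
  define v where "v = (\<lambda>f. if smooth_near L q f then w (\<lambda>y. f (inv_into (mcarrier L) j y)) else 0)"
  have near: "smooth_near (transport_mfd j L) (j q) (\<lambda>y. f (inv_into (mcarrier L) j y)) \<longleftrightarrow> smooth_near L q f" for f
    unfolding smooth_near_transport[OF q]
    using smooth_near_cong[OF mL openin_topspace q, of "\<lambda>x. f (inv_into (mcarrier L) j (j x))" f]
      smooth_near_cong[OF mL openin_topspace q, of f "\<lambda>x. f (inv_into (mcarrier L) j (j x))"] transport_inv by auto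
  have "v \<in> tangent L q"
    using w smooth_near_add[OF mL] smooth_near_mult[OF mL] smooth_near_cmult[OF mL q]
      transport_inv[OF q]
    unfolding tangent_def mem_Collect_eq v_def by (simp add: near)
  moreover have "tmap (transport_mfd j L) j q v = w"
  proof
    fix h
    show "tmap (transport_mfd j L) j q v h = w h"
    proof (cases "smooth_near (transport_mfd j L) (j q) h")
      case True
      have "w (\<lambda>y. h (j (inv_into (mcarrier L) j y))) = w h"
        by (rule tangent_cong[OF manifold_transport openin_topspace jq _ w])
          (auto simp: mcarrier_transport transport_inv)
      then show ?thesis
        using True smooth_near_transport[OF q] by (simp add: tmap_def v_def)
    qed (use w in \<open>auto simp: tmap_def tangent_def\<close>)
  qed
  ultimately show "w \<in> tmap (transport_mfd j L) j q ` tangent L q" by blast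
qed

lemma smooth_map_transport:
  assumes mM: "manifold M" and F: "smooth_map M L F"
  shows "smooth_map M (transport_mfd j L) (\<lambda>x. j (F x))"
  unfolding smooth_map_def
proof (intro conjI)
  have cF: "continuous_map (mtop M) (mtop L) F" using F by (simp add: smooth_map_def)
  then have Fin: "F x \<in> mcarrier L" if "x \<in> mcarrier M" for x
    using that by (auto simp: continuous_map_def)
  show "continuous_map (mtop M) (mtop (transport_mfd j L)) (\<lambda>x. j (F x))"
    using continuous_map_compose[OF cF homeomorphic_imp_continuous_map[OF homeo_transport]]
    by (simp add: o_def)
  have "Cinf_on (mdim M) (\<phi> ` (V \<inter> (\<lambda>x. j (F x)) -` (j ` W)))
      (\<lambda>x. \<psi> (inv_into (mcarrier L) j (j (F (inv_into V \<phi> x)))) i)"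
    if V: "(V, \<phi>) \<in> matlas M" and W: "(W, \<psi>) \<in> matlas L" and i: "i < mdim L" for V \<phi> W \<psi> i
  proof -
    note chV = manifold_chart[OF mM V]
    have Vs: "V \<subseteq> mcarrier M" using chV by (auto simp: chart_def dest: openin_subset)
    have oW: "openin (mtop L) W" using manifold_chart[OF mL W] by (simp add: chart_def)
    have eq: "V \<inter> (\<lambda>x. j (F x)) -` (j ` W) = V \<inter> F -` W"
      using Vs Fin chart_subset[OF W] inj_on_eq_iff[OF inj] by (auto simp: subset_iff)
    have eq2: "V \<inter> F -` W = V \<inter> {x \<in> mcarrier M. F x \<in> W}" using Vs by auto
    have op: "openin (Euclidean_space (mdim M)) (\<phi> ` (V \<inter> F -` W))"
      unfolding eq2
      by (rule openin_chart_image[OF chV openin_continuous_map_preimage[OF cF oW]])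
    have "Cinf_on (mdim M) (\<phi> ` (V \<inter> F -` W)) (\<lambda>x. \<psi> (F (inv_into V \<phi> x)) i)"
      using F V W i unfolding smooth_map_def by fast
    then show ?thesis unfolding eq
      by (rule Cinf_on_cong_subset[OF _ op])
        (use Fin Vs chart_inj[OF chV] transport_inv in \<open>auto simp: subset_iff\<close>)
  qed
  then show "\<forall>(V, \<phi>)\<in>matlas M. \<forall>(W, \<psi>)\<in>matlas (transport_mfd j L). \<forall>i<mdim (transport_mfd j L).
      Cinf_on (mdim M) (\<phi> ` (V \<inter> (\<lambda>x. j (F x)) -` W)) (\<lambda>x. \<psi> (j (F (inv_into V \<phi> x))) i)"
    by (auto simp: transport_mfd_def Let_def)
qed

lemma nci_by_transport:
  assumes mM: "manifold M" and F: "nci_by M \<Xi> X L F"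
  shows "nci_by M \<Xi> X (transport_mfd j L) (\<lambda>x. j (F x))"
proof -
  have fib: "fibration M L F" using F by (simp add: nci_by_def isotropic_fibration_def)
  then have Fim: "F ` mcarrier M = mcarrier L" by (simp add: fibration_def)
  have tm: "tmap (transport_mfd j L) (\<lambda>x. j (F x)) p v = tmap (transport_mfd j L) j (F p) (tmap L F p v)"
    if "p \<in> mcarrier M" for p v
    proof -
    have "F p \<in> mcarrier L" using that Fim by auto
    then show ?thesis
      by (simp add: tmap_def smooth_near_transport fun_eq_iff)
  qed
  have fib': "fibration M (transport_mfd j L) (\<lambda>x. j (F x))"
    unfolding fibration_def
  proof (intro conjI ballI)
    show "smooth_map M (transport_mfd j L) (\<lambda>x. j (F x))"
      using smooth_map_transport[OF mM] fib by (simp add: fibration_def)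
    show "(\<lambda>x. j (F x)) ` mcarrier M = mcarrier (transport_mfd j L)"
      unfolding mcarrier_transport Fim[symmetric] by (simp add: image_image)
    fix p assume p: "p \<in> mcarrier M"
    have "tmap (transport_mfd j L) (\<lambda>x. j (F x)) p ` tangent M p = tmap (transport_mfd j L) j (F p) ` (tmap L F p ` tangent M p)"
      using tm[OF p] by (simp add: image_image)
    also have "\<dots> = tangent (transport_mfd j L) (j (F p))"
      using fib p tangent_transport[of "F p"] Fim by (auto simp: fibration_def)
    finally show "tmap (transport_mfd j L) (\<lambda>x. j (F x)) p ` tangent M p = tangent (transport_mfd j L) (j (F p))" .
  qed
  have ker: "ker_tmap M (transport_mfd j L) (\<lambda>x. j (F x)) p = ker_tmap M L F p" if p: "p \<in> mcarrier M" for p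
  proof -
    have 1: "tmap L F p v = (\<lambda>f. 0)"
      if v: "v \<in> tangent M p" and 0: "tmap (transport_mfd j L) (\<lambda>x. j (F x)) p v = (\<lambda>f. 0)" for v
    proof
      fix f
      have Fp: "F p \<in> mcarrier L" using p Fim by auto
      show "tmap L F p v f = 0"
      proof (cases "smooth_near L (F p) f")
        case True
        then have "smooth_near L (F p) (\<lambda>x. f (inv_into (mcarrier L) j (j x)))"
          by (rule smooth_near_cong[OF mL openin_topspace Fp, rotated]) (simp add: transport_inv)
        then have "smooth_near (transport_mfd j L) (j (F p)) (\<lambda>y. f (inv_into (mcarrier L) j y))"
          using smooth_near_transport[OF Fp] by simp
        then have "v (\<lambda>x. f (inv_into (mcarrier L) j (j (F x)))) = 0"
          using fun_cong[OF 0, of "\<lambda>y. f (inv_into (mcarrier L) j y)"] by (simp add: tmap_def)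
        moreover have "v (\<lambda>x. f (inv_into (mcarrier L) j (j (F x)))) = v (\<lambda>x. f (F x))"
        proof (rule tangent_cong[OF mM openin_topspace p _ v])
          show "f (inv_into (mcarrier L) j (j (F x))) = f (F x)" if "x \<in> mcarrier M" for x
            using transport_inv[of "F x"] imageI[OF that, of F] unfolding Fim by simp
        qed
        ultimately show ?thesis by (simp add: tmap_def)
      qed (simp add: tmap_def)
    qed
    have 2: "tmap (transport_mfd j L) (\<lambda>x. j (F x)) p v = (\<lambda>f. 0)" if "tmap L F p v = (\<lambda>f. 0)" for v
      unfolding tm[OF p] that by (simp add: tmap_def)
    show ?thesis
      unfolding ker_tmap_def using 1 2 by blast
  qed
  have "integral_submanifold M (sharp_ann M \<Xi> (ker_tmap M (transport_mfd j L) (\<lambda>x. j (F x)))) S"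
    if "integral_submanifold M (sharp_ann M \<Xi> (ker_tmap M L F)) S" for S
    proof -
    have "ker_tmap M (transport_mfd j L) (\<lambda>x. j (F x)) q = ker_tmap M L F q" if "q \<in> mcarrier S" for q
      using ker that \<open>integral_submanifold M _ S\<close> by (auto simp: integral_submanifold_def)
    then show ?thesis
      using that by (simp add: integral_submanifold_def sharp_ann_def)
  qed
  then have "integrable_dist M (sharp_ann M \<Xi> (ker_tmap M (transport_mfd j L) (\<lambda>x. j (F x))))"
    using F unfolding nci_by_def integrable_dist_def by blast
  then show ?thesis
    using F fib' manifold_transport
    unfolding nci_by_def isotropic_fibration_def by (simp add: ker)
qed

end

lemma second_countable_inj:
  assumes "second_countable T" "Hausdorff_space T"
  obtains j :: "'a \<Rightarrow> nat \<Rightarrow> real" where "inj_on j (topspace T)"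
proof -
  obtain B where B: "countable B" "\<And>U x. openin T U \<Longrightarrow> x \<in> U \<Longrightarrow> \<exists>V\<in>B. x \<in> V \<and> V \<subseteq> U"
    using assms(1) unfolding second_countable_def by metis
  define j :: "'a \<Rightarrow> nat \<Rightarrow> real" where "j = (\<lambda>x i. if x \<in> from_nat_into B i then 1 else 0)"
  have "x = y" if x: "x \<in> topspace T" and y: "y \<in> topspace T" and eq: "j x = j y" for x y
  proof (rule ccontr)
    assume "x \<noteq> y"
    then obtain U W where U: "openin T U" "x \<in> U" "openin T W" "y \<in> W" "disjnt U W"
      using assms(2) x y unfolding Hausdorff_space_def by metis
    obtain V where V: "V \<in> B" "x \<in> V" "V \<subseteq> U" using B(2) U by metis
    obtain i where i: "from_nat_into B i = V"
      using from_nat_into_surj[OF B(1) V(1)] by blast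
    have "y \<in> V" using fun_cong[OF eq, of i] V i by (simp add: j_def split: if_splits)
    then show False using V U by (auto simp: disjnt_def)
  qed
  then show ?thesis using that[of j] by (auto intro: inj_onI)
qed

theorem nci_by_imp_nci:
  assumes "manifold M" "nci_by M \<Xi> X L F"
  shows "nci M \<Xi> X"
proof -
  have L: "manifold L" using assms(2) by (simp add: nci_by_def)
  then obtain j :: "_ \<Rightarrow> nat \<Rightarrow> real" where "inj_on j (mcarrier L)"
    using second_countable_inj unfolding manifold_def by metis
  then show ?thesis
    using nci_by_transport[OF L _ assms] unfolding nci_def by blast
qed

end

theory Submission
  imports Defs
begin

text \<open>
  Complete solutions and integrals of motion are two descriptions of one local diffeomorphism. Inverting
  \<open>\<Sigma> : N \<times> \<Lambda> \<rightarrow> M\<close> locally and projecting to \<open>\<Lambda>\<close> gives \<open>F\<close>; conversely, if \<open>F\<close> is transverse to \<open>\<Pi>\<close>, then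
  \<open>(\<Pi>, F)\<close> is a local diffeomorphism, and \<open>\<Sigma>\<close> is its local inverse. Either way
  \<open>Ker F\<^sub>* = \<Sigma>\<^sub>*(TN \<times> 0)\<close>, and this is the tangent space of the solution \<open>\<sigma>\<^sub>\<lambda>\<close> through the point. All
  the conditions can be read off from this identity:

  \<^item> the sections \<open>\<sigma>\<^sub>\<lambda>\<close> are isotropic iff \<open>F\<close> is;
  \<^item> a section of \<open>\<Pi>\<close> solves the Hamilton-Jacobi equation iff \<open>X\<^sub>H\<close> is tangent to it, so all \<open>\<sigma>\<^sub>\<lambda>\<close> are
    solutions iff \<open>X\<^sub>H\<close> lies in \<open>Ker F\<^sub>*\<close>;
  \<^item> \<open>\<Sigma>\<^sup>*\<Xi>\<close> being the transported tensor, \<open>\<Sigma>\<^sub>*\<close> carries \<open>(\<Sigma>\<^sup>*\<Xi>)\<^sup>\<sharp>((TN \<times> 0)\<^sup>0)\<close> onto \<open>\<Xi>\<^sup>\<sharp>((Ker F\<^sub>*)\<^sup>0)\<close>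
    (\<open>sharp_ann_pullback\<close>), and \<open>\<Sigma>\<close> and its inverse carry integral submanifolds of one to integral
    submanifolds of the other (\<open>integral_submanifold_transport\<close>).

  The first direction is \<open>complete_solution_imp_nci\<close>. The converse rests on
  \<open>adapted_chart_imp_complete_solution\<close>, where \<open>\<Sigma>\<close> is written down in a coordinate system of \<open>M\<close> whose
  first coordinates come from \<open>\<Pi>\<close> and whose last coordinates come from \<open>F\<close>. When no \<open>\<Pi>\<close> is given, the
  coordinates of \<open>F\<close> are completed to a coordinate system and the added ones define a transverse
  fibration.

  The remainder is the differential geometry on which this rests. Two facts carry it. Tangent vectors,
  which are derivations, are determined by their values on coordinates (\<open>tangent_expansion\<close>); this is
  Hadamard's lemma. Functions with independent differentials can be completed to coordinates
  (\<open>complete_to_chart\<close>); this replaces the inverse function theorem and is proved by exchanging one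
  coordinate at a time, so that the implicit function theorem is needed only for one unknown
  (\<open>coordinate_change\<close>). Working coordinate by coordinate also suits spaces whose dimension is a number
  and not a type: the chain rule and Hadamard's lemma are proved in the same way, from continuous
  partial derivatives.
\<close>

section \<open>Calculus on coordinate spaces\<close>

text \<open>Cubes instead of balls: replacing one coordinate of a point of a cube by another value of the
  interval stays in the cube, and a cube is a product of cubes in complementary coordinates.\<close>

definition cube :: "nat \<Rightarrow> (nat \<Rightarrow> real) \<Rightarrow> real \<Rightarrow> (nat \<Rightarrow> real) set"
  where "cube n p e = {x \<in> topspace (Euclidean_space n). \<forall>i<n. \<bar>x i - p i\<bar> < e}"

lemma Euclidean_space_eq_top_of_set:
  "Euclidean_space n = top_of_set (topspace (Euclidean_space n))"
  by (simp add: Euclidean_space_def euclidean_product_topology)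

lemma openin_Euclidean_iff:
  "openin (Euclidean_space n) W \<longleftrightarrow> (\<exists>T. open T \<and> W = topspace (Euclidean_space n) \<inter> T)"
  by (metis Euclidean_space_eq_top_of_set openin_open)

lemma subtopology_Euclidean:
  assumes "W \<subseteq> topspace (Euclidean_space n)"
  shows "subtopology (Euclidean_space n) W = top_of_set W"
  by (metis Euclidean_space_eq_top_of_set assms inf.absorb_iff2 subtopology_subtopology)

lemma continuous_on_coord: "continuous_on W (\<lambda>x::nat \<Rightarrow> real. x i)"
  by (rule continuous_on_product_then_coordinatewise) (rule continuous_on_id)

lemma openin_cube: "openin (Euclidean_space n) (cube n p e)"
proof -
  have "open {x::nat \<Rightarrow> real. \<bar>x i - p i\<bar> < e}" for i
    by (intro open_Collect_less continuous_intros continuous_on_coord)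
  then have "open (\<Inter>i<n. {x::nat \<Rightarrow> real. \<bar>x i - p i\<bar> < e})" by (intro open_INT) auto
  then show ?thesis
    unfolding openin_Euclidean_iff cube_def by (intro exI conjI) auto
qed

lemma cube_self: "p \<in> topspace (Euclidean_space n) \<Longrightarrow> e > 0 \<Longrightarrow> p \<in> cube n p e"
  by (simp add: cube_def)

lemma openin_contains_cube:
  assumes "openin (Euclidean_space n) W" "p \<in> W"
  obtains e where "e > 0" "cube n p e \<subseteq> W"
proof -
  obtain T where T: "open T" "W = topspace (Euclidean_space n) \<inter> T"
    using assms(1) openin_Euclidean_iff by blast
  then have "openin (product_topology (\<lambda>i. euclidean) UNIV) T" "p \<in> T"
    using assms(2) by (auto simp: euclidean_product_topology)
  then obtain X where X: "p \<in> Pi\<^sub>E UNIV X" "\<And>i. openin euclideanreal (X i)" "Pi\<^sub>E UNIV X \<subseteq> T"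
    using product_topology_open_contains_basis[of "\<lambda>i. euclideanreal" UNIV T p] by auto
  have "\<exists>e>0. ball (p i) e \<subseteq> X i" for i
    using X(1,2) by (metis PiE_mem UNIV_I open_contains_ball open_openin)
  then obtain \<epsilon> where e: "\<And>i. \<epsilon> i > 0" "\<And>i. ball (p i) (\<epsilon> i) \<subseteq> X i" by metis
  define d where "d = Min (insert 1 (\<epsilon> ` {..<n}))"
  have d: "d > 0" "\<And>i. i < n \<Longrightarrow> d \<le> \<epsilon> i" using e by (auto simp: d_def)
  have "x \<in> T" if x: "x \<in> cube n p d" for x
  proof -
    have "x i \<in> X i" for i
    proof (cases "i < n")
      case True
      then have "\<bar>x i - p i\<bar> < \<epsilon> i" using x d(2)[OF True] by (force simp: cube_def)
      then show ?thesis using e(2)[of i] by (auto simp: dist_real_def abs_minus_commute subset_iff)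
    next
      case False
      then have "x i = p i"
        using x assms(2) T(2) by (auto simp: cube_def topspace_Euclidean_space)
      then show ?thesis using X(1) by auto
    qed
    then show ?thesis using X(3) by (auto simp: PiE_def)
  qed
  then show ?thesis using that[OF d(1)] T(2) by (auto simp: cube_def)
qed

lemma upd_in_Euclidean:
  "x \<in> topspace (Euclidean_space n) \<Longrightarrow> i < n \<Longrightarrow> x(i := t) \<in> topspace (Euclidean_space n)"
  by (auto simp: topspace_Euclidean_space)

lemma openin_Euclidean_space_sub: "openin (Euclidean_space n) W \<Longrightarrow> x \<in> W \<Longrightarrow> x \<in> topspace (Euclidean_space n)"
  using openin_subset by blast

lemma eventually_upd_in:
  assumes "openin (Euclidean_space n) W" "x \<in> W" "i < n"
  shows "\<forall>\<^sub>F t in nhds (x i). x(i := t) \<in> W"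
proof -
  obtain e where e: "e > 0" "cube n x e \<subseteq> W" using openin_contains_cube[OF assms(1,2)] .
  have "\<forall>\<^sub>F t in nhds (x i). t \<in> ball (x i) e"
    using e(1) by (intro eventually_nhds_in_open) auto
  then show ?thesis
  proof eventually_elim
    case (elim t)
    then have "x(i := t) \<in> cube n x e"
      using upd_in_Euclidean openin_Euclidean_space_sub[OF assms(1,2)] assms(3) e(1)
      by (auto simp: cube_def dist_real_def abs_minus_commute)
    then show ?case using e(2) by auto
  qed
qed

subsection \<open>Smoothness classes\<close>

lemma Ck_on_0: "openin (Euclidean_space n) W \<Longrightarrow> Ck_on 0 n W f \<longleftrightarrow> continuous_on W f"
  by (simp add: subtopology_Euclidean openin_subset)

lemma Ck_on_imp_continuous: "openin (Euclidean_space n) W \<Longrightarrow> Ck_on k n W f \<Longrightarrow> continuous_on W f"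
  by (cases k) (simp_all add: subtopology_Euclidean openin_subset)

lemma Ck_on_SucD:
  assumes "Ck_on (Suc k) n W f" "i < n"
  shows "x \<in> W \<Longrightarrow> ((\<lambda>t. f (x(i := t))) has_real_derivative partial_deriv i f x) (at (x i))"
    and "Ck_on k n W (partial_deriv i f)"
proof -
  assume "x \<in> W"
  then have "(\<lambda>t. f (x(i := t))) field_differentiable (at (x i))" using assms by simp
  then show "((\<lambda>t. f (x(i := t))) has_real_derivative partial_deriv i f x) (at (x i))"
    unfolding partial_deriv_def by (rule field_differentiable_derivI)
qed (use assms in simp)

lemma partial_deriv_eqI:
  "((\<lambda>t. f (x(i := t))) has_real_derivative d) (at (x i)) \<Longrightarrow> partial_deriv i f x = d"
  unfolding partial_deriv_def by (rule DERIV_imp_deriv)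

lemma Ck_on_SucI:
  assumes "openin (Euclidean_space n) W" "continuous_on W f"
    and "\<And>i x. i < n \<Longrightarrow> x \<in> W \<Longrightarrow> ((\<lambda>t. f (x(i := t))) has_real_derivative d i x) (at (x i))"
    and "\<And>i. i < n \<Longrightarrow> Ck_on k n W (d i)"
  shows "Ck_on (Suc k) n W f"
proof -
  have "Ck_on k n W (partial_deriv i f)" if i: "i < n" for i
    by (rule Ck_on_cong_subset[OF assms(4)[OF i] assms(1) subset_refl])
      (simp add: partial_deriv_eqI[OF assms(3)[OF i]])
  moreover have "continuous_map (subtopology (Euclidean_space n) W) euclideanreal f"
    using assms(1,2) by (simp add: subtopology_Euclidean openin_subset)
  moreover have "(\<lambda>t. f (x(i := t))) field_differentiable (at (x i))" if "i < n" "x \<in> W" for i x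
    using assms(3)[OF that] unfolding field_differentiable_def by blast
  ultimately show ?thesis
    unfolding Ck_on.simps by blast
qed

text \<open>From here on \<open>Ck_on_SucD\<close> and \<open>Ck_on_SucI\<close> take the place of the recursive equation, which
  as a rewrite rule unfolds smoothness hypotheses into partial derivatives of every order.\<close>

declare Ck_on.simps(2) [simp del]

lemma Ck_on_mono: "Ck_on k n W f \<Longrightarrow> j \<le> k \<Longrightarrow> Ck_on j n W f"
proof (induction k)
  case (Suc k)
  then show ?case using Ck_on_Suc[of k] by (cases "j = Suc k") simp_all
qed simp

lemma Cinf_onD: "Cinf_on n W f \<Longrightarrow> Ck_on k n W f"
  by (simp add: Cinf_on_def)

lemma Cinf_on_continuous: "openin (Euclidean_space n) W \<Longrightarrow> Cinf_on n W f \<Longrightarrow> continuous_on W f"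
  by (rule Ck_on_imp_continuous[OF _ Cinf_onD])

lemma Cinf_on_partial: "Cinf_on n W f \<Longrightarrow> i < n \<Longrightarrow> Cinf_on n W (partial_deriv i f)"
  unfolding Cinf_on_def by (intro allI Ck_on_SucD(2)) (erule spec)

lemma Cinf_on_subset: "Cinf_on n W f \<Longrightarrow> openin (Euclidean_space n) W' \<Longrightarrow> W' \<subseteq> W \<Longrightarrow> Cinf_on n W' f"
  by (erule Cinf_on_cong_subset) auto

lemma Ck_on_locally:
  assumes W: "openin (Euclidean_space n) W"
    and loc: "\<And>x. x \<in> W \<Longrightarrow> \<exists>V. openin (Euclidean_space n) V \<and> x \<in> V \<and> Ck_on k n V f"
  shows "Ck_on k n W f"
  using loc
proof (induction k arbitrary: f)
  have cont: "continuous_on W f"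
    if loc: "\<And>x. x \<in> W \<Longrightarrow> \<exists>V. openin (Euclidean_space n) V \<and> x \<in> V \<and> continuous_on V f"
    for f :: "(nat \<Rightarrow> real) \<Rightarrow> real"
    unfolding continuous_on_eq_continuous_within
  proof
    fix x assume x: "x \<in> W"
    then obtain V where V: "openin (Euclidean_space n) V" "x \<in> V" "continuous_on V f"
      using loc[OF x] by blast
    then obtain T where T: "open T" "V = topspace (Euclidean_space n) \<inter> T"
      using openin_Euclidean_iff by blast
    obtain T' where T': "open T'" "W = topspace (Euclidean_space n) \<inter> T'"
      using W openin_Euclidean_iff by blast
    have "at x within W = at x within V"
      by (rule at_within_nhd[of x "T \<inter> T'"]) (use T T' x V(2) in auto)
    then show "continuous (at x within W) f"
      using V(2,3) by (simp add: continuous_on_eq_continuous_within)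
  qed
  {
    case 0
    then show ?case using cont[of f] W by (metis Ck_on_0)
  next
    case (Suc k)
    show ?case
    proof (rule Ck_on_SucI[OF W, where d = "\<lambda>i. partial_deriv i f"])
      show "continuous_on W f"
      proof (rule cont)
        fix x assume "x \<in> W"
        then obtain V where "openin (Euclidean_space n) V" "x \<in> V" "Ck_on (Suc k) n V f"
          using Suc.prems[of x] by blast
        then show "\<exists>V. openin (Euclidean_space n) V \<and> x \<in> V \<and> continuous_on V f"
          by (intro exI[of _ V] conjI Ck_on_imp_continuous)
      qed
      fix i assume i: "i < n"
      show "((\<lambda>t. f (x(i := t))) has_real_derivative partial_deriv i f x) (at (x i))"
        if x: "x \<in> W" for x
      proof -
        obtain V where "x \<in> V" "Ck_on (Suc k) n V f" using Suc.prems[OF x] by blast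
        then show ?thesis using Ck_on_SucD(1)[OF _ i] by simp
      qed
      show "Ck_on k n W (partial_deriv i f)"
      proof (rule Suc.IH)
        fix x assume "x \<in> W"
        then obtain V where "openin (Euclidean_space n) V" "x \<in> V" "Ck_on (Suc k) n V f"
          using Suc.prems[of x] by blast
        then show "\<exists>V. openin (Euclidean_space n) V \<and> x \<in> V \<and> Ck_on k n V (partial_deriv i f)"
          by (intro exI[of _ V] conjI Ck_on_SucD(2)[OF _ i])
      qed
    qed
  }
qed

lemma Cinf_on_locally:
  assumes "openin (Euclidean_space n) W"
    and "\<And>x. x \<in> W \<Longrightarrow> \<exists>V. openin (Euclidean_space n) V \<and> x \<in> V \<and> Cinf_on n V f"
  shows "Cinf_on n W f"
  unfolding Cinf_on_def
proof
  fix k show "Ck_on k n W f"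
    by (rule Ck_on_locally[OF assms(1)]) (use assms(2) in \<open>auto simp: Cinf_on_def\<close>)
qed

lemma Cinf_on_coord: "openin (Euclidean_space n) W \<Longrightarrow> Cinf_on n W (\<lambda>x. x i)"
proof -
  assume W: "openin (Euclidean_space n) W"
  have "Ck_on k n W (\<lambda>x. x i)" for k
  proof (cases k)
    case 0
    then show ?thesis using Ck_on_0[OF W] continuous_on_coord by blast
  next
    case (Suc j)
    show ?thesis unfolding Suc
    proof (rule Ck_on_SucI[OF W, where d = "\<lambda>l x. if l = i then 1 else 0"])
      show "((\<lambda>t. (x(l := t)) i) has_real_derivative (if l = i then 1 else 0)) (at (x l))" for l and x :: "nat \<Rightarrow> real"
        by (cases "l = i") (auto intro!: derivative_eq_intros)
    qed (use Cinf_onD[OF Cinf_on_const] continuous_on_coord in auto)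
  qed
  then show ?thesis by (simp add: Cinf_on_def)
qed

lemma Ck_on_const: "Ck_on k n W (\<lambda>x. c)"
  using Cinf_on_const Cinf_onD by blast

lemma Ck_on_sum:
  assumes "openin (Euclidean_space n) W" "\<And>i. i \<in> A \<Longrightarrow> Ck_on k n W (f i)"
  shows "Ck_on k n W (\<lambda>x. \<Sum>i\<in>A. f i x)"
  using assms(2)
  by (induction A rule: infinite_finite_induct) (auto intro: Ck_on_const Ck_on_add[OF assms(1)] simp del: Ck_on.simps)

lemma Ck_on_inverse:
  assumes W: "openin (Euclidean_space n) W" and f: "Ck_on k n W f" and nz: "\<And>x. x \<in> W \<Longrightarrow> f x \<noteq> 0"
  shows "Ck_on k n W (\<lambda>x. inverse (f x))"
  using f
proof (induction k)
  case 0
  then show ?case using nz unfolding Ck_on_0[OF W] by (intro continuous_intros) auto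
next
  case (Suc k)
  note IH = Suc.IH[OF Ck_on_Suc[OF Suc.prems]]
  show ?case
  proof (rule Ck_on_SucI[OF W, where d = "\<lambda>i x. (-1) * (partial_deriv i f x * (inverse (f x) * inverse (f x)))"])
    show "continuous_on W (\<lambda>x. inverse (f x))"
      using nz Ck_on_imp_continuous[OF W Suc.prems] by (intro continuous_intros) auto
    fix i assume i: "i < n"
    then show "Ck_on k n W (\<lambda>x. (-1) * (partial_deriv i f x * (inverse (f x) * inverse (f x))))"
      by (intro Ck_on_mult[OF W] IH Ck_on_const Ck_on_SucD(2)[OF Suc.prems])
    fix x assume x: "x \<in> W"
    show "((\<lambda>t. inverse (f (x(i := t)))) has_real_derivative
        (-1) * (partial_deriv i f x * (inverse (f x) * inverse (f x)))) (at (x i))"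
      using DERIV_inverse'[OF Ck_on_SucD(1)[OF Suc.prems i x]] nz[OF x] by (simp add: mult_ac del: fun_upd_apply)
  qed
qed

subsection \<open>Chain rule\<close>

text \<open>Caratheodory's form of the derivative, with increments measured by another differentiable function
  \<open>u\<close>: this is the shape in which the mean value theorem delivers difference quotients below.\<close>

lemma has_derivative_of_increments:
  assumes u: "(u has_real_derivative u') (at t0)" and r: "(r \<longlongrightarrow> r0) (at t0)"
    and ev: "\<forall>\<^sub>F t in at t0. F t - F t0 = r t * (u t - u t0)"
  shows "(F has_real_derivative r0 * u') (at (t0::real))"
  unfolding has_field_derivative_iff
proof (rule Lim_transform_eventually)
  show "((\<lambda>t. r t * ((u t - u t0) / (t - t0))) \<longlongrightarrow> r0 * u') (at t0)"
    using u r unfolding has_field_derivative_iff by (rule tendsto_mult[rotated])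
  show "\<forall>\<^sub>F t in at t0. r t * ((u t - u t0) / (t - t0)) = (F t - F t0) / (t - t0)"
    using ev by eventually_elim simp
qed

lemma mvt_coordinate:
  assumes f: "Ck_on (Suc 0) n (cube n p e) f" and i: "i < n"
    and a: "x(i := a) \<in> cube n p e" and b: "x(i := b) \<in> cube n p e"
  shows "\<exists>\<xi>. \<bar>\<xi> - a\<bar> \<le> \<bar>b - a\<bar> \<and> x(i := \<xi>) \<in> cube n p e \<and>
    f (x(i := b)) - f (x(i := a)) = partial_deriv i f (x(i := \<xi>)) * (b - a)"
proof -
  have in_cube: "x(i := t) \<in> cube n p e" if "min a b \<le> t" "t \<le> max a b" for t
  proof -
    have "\<bar>t - p i\<bar> < e" using a b that i by (auto simp: cube_def min_def max_def split: if_splits)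
    then show ?thesis
      using a i by (auto simp: cube_def topspace_Euclidean_space)
  qed
  have der: "((\<lambda>t. f (x(i := t))) has_real_derivative partial_deriv i f (x(i := t))) (at t)"
    if "min a b \<le> t" "t \<le> max a b" for t
    using Ck_on_SucD(1)[OF f i in_cube[OF that]] by simp
  consider "a < b" | "a = b" | "b < a" by linarith
  then show ?thesis
  proof cases
    case 1
    then obtain z where z: "z > a" "z < b" "f (x(i := b)) - f (x(i := a)) = (b - a) * partial_deriv i f (x(i := z))"
      using MVT2[of a b "\<lambda>t. f (x(i := t))" "\<lambda>t. partial_deriv i f (x(i := t))"] der by auto
    then show ?thesis using in_cube[of z] by (intro exI[of _ z]) auto
  next
    case 2
    then show ?thesis using a by auto
  next
    case 3
    then obtain z where z: "z > b" "z < a" "f (x(i := a)) - f (x(i := b)) = (a - b) * partial_deriv i f (x(i := z))"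
      using MVT2[of b a "\<lambda>t. f (x(i := t))" "\<lambda>t. partial_deriv i f (x(i := t))"] der by auto
    then show ?thesis using in_cube[of z] by (intro exI[of _ z]) (auto simp: algebra_simps)
  qed
qed

lemma filterlim_cubeI:
  assumes W: "openin (Euclidean_space n) W" and p: "p \<in> W"
    and lim: "\<And>i. i < n \<Longrightarrow> ((\<lambda>t. \<gamma> t i) \<longlongrightarrow> p i) F"
    and E: "\<forall>\<^sub>F t in F. \<gamma> t \<in> topspace (Euclidean_space n)"
  shows "\<forall>\<^sub>F t in F. \<gamma> t \<in> W"
proof -
  obtain e where e: "e > 0" "cube n p e \<subseteq> W" using openin_contains_cube[OF W p] .
  have "\<forall>\<^sub>F t in F. \<forall>i\<in>{..<n}. \<bar>\<gamma> t i - p i\<bar> < e"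
    by (rule eventually_ball_finite)
      (use lim e(1) in \<open>auto simp: tendsto_iff dist_real_def\<close>)
  then show ?thesis
    using E by eventually_elim (use e(2) in \<open>auto simp: cube_def\<close>)
qed

lemma tendsto_compose_Euclidean:
  assumes W: "openin (Euclidean_space n) W" and p: "p \<in> W" and g: "continuous_on W g"
    and lim: "\<And>i. i < n \<Longrightarrow> ((\<lambda>t. \<gamma> t i) \<longlongrightarrow> p i) F"
    and E: "\<forall>\<^sub>F t in F. \<gamma> t \<in> topspace (Euclidean_space n)"
  shows "((\<lambda>t. g (\<gamma> t)) \<longlongrightarrow> (g p :: real)) F"
proof (rule topological_tendstoI)
  fix S assume S: "open S" "g p \<in> S"
  obtain T where T: "open T" "W \<inter> T = W \<inter> g -` S"
    using g S(1) unfolding continuous_on_open_invariant by (metis Int_commute)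
  obtain T' where T': "open T'" "W = topspace (Euclidean_space n) \<inter> T'"
    using W openin_Euclidean_iff by blast
  have "openin (Euclidean_space n) (W \<inter> T)"
    unfolding openin_Euclidean_iff using T(1) T' by (intro exI[of _ "T' \<inter> T"]) auto
  moreover have "p \<in> W \<inter> T" using T p S by auto
  ultimately have "\<forall>\<^sub>F t in F. \<gamma> t \<in> W \<inter> T"
    using filterlim_cubeI lim E by blast
  then show "\<forall>\<^sub>F t in F. g (\<gamma> t) \<in> S"
    by eventually_elim (use T in auto)
qed

text \<open>The coordinates of the curve are released one after the other. Each release changes \<open>f\<close> by a
  partial derivative at an intermediate point times the increment of that coordinate, and continuity
  of the partial derivative moves the intermediate point to \<open>\<gamma> t0\<close>. Thus continuous partial
  derivatives suffice, and total derivatives never appear.\<close>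

lemma chain_rule_curve:
  assumes W: "openin (Euclidean_space n) W" and f: "Ck_on (Suc 0) n W f"
    and \<gamma>0: "\<gamma> t0 \<in> W" and \<gamma>: "\<And>t. \<gamma> t \<in> topspace (Euclidean_space n)"
    and der: "\<And>i. i < n \<Longrightarrow> ((\<lambda>t. \<gamma> t i) has_real_derivative \<gamma>' i) (at t0)"
  shows "((\<lambda>t. f (\<gamma> t)) has_real_derivative (\<Sum>i<n. partial_deriv i f (\<gamma> t0) * \<gamma>' i)) (at t0)"
proof -
  define p where "p = \<gamma> t0"
  define \<delta> where "\<delta> = (\<lambda>k t i. if i < k then \<gamma> t i else p i)"
  obtain e where e: "e > 0" "cube n p e \<subseteq> W" using openin_contains_cube[OF W] \<gamma>0 p_def by metis
  have p: "p \<in> cube n p e" using \<gamma>[of t0] e(1) by (simp add: p_def cube_self)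
  have fc: "Ck_on (Suc 0) n (cube n p e) f"
    by (rule Ck_on_cong_subset[OF f openin_cube e(2)]) auto
  have lim: "((\<lambda>t. \<delta> k t i) \<longlongrightarrow> p i) (at t0)" if "i < n" for k i
    using DERIV_isCont[OF der[OF that]] unfolding isCont_def \<delta>_def p_def by (cases "i < k") auto
  have \<delta>E: "\<delta> k t \<in> topspace (Euclidean_space n)" for k t
    using \<gamma>[of t] \<gamma>[of t0] by (auto simp: \<delta>_def topspace_Euclidean_space p_def)
  have \<delta>in: "\<forall>\<^sub>F t in at t0. \<delta> k t \<in> cube n p e" for k
    by (rule filterlim_cubeI[OF openin_cube p lim]) (auto simp: \<delta>E)
  have "k \<le> n \<Longrightarrow> ((\<lambda>t. f (\<delta> k t)) has_real_derivative (\<Sum>i<k. partial_deriv i f p * \<gamma>' i)) (at t0)" for k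
  proof (induction k)
    case 0
    then show ?case by (simp add: \<delta>_def)
  next
    case (Suc k)
    then have k: "k < n" by simp
    define P where "P = (\<lambda>t \<xi>. \<bar>\<xi> - p k\<bar> \<le> \<bar>\<gamma> t k - p k\<bar> \<and>
      f (\<delta> (Suc k) t) - f (\<delta> k t) = partial_deriv k f ((\<delta> k t)(k := \<xi>)) * (\<gamma> t k - p k))"
    define \<xi> where "\<xi> = (\<lambda>t. SOME x. P t x)"
    have up: "\<delta> (Suc k) t = (\<delta> k t)(k := \<gamma> t k)" "\<delta> k t = (\<delta> k t)(k := p k)" for t
      by (auto simp: \<delta>_def fun_eq_iff)
    have "\<forall>\<^sub>F t in at t0. P t (\<xi> t)"
      using \<delta>in[of k] \<delta>in[of "Suc k"]
    proof eventually_elim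
      case (elim t)
      then have "\<exists>x. P t x"
        using mvt_coordinate[OF fc k, of "\<delta> k t" "p k" "\<gamma> t k"] up[of t] unfolding P_def by metis
      then show ?case unfolding \<xi>_def by (rule someI_ex)
    qed
    note evP = this
    have "((\<lambda>t. \<gamma> t k - p k) \<longlongrightarrow> 0) (at t0)"
      using lim[OF k, of "Suc k"] LIM_zero by (fastforce simp: \<delta>_def)
    then have "((\<lambda>t. \<xi> t - p k) \<longlongrightarrow> 0) (at t0)"
      by (rule Lim_null_comparison[rotated, OF tendsto_rabs_zero])
        (use evP in \<open>auto simp: P_def elim: eventually_mono\<close>)
    then have lim\<xi>: "(\<xi> \<longlongrightarrow> p k) (at t0)" by (simp add: LIM_zero_iff)
    have "((\<lambda>t. partial_deriv k f ((\<delta> k t)(k := \<xi> t))) \<longlongrightarrow> partial_deriv k f p) (at t0)"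
    proof (rule tendsto_compose_Euclidean[OF openin_cube p])
      show "continuous_on (cube n p e) (partial_deriv k f)"
        using Ck_on_SucD(2)[OF fc k] Ck_on_0[OF openin_cube] by blast
      show "((\<lambda>t. ((\<delta> k t)(k := \<xi> t)) i) \<longlongrightarrow> p i) (at t0)" if "i < n" for i
        using lim[OF that, of k] lim\<xi> by (cases "i = k") auto
    qed (rule always_eventually, rule allI, rule upd_in_Euclidean[OF \<delta>E k])
    then have "((\<lambda>t. f (\<delta> (Suc k) t) - f (\<delta> k t)) has_real_derivative partial_deriv k f p * \<gamma>' k) (at t0)"
    proof (rule has_derivative_of_increments[OF der[OF k]])
      have "\<delta> j t0 = p" for j by (auto simp: \<delta>_def p_def)
      then show "\<forall>\<^sub>F t in at t0. f (\<delta> (Suc k) t) - f (\<delta> k t) - (f (\<delta> (Suc k) t0) - f (\<delta> k t0)) =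
          partial_deriv k f ((\<delta> k t)(k := \<xi> t)) * (\<gamma> t k - \<gamma> t0 k)"
        using evP by (auto simp: P_def p_def elim: eventually_mono)
    qed
    from DERIV_add[OF Suc.IH this] k show ?case by simp
  qed
  from this[of n] show ?thesis
  proof -
    have "\<delta> n = \<gamma>"
      using \<gamma> \<gamma>[of t0] by (fastforce simp: \<delta>_def p_def fun_eq_iff topspace_Euclidean_space)
    then show ?thesis
      using \<open>n \<le> n \<Longrightarrow> _\<close> by (simp add: p_def)
  qed
qed

lemma continuous_on_Euclidean_map:
  assumes V: "openin (Euclidean_space n) V" and g: "\<And>x. x \<in> V \<Longrightarrow> g x \<in> topspace (Euclidean_space m)"
    and c: "\<And>i. i < m \<Longrightarrow> continuous_on V (\<lambda>x. g x i)"
  shows "continuous_on V g"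
proof (rule continuous_on_coordinatewise_then_product)
  fix i show "continuous_on V (\<lambda>x. g x i)"
  proof (cases "i < m")
    case False
    then have "g x i = 0" if "x \<in> V" for x using g[OF that] by (auto simp: topspace_Euclidean_space)
    then show ?thesis by (simp cong: continuous_on_cong)
  qed (rule c)
qed

lemma partial_deriv_compose:
  assumes V: "openin (Euclidean_space n) V" and W: "openin (Euclidean_space m) W"
    and gW: "\<And>x. x \<in> V \<Longrightarrow> g x \<in> W" and f: "Ck_on (Suc 0) m W f"
    and g: "\<And>i. i < m \<Longrightarrow> Ck_on (Suc 0) n V (\<lambda>x. g x i)" and x: "x \<in> V" and j: "j < n"
  shows "((\<lambda>t. f (g (x(j := t)))) has_real_derivative
      (\<Sum>i<m. partial_deriv i f (g x) * partial_deriv j (\<lambda>x. g x i) x)) (at (x j))"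
proof -
  define \<gamma> where "\<gamma> = (\<lambda>t i. if i < m then g (x(j := t)) i else 0)"
  have eq: "\<gamma> t = g (x(j := t))" if "x(j := t) \<in> V" for t
    using openin_Euclidean_space_sub[OF W gW[OF that]] by (auto simp: \<gamma>_def topspace_Euclidean_space fun_eq_iff)
  have eq0: "\<gamma> (x j) = g x" using eq[of "x j"] x by simp
  have "((\<lambda>t. f (\<gamma> t)) has_real_derivative
      (\<Sum>i<m. partial_deriv i f (\<gamma> (x j)) * partial_deriv j (\<lambda>x. g x i) x)) (at (x j))"
  proof (rule chain_rule_curve[OF W f])
    show "\<gamma> (x j) \<in> W" using eq0 gW[OF x] by simp
    show "\<gamma> t \<in> topspace (Euclidean_space m)" for t by (simp add: \<gamma>_def topspace_Euclidean_space)
    show "((\<lambda>t. \<gamma> t i) has_real_derivative partial_deriv j (\<lambda>x. g x i) x) (at (x j))" if "i < m" for i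
      using Ck_on_SucD(1)[OF g[OF that] j x] that by (simp add: \<gamma>_def)
  qed
  moreover have "\<forall>\<^sub>F t in nhds (x j). f (\<gamma> t) = f (g (x(j := t)))"
    using eventually_upd_in[OF V x j] by eventually_elim (simp add: eq)
  ultimately show ?thesis
    unfolding eq0 by (rule DERIV_cong_ev[OF refl _ refl, THEN iffD1, rotated])
qed

text \<open>The chain rule expresses the partial derivatives of the composite by composites and functions of
  one class less, so that induction on the class applies.\<close>

theorem Ck_on_compose:
  assumes V: "openin (Euclidean_space n) V" and W: "openin (Euclidean_space m) W"
    and gW: "\<And>x. x \<in> V \<Longrightarrow> g x \<in> W" and f: "Ck_on k m W f"
    and g: "\<And>i. i < m \<Longrightarrow> Ck_on k n V (\<lambda>x. g x i)"
  shows "Ck_on k n V (\<lambda>x. f (g x))"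
  using f g
proof (induction k arbitrary: f)
  have cont: "continuous_on V (\<lambda>x. f (g x))"
    if "continuous_on W f" "\<And>i. i < m \<Longrightarrow> continuous_on V (\<lambda>x. g x i)" for f :: "(nat \<Rightarrow> real) \<Rightarrow> real"
    by (rule continuous_on_compose2[OF that(1) continuous_on_Euclidean_map[OF V]])
      (use that gW openin_Euclidean_space_sub[OF W] in auto)
  {
    case 0
    then show ?case using cont unfolding Ck_on_0[OF V] Ck_on_0[OF W] by blast
  next
    case (Suc k)
    show ?case
    proof (rule Ck_on_SucI[OF V, where d = "\<lambda>j x. \<Sum>i<m. partial_deriv i f (g x) * partial_deriv j (\<lambda>x. g x i) x"])
      show "continuous_on V (\<lambda>x. f (g x))"
        by (rule cont[OF Ck_on_imp_continuous[OF W Suc.prems(1)] Ck_on_imp_continuous[OF V Suc.prems(2)]])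
      have 1: "Ck_on (Suc 0) m W f" "\<And>i. i < m \<Longrightarrow> Ck_on (Suc 0) n V (\<lambda>x. g x i)"
        by (rule Ck_on_mono[OF Suc.prems(1)], simp) (rule Ck_on_mono[OF Suc.prems(2)], simp_all)
      fix j assume j: "j < n"
      show "((\<lambda>t. f (g (x(j := t)))) has_real_derivative
          (\<Sum>i<m. partial_deriv i f (g x) * partial_deriv j (\<lambda>x. g x i) x)) (at (x j))" if "x \<in> V" for x
        by (rule partial_deriv_compose[OF V W gW 1 that j])
      show "Ck_on k n V (\<lambda>x. \<Sum>i<m. partial_deriv i f (g x) * partial_deriv j (\<lambda>x. g x i) x)"
      proof (intro Ck_on_sum[OF V] Ck_on_mult[OF V])
        fix i assume "i \<in> {..<m}"
        then have i: "i < m" by simp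
        show "Ck_on k n V (\<lambda>x. partial_deriv i f (g x))"
          by (rule Suc.IH[OF Ck_on_SucD(2)[OF Suc.prems(1) i] Ck_on_Suc[OF Suc.prems(2)]])
        show "Ck_on k n V (partial_deriv j (\<lambda>x. g x i))"
          by (rule Ck_on_SucD(2)[OF Suc.prems(2)[OF i] j])
      qed
    qed
  }
qed

lemma Cinf_on_compose:
  assumes "openin (Euclidean_space n) V" "openin (Euclidean_space m) W"
    and "\<And>x. x \<in> V \<Longrightarrow> g x \<in> W" "Cinf_on m W f" "\<And>i. i < m \<Longrightarrow> Cinf_on n V (\<lambda>x. g x i)"
  shows "Cinf_on n V (\<lambda>x. f (g x))"
  unfolding Cinf_on_def
proof
  fix k show "Ck_on k n V (\<lambda>x. f (g x))"
    by (rule Ck_on_compose[where f = f and g = g, OF assms(1-3) Cinf_onD[OF assms(4)] Cinf_onD[OF assms(5)]])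
qed

subsection \<open>Replacing one coordinate\<close>

lemma openin_pos:
  assumes W: "openin (Euclidean_space n) W" and g: "continuous_on W (g :: _ \<Rightarrow> real)"
  shows "openin (Euclidean_space n) {x\<in>W. g x > 0}"
proof -
  have "openin (top_of_set W) (W \<inter> g -` {0<..})"
    using g continuous_on_open_gen[of g W UNIV] by (auto simp: open_greaterThan)
  then have "openin (Euclidean_space n) (W \<inter> g -` {0<..})"
    using W by (metis openin_trans_full openin_subset subtopology_Euclidean)
  moreover have "W \<inter> g -` {0<..} = {x\<in>W. g x > 0}" by auto
  ultimately show ?thesis by simp
qed

lemma openin_Euclidean_preimage:
  assumes V: "openin (Euclidean_space n) V" and W: "openin (Euclidean_space m) W"
    and g: "\<And>x. x \<in> V \<Longrightarrow> g x \<in> topspace (Euclidean_space m)"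
    and c: "\<And>i. i < m \<Longrightarrow> continuous_on V (\<lambda>x. g x i)"
  shows "openin (Euclidean_space n) {x\<in>V. g x \<in> W}"
proof -
  obtain T where T: "open T" "W = topspace (Euclidean_space m) \<inter> T"
    using W openin_Euclidean_iff by blast
  have "openin (top_of_set V) (V \<inter> g -` T)"
    by (rule continuous_openin_preimage_gen[OF continuous_on_Euclidean_map[OF V g c] T(1)])
  then have "openin (Euclidean_space n) (V \<inter> g -` T)"
    using V by (metis openin_trans_full openin_subset subtopology_Euclidean)
  moreover have "V \<inter> g -` T = {x\<in>V. g x \<in> W}" using T(2) g by auto
  ultimately show ?thesis by simp
qed

lemma continuous_on_openinI:
  assumes "\<And>x \<epsilon>. x \<in> W \<Longrightarrow> \<epsilon> > 0 \<Longrightarrow>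
      \<exists>V. openin (Euclidean_space n) V \<and> x \<in> V \<and> (\<forall>y\<in>V \<inter> W. \<bar>g y - g x\<bar> < \<epsilon>)"
    and W: "W \<subseteq> topspace (Euclidean_space n)"
  shows "continuous_on W (g :: _ \<Rightarrow> real)"
  unfolding continuous_on_eq_continuous_within continuous_within
proof (intro ballI tendstoI)
  fix x and \<epsilon> :: real assume x: "x \<in> W" and e: "\<epsilon> > 0"
  obtain V where V: "openin (Euclidean_space n) V" "x \<in> V" "\<And>y. y \<in> V \<inter> W \<Longrightarrow> \<bar>g y - g x\<bar> < \<epsilon>"
    using assms(1)[OF x e] by blast
  obtain T where "open T" "V = topspace (Euclidean_space n) \<inter> T"
    using V(1) openin_Euclidean_iff by blast
  then show "\<forall>\<^sub>F y in at x within W. dist (g y) (g x) < \<epsilon>"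
    unfolding eventually_at_topological using V W
    by (intro exI[of _ T]) (auto simp: dist_real_def)
qed

text \<open>The one step of the inverse function theorem that needs analysis: exchanging a single coordinate.
  On a cube where \<open>partial_deriv i f\<close> keeps its sign, \<open>f\<close> is strictly monotone in the \<open>i\<close>-th
  coordinate, so the map is injective; the intermediate value theorem makes its image open and its
  inverse \<open>\<eta>\<close> continuous. By the mean value theorem the \<open>i\<close>-th component of \<open>\<eta>\<close> has the partial
  derivatives \<open>-\<partial>\<^sub>j f / \<partial>\<^sub>i f\<close> for \<open>j \<noteq> i\<close> and \<open>1 / \<partial>\<^sub>i f\<close> for \<open>j = i\<close>, taken at \<open>\<eta> y\<close>; as they are
  composites with \<open>\<eta>\<close>, the inverse gains one class of smoothness at a time.\<close>

theorem coordinate_change: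
  assumes W: "openin (Euclidean_space n) W" and f: "Cinf_on n W f" and p: "p \<in> W"
    and i: "i < n" and nz: "partial_deriv i f p \<noteq> 0"
  obtains C \<eta> where "openin (Euclidean_space n) C" "p \<in> C" "C \<subseteq> W"
    "openin (Euclidean_space n) ((\<lambda>x. x(i := f x)) ` C)"
    "\<And>x. x \<in> C \<Longrightarrow> \<eta> (x(i := f x)) = x"
    "\<And>j. Cinf_on n ((\<lambda>x. x(i := f x)) ` C) (\<lambda>y. \<eta> y j)"
proof -
  define s where "s = sgn (partial_deriv i f p)"
  have s: "s * partial_deriv i f p > 0" "s * s = 1"
    using nz by (auto simp: s_def sgn_if)
  have "openin (Euclidean_space n) {x\<in>W. s * partial_deriv i f x > 0}"
    by (intro openin_pos[OF W] continuous_intros Cinf_on_continuous[OF W] Cinf_on_partial[OF f i])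
  then obtain e where e: "e > 0" "cube n p e \<subseteq> {x\<in>W. s * partial_deriv i f x > 0}"
    using openin_contains_cube p s by (metis (no_types, lifting) mem_Collect_eq)
  define C where "C = cube n p e"
  have C: "openin (Euclidean_space n) C" "p \<in> C" "C \<subseteq> W"
    and pos: "\<And>x. x \<in> C \<Longrightarrow> s * partial_deriv i f x > 0"
    using e openin_cube cube_self openin_Euclidean_space_sub[OF W p] unfolding C_def by auto
  have fC: "Cinf_on n C f" by (rule Cinf_on_subset[OF f C(1,3)])
  note mvt = mvt_coordinate[OF fC[unfolded C_def, THEN Cinf_onD] i, folded C_def]
  have mono: "s * f (x(i := a)) < s * f (x(i := b))"
    if ab: "x(i := a) \<in> C" "x(i := b) \<in> C" "a < b" for x a b
  proof -
    obtain \<xi> where \<xi>: "x(i := \<xi>) \<in> C" "f (x(i := b)) - f (x(i := a)) = partial_deriv i f (x(i := \<xi>)) * (b - a)"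
      using mvt[where x = x and a = a and b = b, OF ab(1,2)] by (elim exE conjE) (rule that)
    have "s * f (x(i := b)) - s * f (x(i := a)) = s * partial_deriv i f (x(i := \<xi>)) * (b - a)"
      by (simp only: right_diff_distrib[symmetric] \<xi>(2) mult.assoc)
    also have "\<dots> > 0" using pos[OF \<xi>(1)] ab(3) by simp
    finally show ?thesis by simp
  qed
  define \<theta> where "\<theta> = (\<lambda>x. x(i := f x))"
  define \<eta> where "\<eta> = inv_into C \<theta>"
  have inj: "inj_on \<theta> C"
  proof (rule inj_onI)
    fix x y assume xy: "x \<in> C" "y \<in> C" "\<theta> x = \<theta> y"
    have off: "x k = y k" if "k \<noteq> i" for k
      using fun_cong[OF xy(3), of k] that by (simp add: \<theta>_def)
    have fe: "f x = f y" using fun_cong[OF xy(3), of i] by (simp add: \<theta>_def)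
    have eqs: "x(i := x i) = x" "x(i := y i) = y" using off by (auto simp: fun_eq_iff)
    have eq: "x = y" if "x i = y i" using off that by (metis ext)
    have "\<not> x i < y i" "\<not> y i < x i"
      using mono[of x "x i" "y i", unfolded eqs] mono[of x "y i" "x i", unfolded eqs] xy(1,2) fe by auto
    then show "x = y" using eq by linarith
  qed
  have \<eta>\<theta>: "\<eta> (\<theta> x) = x" if "x \<in> C" for x using inj that by (simp add: \<eta>_def)
  define D where "D = \<theta> ` C"
  have \<eta>C: "\<eta> y \<in> C" "\<theta> (\<eta> y) = y" if "y \<in> D" for y
    using that \<eta>\<theta> by (auto simp: D_def)
  have \<eta>f: "\<eta> y = y(i := \<eta> y i)" "f (\<eta> y) = y i" if "y \<in> D" for y
  proof -
    have 1: "(\<eta> y)(i := f (\<eta> y)) = y" using \<eta>C(2)[OF that] by (simp only: \<theta>_def)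
    show "f (\<eta> y) = y i" using fun_cong[OF 1, of i] by simp
    have "\<eta> y l = (y(i := \<eta> y i)) l" for l using fun_cong[OF 1, of l] by (cases "l = i") auto
    then show "\<eta> y = y(i := \<eta> y i)" by (rule ext)
  qed
  \<comment> \<open>By the intermediate value theorem the image contains a neighbourhood on which the inverse varies by at most \<open>\<delta>\<close>.\<close>
  have bracket: "\<exists>V. openin (Euclidean_space n) V \<and> \<theta> x0 \<in> V \<and> V \<subseteq> D \<and> (\<forall>y\<in>V. \<bar>\<eta> y i - x0 i\<bar> \<le> \<delta>)"
    if x0: "x0 \<in> C" and d: "\<delta> > 0" and ab: "x0(i := x0 i - \<delta>) \<in> C" "x0(i := x0 i + \<delta>) \<in> C" for x0 \<delta>
  proof -
    define a where "a = x0 i - \<delta>"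
    define b where "b = x0 i + \<delta>"
    let ?E = "topspace (Euclidean_space n)"
    define V1 where "V1 = (\<lambda>c. {y\<in>?E. y(i := c) \<in> C})"
    have up: "continuous_on A (\<lambda>y. (y(i := c)) j)" for A and c :: real and j
      by (cases "j = i") (auto intro: continuous_on_coord)
    have V1: "openin (Euclidean_space n) (V1 c)" for c
      unfolding V1_def
      by (rule openin_Euclidean_preimage[OF openin_topspace C(1)]) (use upd_in_Euclidean i up in auto)
    have cf: "continuous_on (V1 c) (\<lambda>y. f (y(i := c)))" for c
    proof (rule continuous_on_compose2[OF Cinf_on_continuous[OF C(1) fC]])
      show "continuous_on (V1 c) (\<lambda>y. y(i := c))"
        by (rule continuous_on_coordinatewise_then_product) (rule up)
    qed (auto simp: V1_def)
    define Va where "Va = {y\<in>V1 a. s * y i - s * f (y(i := a)) > 0}"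
    define Vb where "Vb = {y\<in>V1 b. s * f (y(i := b)) - s * y i > 0}"
    have "openin (Euclidean_space n) Va" "openin (Euclidean_space n) Vb"
      unfolding Va_def Vb_def
      by (intro openin_pos[OF V1] continuous_intros cf continuous_on_coord)+
    then have o: "openin (Euclidean_space n) (Va \<inter> Vb)" by blast
    have E: "x0 \<in> ?E" using C(1) x0 openin_Euclidean_space_sub by blast
    have "\<theta> x0 \<in> Va \<inter> Vb"
      using mono[of x0 a "x0 i"] mono[of x0 "x0 i" b] ab x0 d upd_in_Euclidean[OF E i]
      by (simp add: Va_def Vb_def V1_def \<theta>_def a_def b_def del: fun_upd_apply) simp
    moreover have "y \<in> D \<and> \<bar>\<eta> y i - x0 i\<bar> \<le> \<delta>" if y: "y \<in> Va \<inter> Vb" for y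
    proof -
      have yC: "y(i := a) \<in> C" "y(i := b) \<in> C" using y by (auto simp: Va_def Vb_def V1_def)
      have inC: "y(i := t) \<in> C" if "a \<le> t" "t \<le> b" for t
      proof -
        have "\<bar>a - p i\<bar> < e" "\<bar>b - p i\<bar> < e" using yC i by (auto simp: C_def cube_def)
        then have "\<bar>t - p i\<bar> < e" using that by linarith
        then show ?thesis
          using yC(1) i by (auto simp: C_def cube_def topspace_Euclidean_space)
      qed
      have cont: "continuous_on {a..b} (\<lambda>t. s * f (y(i := t)))"
      proof (intro continuous_intros continuous_on_compose2[OF Cinf_on_continuous[OF C(1) fC]] continuous_on_coordinatewise_then_product)
        show "continuous_on {a..b} (\<lambda>t. (y(i := t)) j)" for j
          by (cases "j = i") (auto intro: continuous_intros)
      qed (use inC in auto)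
      have "\<exists>t\<ge>a. t \<le> b \<and> s * f (y(i := t)) = s * y i"
        using IVT'[of "\<lambda>t. s * f (y(i := t))" a "s * y i" b] y cont d
        by (auto simp: Va_def Vb_def a_def b_def)
      then obtain t where t: "a \<le> t" "t \<le> b" "s * f (y(i := t)) = s * y i" by blast
      then have ft: "f (y(i := t)) = y i" using s(2) by (metis mult_cancel_left mult_zero_left zero_neq_one)
      then have "\<theta> (y(i := t)) = y" by (simp add: \<theta>_def)
      then have "y \<in> D" "\<eta> y = y(i := t)" using inC[OF t(1,2)] \<eta>\<theta> unfolding D_def by (metis imageI)+
      then show ?thesis using t(1,2) by (auto simp: a_def b_def)
    qed
    ultimately show ?thesis using o by blast
  qed
  have small: "\<exists>d>0. d < \<epsilon> \<and> x(i := x i - d) \<in> C \<and> x(i := x i + d) \<in> C" if x: "x \<in> C" and "\<epsilon> > 0" for x \<epsilon>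
  proof -
    obtain d' where d': "d' > 0" "cube n x d' \<subseteq> C" using openin_contains_cube[OF C(1) x] .
    define d where "d = min d' \<epsilon> / 2"
    have E: "x \<in> topspace (Euclidean_space n)" using C(1) x openin_Euclidean_space_sub by blast
    have d: "d > 0" "d < \<epsilon>" "d < d'" using d'(1) \<open>\<epsilon> > 0\<close> by (auto simp: d_def)
    have "x(i := x i + t) \<in> C" if "\<bar>t\<bar> < d'" for t
      using d'(2) upd_in_Euclidean[OF E i, of "x i + t"] that d'(1) by (auto simp: cube_def subset_iff)
    from this[of d] this[of "-d"] d show ?thesis by (intro exI[of _ d]) auto
  qed
  have D: "openin (Euclidean_space n) D"
  proof (subst openin_subopen, intro ballI)
    fix y assume "y \<in> D"
    then obtain x where x: "x \<in> C" "y = \<theta> x" by (auto simp: D_def)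
    obtain d where "d > 0" "x(i := x i - d) \<in> C" "x(i := x i + d) \<in> C"
      using small[OF x(1) zero_less_one] by blast
    then show "\<exists>T. openin (Euclidean_space n) T \<and> y \<in> T \<and> T \<subseteq> D"
      using bracket[OF x(1)] x(2) by blast
  qed
  have cont: "continuous_on D (\<lambda>y. \<eta> y i)"
  proof (rule continuous_on_openinI)
    fix y and \<epsilon> :: real assume y: "y \<in> D" and "\<epsilon> > 0"
    have x: "\<eta> y \<in> C" "\<theta> (\<eta> y) = y" by (rule \<eta>C[OF y])+
    obtain d where d: "d > 0" "d < \<epsilon>" "(\<eta> y)(i := \<eta> y i - d) \<in> C" "(\<eta> y)(i := \<eta> y i + d) \<in> C"
      using small[OF x(1) \<open>\<epsilon> > 0\<close>] by blast
    then obtain V where "openin (Euclidean_space n) V" "y \<in> V" "\<And>z. z \<in> V \<Longrightarrow> \<bar>\<eta> z i - \<eta> y i\<bar> \<le> d"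
      using bracket[OF x(1) d(1,3,4)] x(2) by metis
    then show "\<exists>V. openin (Euclidean_space n) V \<and> y \<in> V \<and> (\<forall>z\<in>V \<inter> D. \<bar>\<eta> z i - \<eta> y i\<bar> < \<epsilon>)"
      using d(2) by (intro exI[of _ V]) force
  qed (use D openin_subset in blast)
  define d where "d = (\<lambda>j y. ((if j = i then 1 else 0) - (if j = i then 0 else partial_deriv j f (\<eta> y)))
      * inverse (partial_deriv i f (\<eta> y)))"
  have der: "((\<lambda>t. \<eta> (y(j := t)) i) has_real_derivative d j y) (at (y j))" if y: "y \<in> D" and j: "j < n" for y j
  proof -
    define x where "x = \<eta> y"
    have xC: "x \<in> C" using \<eta>C[OF y] by (simp add: x_def)
    have xE: "x \<in> topspace (Euclidean_space n)" using C(1) xC openin_Euclidean_space_sub by blast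
    have yE: "y \<in> topspace (Euclidean_space n)" using D y openin_Euclidean_space_sub by blast
    have x: "x = y(i := x i)" "f x = y i" using \<eta>f[OF y] by (auto simp: x_def)
    \<comment> \<open>Moving from \<open>w t\<close> to \<open>\<eta> (y(j := t))\<close> changes only the \<open>i\<close>-th coordinate, from \<open>x i\<close> to \<open>h t\<close>,
        and \<open>u t\<close> is the resulting change of \<open>f\<close>; this covers \<open>j = i\<close> and \<open>j \<noteq> i\<close> at once.\<close>
    define w where "w = (\<lambda>t. (y(j := t))(i := x i))"
    define h where "h = (\<lambda>t. \<eta> (y(j := t)) i)"
    define u where "u = (\<lambda>t. (y(j := t)) i - f (w t))"
    have w: "w t = (if j = i then x else x(j := t))" for t
    proof (cases "j = i")
      case False
      have "w t = (y(i := x i))(j := t)" unfolding w_def by (rule fun_upd_twist[OF False])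
      then show ?thesis using False unfolding x(1)[symmetric] by simp
    qed (simp add: w_def x(1)[symmetric])
    have w0: "w (y j) = x" unfolding w_def fun_upd_triv by (rule x(1)[symmetric])
    have u: "(u has_real_derivative ((if j = i then 1 else 0) - (if j = i then 0 else partial_deriv j f x))) (at (y j))"
    proof (cases "j = i")
      case True
      have "u = (\<lambda>t. t - f x)" using True by (simp add: u_def w fun_eq_iff)
      then show ?thesis using True by (auto intro!: derivative_eq_intros)
    next
      case False
      have xj: "x j = y j" using x(1) False by (metis fun_upd_other)
      have "((\<lambda>t. f (x(j := t))) has_real_derivative partial_deriv j f x) (at (y j))"
        using Ck_on_SucD(1)[OF Cinf_onD[OF fC] j xC] xj by simp
      moreover have "u = (\<lambda>t. y i - f (x(j := t)))" using False by (simp add: u_def w fun_eq_iff)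
      ultimately show ?thesis using False by (auto intro!: derivative_eq_intros)
    qed
    have evD: "\<forall>\<^sub>F t in at (y j). y(j := t) \<in> D"
      using eventually_upd_in[OF D y j] by (simp add: eventually_nhds_conv_at)
    have evw: "\<forall>\<^sub>F t in at (y j). w t \<in> C"
    proof (cases "j = i")
      case False
      then have "x j = y j" using x(1) by (metis fun_upd_other)
      then show ?thesis
        using eventually_upd_in[OF C(1) xC j] False by (simp add: eventually_nhds_conv_at w)
    qed (simp add: w xC)
    have limy: "((\<lambda>t. (y(j := t)) l) \<longlongrightarrow> y l) (at (y j))" for l by (cases "l = j") auto
    have h0: "h (y j) = x i" by (simp add: h_def x_def)
    have limh: "(h \<longlongrightarrow> x i) (at (y j))"
      unfolding h_def x_def
      by (rule tendsto_compose_Euclidean[OF D y cont limy]) (intro always_eventually allI upd_in_Euclidean[OF yE j])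
    define P where "P = (\<lambda>t \<xi>. \<bar>\<xi> - x i\<bar> \<le> \<bar>h t - x i\<bar> \<and> (w t)(i := \<xi>) \<in> C \<and>
      u t = partial_deriv i f ((w t)(i := \<xi>)) * (h t - x i))"
    define \<xi> where "\<xi> = (\<lambda>t. SOME z. P t z)"
    have evP: "\<forall>\<^sub>F t in at (y j). P t (\<xi> t)"
      using evD evw
    proof eventually_elim
      case (elim t)
      have z: "(w t)(i := h t) = \<eta> (y(j := t))" using \<eta>f(1)[OF elim(1)] by (simp add: w_def h_def)
      have wt: "(w t)(i := x i) = w t" by (simp add: w_def)
      have "u t = f ((w t)(i := h t)) - f ((w t)(i := x i))"
        unfolding z wt u_def \<eta>f(2)[OF elim(1)] ..
      moreover have "(w t)(i := h t) \<in> C" "(w t)(i := x i) \<in> C" unfolding z wt using \<eta>C(1) elim by auto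
      ultimately have "\<exists>z. P t z" using mvt[of "w t" "x i" "h t"] unfolding P_def by auto
      then show ?case unfolding \<xi>_def by (rule someI_ex)
    qed
    have "((\<lambda>t. h t - x i) \<longlongrightarrow> 0) (at (y j))" using limh by (simp add: LIM_zero_iff)
    then have "((\<lambda>t. \<xi> t - x i) \<longlongrightarrow> 0) (at (y j))"
      by (rule Lim_null_comparison[rotated, OF tendsto_rabs_zero])
        (use evP in \<open>auto simp: P_def elim: eventually_mono\<close>)
    then have lim\<xi>: "(\<xi> \<longlongrightarrow> x i) (at (y j))" by (simp add: LIM_zero_iff)
    have "((\<lambda>t. partial_deriv i f ((w t)(i := \<xi> t))) \<longlongrightarrow> partial_deriv i f x) (at (y j))"
    proof (rule tendsto_compose_Euclidean[OF C(1) xC])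
      show "continuous_on C (partial_deriv i f)"
        by (rule Cinf_on_continuous[OF C(1) Cinf_on_partial[OF fC i]])
      show "((\<lambda>t. ((w t)(i := \<xi> t)) l) \<longlongrightarrow> x l) (at (y j))" for l
      proof (cases "l = i")
        case False
        then have "x l = y l" using x(1) by (metis fun_upd_other)
        then show ?thesis using False limy[of l] by (simp add: w_def)
      qed (simp add: lim\<xi>)
      have "(w t)(i := \<xi> t) \<in> topspace (Euclidean_space n)" for t
        unfolding w_def by (intro upd_in_Euclidean yE i j)
      then show "\<forall>\<^sub>F t in at (y j). (w t)(i := \<xi> t) \<in> topspace (Euclidean_space n)" by simp
    qed
    then have r: "((\<lambda>t. inverse (partial_deriv i f ((w t)(i := \<xi> t)))) \<longlongrightarrow> inverse (partial_deriv i f x)) (at (y j))"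
      by (rule tendsto_inverse) (use pos[OF xC] in auto)
    have u0: "u (y j) = 0" using w0 x(2) by (simp add: u_def)
    have ev: "\<forall>\<^sub>F t in at (y j). h t - h (y j) = inverse (partial_deriv i f ((w t)(i := \<xi> t))) * (u t - u (y j))"
      using evP
    proof eventually_elim
      case (elim t)
      then have "partial_deriv i f ((w t)(i := \<xi> t)) \<noteq> 0" using pos[of "(w t)(i := \<xi> t)"] by (auto simp: P_def)
      then show ?case using elim by (simp add: P_def h0 u0)
    qed
    show ?thesis
      using has_derivative_of_increments[OF u r ev] unfolding h_def d_def x_def by (simp only: mult.commute)
  qed
  have Ck: "Ck_on k n D (\<lambda>y. \<eta> y j)" for k j
  proof (cases "j = i")
    case False
    have e: "y j = \<eta> y j" if "y \<in> D" for y using \<eta>f(1)[OF that] False by (metis fun_upd_other)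
    show ?thesis
      by (rule Ck_on_cong_subset[OF Cinf_onD[OF Cinf_on_coord[OF D]] D subset_refl e])
  next
    case True
    have "Ck_on k n D (\<lambda>y. \<eta> y i)"
    proof (induction k)
      case 0
      then show ?case using cont Ck_on_0[OF D] by blast
    next
      case (Suc k)
      have IH: "Ck_on k n D (\<lambda>y. \<eta> y j)" for j
      proof (cases "j = i")
        case False
        have e: "y j = \<eta> y j" if "y \<in> D" for y using \<eta>f(1)[OF that] False by (metis fun_upd_other)
        show ?thesis
          by (rule Ck_on_cong_subset[OF Cinf_onD[OF Cinf_on_coord[OF D]] D subset_refl e])
      qed (use Suc in simp)
      have comp: "Ck_on k n D (\<lambda>y. partial_deriv j f (\<eta> y))" if "j < n" for j
        by (rule Ck_on_compose[OF D C(1) \<eta>C(1) Cinf_onD[OF Cinf_on_partial[OF fC that]] IH])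
      show ?case
      proof (rule Ck_on_SucI[OF D cont, where d = d])
        fix j assume j: "j < n"
        show "((\<lambda>t. \<eta> (y(j := t)) i) has_real_derivative d j y) (at (y j))" if "y \<in> D" for y
          by (rule der[OF that j])
        have inv: "Ck_on k n D (\<lambda>y. inverse (partial_deriv i f (\<eta> y)))"
          by (rule Ck_on_inverse[OF D comp[OF i]]) (use pos \<eta>C(1) in force)
        show "Ck_on k n D (d j)"
        proof (cases "j = i")
          case True
          then show ?thesis using inv by (simp add: d_def)
        next
          case False
          have "Ck_on k n D (\<lambda>y. (- 1) * (partial_deriv j f (\<eta> y) * inverse (partial_deriv i f (\<eta> y))))"
            by (intro Ck_on_mult[OF D] Ck_on_const comp[OF j] inv)
          then show ?thesis using False by (simp add: d_def)
        qed
      qed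
    qed
    then show ?thesis using True by simp
  qed
  show ?thesis
    by (rule that[of C \<eta>]) (use C D \<eta>\<theta> Ck in \<open>simp_all add: D_def \<theta>_def Cinf_on_def\<close>)
qed

subsection \<open>Hadamard's lemma\<close>

text \<open>The quotient is the integral of \<open>partial_deriv i f\<close> along the segment from \<open>x(i := p i)\<close> to \<open>x\<close>,
  by the fundamental theorem of calculus; its smoothness is differentiation under the integral.\<close>

lemma Cinf_division:
  assumes f: "Cinf_on n (cube n p e) f" and i: "i < n"
  obtains h where "Cinf_on n (cube n p e) h"
    "\<And>x. x \<in> cube n p e \<Longrightarrow> f x = f (x(i := p i)) + (x i - p i) * h x"
proof -
  define C where "C = cube n p e"
  have C: "openin (Euclidean_space n) C" by (simp add: C_def openin_cube)
  have fC: "Cinf_on n C f" using f by (simp add: C_def)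
  define c where "c = (\<lambda>x s. x(i := p i + s * (x i - p i)))"
  have cC: "c x s \<in> C" if x: "x \<in> C" and s: "s \<in> cbox 0 (1::real)" for x s
  proof -
    have "\<bar>s * (x i - p i)\<bar> \<le> 1 * \<bar>x i - p i\<bar>"
      unfolding abs_mult using s by (intro mult_right_mono) auto
    then have "\<bar>s * (x i - p i)\<bar> < e" using x i by (auto simp: C_def cube_def)
    then show ?thesis
      using x i by (auto simp: c_def C_def cube_def topspace_Euclidean_space)
  qed
  have c_cont: "continuous_on A (\<lambda>(x, s). c x s)" for A
    unfolding split_beta
  proof (rule continuous_on_coordinatewise_then_product)
    have x: "continuous_on A (\<lambda>z. fst z j)" for j
      by (rule continuous_on_product_then_coordinatewise) (rule continuous_on_fst[OF continuous_on_id])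
    show "continuous_on A (\<lambda>z. c (fst z) (snd z) j)" for j
    proof (cases "j = i")
      case True
      then show ?thesis unfolding c_def by (simp, intro continuous_intros x)
    qed (simp add: c_def x)
  qed
  have joint: "continuous_on (C \<times> cbox 0 1) (\<lambda>(x, s). s ^ m * g (c x s))" if g: "Cinf_on n C g" for m g
  proof -
    have "continuous_on (C \<times> cbox 0 1) (\<lambda>z. g ((\<lambda>(x, s). c x s) z))"
      by (rule continuous_on_compose2[OF Cinf_on_continuous[OF C g] c_cont]) (auto simp: cC simp del: cbox_interval)
    then show ?thesis
      unfolding split_beta by (intro continuous_intros)
  qed
  \<comment> \<open>Differentiation in direction \<open>i\<close> produces a factor \<open>s\<close>; with arbitrary powers of \<open>s\<close> the
      integrals are closed under partial derivatives.\<close>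
  define J where "J = (\<lambda>m g x. integral (cbox 0 1) (\<lambda>s. s ^ m * g (c x s)))"
  have J0: "continuous_on C (J m g)" if "Cinf_on n C g" for m g
    unfolding J_def by (rule integral_continuous_on_param[OF joint[OF that]])
  have J_der: "((\<lambda>t. J m g (x(j := t))) has_real_derivative
      J (if j = i then Suc m else m) (partial_deriv j g) x) (at (x j))"
    if g: "Cinf_on n C g" and j: "j < n" and x: "x \<in> C" for m g j x
  proof -
    define U where "U = {t. \<bar>t - p j\<bar> < e}"
    have U: "open U" "convex U"
    proof -
      have "U = ball (p j) e" by (auto simp: U_def dist_real_def abs_minus_commute)
      then show "open U" "convex U" by auto
    qed
    have xU: "x j \<in> U" using x j by (auto simp: U_def C_def cube_def)
    have upC: "x(j := t) \<in> C" if "t \<in> U" for t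
      using x j that by (auto simp: U_def C_def cube_def topspace_Euclidean_space)
    define m' where "m' = (if j = i then Suc m else m)"
    have "((\<lambda>t. integral (cbox 0 1) (\<lambda>s. s ^ m * g (c (x(j := t)) s))) has_real_derivative
        integral (cbox 0 1) (\<lambda>s. s ^ m' * partial_deriv j g (c (x(j := x j)) s))) (at (x j) within U)"
    proof (rule leibniz_rule_field_derivative[OF _ _ _ xU U(2)])
      fix t s :: real assume t: "t \<in> U" and s: "s \<in> cbox 0 1"
      define z where "z = c (x(j := t)) s"
      have z: "z \<in> C" unfolding z_def by (rule cC[OF upC[OF t] s])
      have gz: "((\<lambda>r. g (z(j := r))) has_real_derivative partial_deriv j g z) (at (z j))"
        by (rule Ck_on_SucD(1)[OF Cinf_onD[OF g] j z])
      have "((\<lambda>t. s ^ m * g (c (x(j := t)) s)) has_real_derivative s ^ m' * partial_deriv j g z) (at t)"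
      proof (cases "j = i")
        case True
        have zr: "c (x(j := r)) s = z(j := p i + s * (r - p i))" for r
          by (simp add: c_def z_def True)
        have zj: "z j = p i + s * (t - p i)" by (simp add: c_def z_def True)
        have "((\<lambda>r. p i + s * (r - p i)) has_real_derivative s) (at t)"
          by (auto intro!: derivative_eq_intros)
        from DERIV_chain2[OF gz[unfolded zj] this]
        show ?thesis unfolding zr m'_def
          using True by (auto intro!: derivative_eq_intros simp del: fun_upd_apply)
      next
        case False
        have zr: "c (x(j := r)) s = z(j := r)" for r
          using False unfolding c_def z_def by (simp add: fun_upd_twist)
        have "z j = t" using False by (simp add: c_def z_def)
        then show ?thesis unfolding zr m'_def
          using False gz by (auto intro!: derivative_eq_intros simp del: fun_upd_apply)
      qed
      then show "((\<lambda>t. s ^ m * g (c (x(j := t)) s)) has_real_derivative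
          s ^ m' * partial_deriv j g (c (x(j := t)) s)) (at t within U)"
        unfolding z_def by (rule has_field_derivative_at_within)
    next
      fix t assume t: "t \<in> U"
      have "continuous_on (cbox 0 1) (\<lambda>s. (\<lambda>(x, s). s ^ m * g (c x s)) (x(j := t), s))"
        by (rule continuous_on_compose2[OF joint[OF g]]) (use upC[OF t] in \<open>auto intro!: continuous_intros\<close>)
      then show "(\<lambda>s. s ^ m * g (c (x(j := t)) s)) integrable_on cbox 0 1"
        by (intro integrable_continuous) simp
    next
      have "continuous_on (U \<times> cbox 0 1) (\<lambda>z. (\<lambda>(x, s). s ^ m' * partial_deriv j g (c x s)) (x(j := fst z), snd z))"
      proof (rule continuous_on_compose2[OF joint[OF Cinf_on_partial[OF g j]]])
        have "continuous_on (U \<times> cbox 0 1) (\<lambda>z::real \<times> real. x(j := fst z))"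
        proof (rule continuous_on_coordinatewise_then_product)
          show "continuous_on (U \<times> cbox 0 1) (\<lambda>z::real \<times> real. (x(j := fst z)) l)" for l
            by (cases "l = j") (auto intro!: continuous_intros)
        qed
        then show "continuous_on (U \<times> cbox 0 1) (\<lambda>z::real \<times> real. (x(j := fst z), snd z))"
          by (rule continuous_on_Pair) (intro continuous_intros)
      qed (use upC in auto)
      then show "continuous_on (U \<times> cbox 0 1) (\<lambda>(t, s). s ^ m' * partial_deriv j g (c (x(j := t)) s))"
        by (simp add: split_beta)
    qed
    then show ?thesis
      unfolding J_def m'_def fun_upd_triv using at_within_open[OF xU U(1)] by metis
  qed
  have J: "Ck_on k n C (J m g)" if "Cinf_on n C g" for k m g
    using that
  proof (induction k arbitrary: m g)
    case 0
    then show ?case using J0 Ck_on_0[OF C] by metis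
  next
    case (Suc k)
    show ?case
      by (rule Ck_on_SucI[OF C J0[OF Suc.prems] J_der[OF Suc.prems]])
        (assumption+, rule Suc.IH[OF Cinf_on_partial[OF Suc.prems]])
  qed
  have "f x = f (x(i := p i)) + (x i - p i) * J 0 (partial_deriv i f) x" if x: "x \<in> C" for x
  proof -
    have "((\<lambda>s. (x i - p i) * partial_deriv i f (c x s)) has_integral f (c x 1) - f (c x 0)) {0..1}"
    proof (rule fundamental_theorem_of_calculus)
      fix s :: real assume s: "s \<in> {0..1}"
      have z: "c x s \<in> C" by (rule cC[OF x]) (use s in simp)
      have gz: "((\<lambda>r. f ((c x s)(i := r))) has_real_derivative partial_deriv i f (c x s)) (at (c x s i))"
        by (rule Ck_on_SucD(1)[OF Cinf_onD[OF fC] i z])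
      have ci: "c x s i = p i + s * (x i - p i)" by (simp add: c_def)
      have cr: "c x r = (c x s)(i := p i + r * (x i - p i))" for r by (simp add: c_def)
      have "((\<lambda>r. p i + r * (x i - p i)) has_real_derivative (x i - p i)) (at s)"
        by (auto intro!: derivative_eq_intros)
      from DERIV_chain2[OF gz[unfolded ci] this]
      have "((\<lambda>r. f (c x r)) has_real_derivative (x i - p i) * partial_deriv i f (c x s)) (at s)"
        unfolding cr[symmetric] by (simp only: mult.commute)
      then show "((\<lambda>r. f (c x r)) has_vector_derivative (x i - p i) * partial_deriv i f (c x s)) (at s within {0..1})"
        using has_field_derivative_at_within has_real_derivative_iff_has_vector_derivative by metis
    qed simp
    then have "integral {0..1} (\<lambda>s. (x i - p i) * partial_deriv i f (c x s)) = f (c x 1) - f (c x 0)"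
      by (rule integral_unique)
    moreover have "c x 1 = x" "c x 0 = x(i := p i)" by (auto simp: c_def)
    ultimately show ?thesis by (simp add: J_def)
  qed
  then show ?thesis
    using that[of "J 0 (partial_deriv i f)"] J[OF Cinf_on_partial[OF fC i]] unfolding C_def Cinf_on_def by blast
qed

text \<open>The coordinates of \<open>x\<close> are reset to those of \<open>p\<close> one after the other, and each difference is
  divided by \<open>x i - p i\<close>. Derivations at \<open>p\<close> see only the values \<open>h i p\<close>.\<close>

theorem Hadamard_lemma:
  assumes f: "Cinf_on n (cube n p e) f" and p: "p \<in> cube n p e"
  obtains h where "\<And>i. i < n \<Longrightarrow> Cinf_on n (cube n p e) (h i)"
    "\<And>i. i < n \<Longrightarrow> h i p = partial_deriv i f p"
    "\<And>x. x \<in> cube n p e \<Longrightarrow> f x = f p + (\<Sum>i<n. (x i - p i) * h i x)"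
proof -
  define C where "C = cube n p e"
  have C: "openin (Euclidean_space n) C" "p \<in> C" using p by (simp_all add: C_def openin_cube)
  have fC: "Cinf_on n C f" using f by (simp add: C_def)
  define tr where "tr = (\<lambda>k x i. if i < k then x i else p i)"
  have e: "e > 0" if "0 < n" using p that by (auto simp: cube_def)
  have trC: "tr k x \<in> C" if "x \<in> C" for k x
    using that C(2) by (auto simp: C_def cube_def tr_def topspace_Euclidean_space)
  have trs: "Cinf_on n C (\<lambda>x. f (tr k x))" for k
  proof (rule Cinf_on_compose[OF C(1) C(1) trC fC])
    show "Cinf_on n C (\<lambda>x. tr k x i)" for i
      by (cases "i < k") (simp_all add: tr_def Cinf_on_const Cinf_on_coord[OF C(1)])
  qed
  have "k \<le> n \<Longrightarrow> \<exists>h. (\<forall>i<k. Cinf_on n C (h i) \<and> h i p = partial_deriv i f p) \<and>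
      (\<forall>x\<in>C. f (tr k x) = f p + (\<Sum>i<k. (x i - p i) * h i x))" for k
  proof (induction k)
    case 0
    then show ?case by (simp add: tr_def)
  next
    case (Suc k)
    then obtain h where h: "\<And>i. i < k \<Longrightarrow> Cinf_on n C (h i) \<and> h i p = partial_deriv i f p"
      "\<And>x. x \<in> C \<Longrightarrow> f (tr k x) = f p + (\<Sum>i<k. (x i - p i) * h i x)" by force
    have k: "k < n" using Suc.prems by simp
    obtain g where g: "Cinf_on n C g"
      "\<And>x. x \<in> C \<Longrightarrow> f (tr (Suc k) x) = f (tr (Suc k) (x(k := p k))) + (x k - p k) * g x"
      using Cinf_division[OF trs[of "Suc k", unfolded C_def] k] unfolding C_def by metis
    have tru: "tr (Suc k) (x(k := p k)) = tr k x" for x by (auto simp: tr_def fun_eq_iff less_Suc_eq)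
    have trp: "tr (Suc k) (p(k := t)) = p(k := t)" "tr k (p(k := t)) = p" for t
      by (auto simp: tr_def fun_eq_iff)
    have pE: "p \<in> topspace (Euclidean_space n)" using C openin_Euclidean_space_sub by blast
    have gp: "g p = partial_deriv k f p"
    proof -
      have lim: "((\<lambda>t. g (p(k := t))) \<longlongrightarrow> g p) (at (p k))"
      proof (rule tendsto_compose_Euclidean[OF C Cinf_on_continuous[OF C(1) g(1)]])
        show "((\<lambda>t. (p(k := t)) i) \<longlongrightarrow> p i) (at (p k))" for i by (cases "i = k") auto
      qed (intro always_eventually allI upd_in_Euclidean[OF pE k])
      have ev: "\<forall>\<^sub>F t in at (p k). f (p(k := t)) - f (p(k := p k)) = g (p(k := t)) * (t - p k)"
      proof -
        have "\<forall>\<^sub>F t in at (p k). p(k := t) \<in> C"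
          using eventually_upd_in[OF C k] by (simp only: eventually_nhds_conv_at)
        then show ?thesis
        proof eventually_elim
          case (elim t)
          show ?case using g(2)[OF elim] unfolding tru trp by (simp add: mult.commute)
        qed
      qed
      have "((\<lambda>t. f (p(k := t))) has_real_derivative g p * 1) (at (p k))"
        by (rule has_derivative_of_increments[OF DERIV_ident lim ev])
      then show ?thesis using partial_deriv_eqI[of f p k] by simp
    qed
    show ?case
    proof (intro exI[of _ "h(k := g)"] conjI allI impI ballI)
      fix i assume "i < Suc k"
      then show "Cinf_on n C ((h(k := g)) i)" "(h(k := g)) i p = partial_deriv i f p"
        using h(1) g(1) gp by (auto simp: less_Suc_eq)
    next
      fix x assume x: "x \<in> C"
      have "(\<Sum>i<Suc k. (x i - p i) * (h(k := g)) i x) = (\<Sum>i<k. (x i - p i) * h i x) + (x k - p k) * g x"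
        by simp
      then show "f (tr (Suc k) x) = f p + (\<Sum>i<Suc k. (x i - p i) * (h(k := g)) i x)"
        using g(2)[OF x] h(2)[OF x] unfolding tru by simp
    qed
  qed
  then obtain h where h: "\<And>i. i < n \<Longrightarrow> Cinf_on n C (h i) \<and> h i p = partial_deriv i f p"
    "\<And>x. x \<in> C \<Longrightarrow> f (tr n x) = f p + (\<Sum>i<n. (x i - p i) * h i x)" by blast
  have "tr n x = x" if "x \<in> C" for x
    using openin_Euclidean_space_sub[OF C(1) that] openin_Euclidean_space_sub[OF C]
    by (auto simp: tr_def fun_eq_iff topspace_Euclidean_space)
  then show ?thesis using that[of h] h unfolding C_def by auto
qed

section \<open>Coordinate systems on manifolds\<close>

definition Cinf_at :: "nat \<Rightarrow> (nat \<Rightarrow> real) \<Rightarrow> ((nat \<Rightarrow> real) \<Rightarrow> real) \<Rightarrow> bool"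
  where "Cinf_at n x f \<longleftrightarrow> (\<exists>W. openin (Euclidean_space n) W \<and> x \<in> W \<and> Cinf_on n W f)"

lemma Cinf_atI: "openin (Euclidean_space n) W \<Longrightarrow> x \<in> W \<Longrightarrow> Cinf_on n W f \<Longrightarrow> Cinf_at n x f"
  unfolding Cinf_at_def by (intro exI conjI)

lemma Cinf_at_cong:
  assumes f: "Cinf_at n x f" and V: "openin (Euclidean_space n) V" "x \<in> V" and eq: "\<And>y. y \<in> V \<Longrightarrow> f y = g y"
  shows "Cinf_at n x g"
proof -
  obtain W where W: "openin (Euclidean_space n) W" "x \<in> W" "Cinf_on n W f"
    using f unfolding Cinf_at_def by (elim exE conjE)
  have "Cinf_on n (W \<inter> V) g"
    by (rule Cinf_on_cong_subset[OF W(3) openin_Int[OF W(1) V(1)]]) (use eq in simp_all)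
  then show ?thesis using W V by (intro Cinf_atI[of n "W \<inter> V"]) auto
qed

lemma Cinf_at_compose:
  assumes f: "Cinf_at m (g x) f" and V: "openin (Euclidean_space n) V" "x \<in> V"
    and gE: "\<And>y. y \<in> V \<Longrightarrow> g y \<in> topspace (Euclidean_space m)"
    and g: "\<And>i. i < m \<Longrightarrow> Cinf_on n V (\<lambda>y. g y i)"
  shows "Cinf_at n x (\<lambda>y. f (g y))"
proof -
  obtain W where W: "openin (Euclidean_space m) W" "g x \<in> W" "Cinf_on m W f"
    using f unfolding Cinf_at_def by (elim exE conjE)
  define V' where "V' = {y\<in>V. g y \<in> W}"
  have V': "openin (Euclidean_space n) V'"
    unfolding V'_def
    by (rule openin_Euclidean_preimage[OF V(1) W(1) gE Cinf_on_continuous[OF V(1) g]])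
  have "Cinf_on n V' (\<lambda>y. f (g y))"
    by (rule Cinf_on_compose[where f = f and g = g, OF V' W(1) _ W(3) Cinf_on_subset[OF g V']])
      (auto simp: V'_def)
  then show ?thesis by (intro Cinf_atI[OF V']) (simp_all add: V'_def V W)
qed

lemma Cinf_at_common:
  fixes m :: nat
  assumes x: "x \<in> topspace (Euclidean_space n)" and F: "\<And>i. i < m \<Longrightarrow> Cinf_at n x (F i)"
  shows "\<exists>W. openin (Euclidean_space n) W \<and> x \<in> W \<and> (\<forall>i<m. Cinf_on n W (F i))"
  using F
proof (induction m)
  case 0
  then show ?case using x by (intro exI[of _ "topspace (Euclidean_space n)"]) auto
next
  case (Suc m)
  obtain W where W: "openin (Euclidean_space n) W" "x \<in> W" "\<And>i. i < m \<Longrightarrow> Cinf_on n W (F i)"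
    using Suc.IH[OF Suc.prems[OF less_SucI]] by auto
  obtain V where V: "openin (Euclidean_space n) V" "x \<in> V" "Cinf_on n V (F m)"
    using Suc.prems[OF lessI] unfolding Cinf_at_def by (elim exE conjE)
  have o: "openin (Euclidean_space n) (W \<inter> V)" using W V by auto
  have "Cinf_on n (W \<inter> V) (F i)" if "i < Suc m" for i
    using that Cinf_on_subset[OF W(3) o] Cinf_on_subset[OF V(3) o] by (auto simp: less_Suc_eq)
  then show ?case using o W(2) V(2) by (intro exI[of _ "W \<inter> V"]) auto
qed

lemma Cinf_at_has_derivative:
  assumes "Cinf_at n x f" "i < n"
  shows "((\<lambda>t. f (x(i := t))) has_real_derivative partial_deriv i f x) (at (x i))"
proof -
  obtain W where W: "openin (Euclidean_space n) W" "x \<in> W" "Cinf_on n W f"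
    using assms(1) unfolding Cinf_at_def by (elim exE conjE)
  show ?thesis by (rule Ck_on_SucD(1)[OF Cinf_onD[OF W(3)] assms(2) W(2)])
qed

text \<open>The coordinate systems compatible with the atlas, whether or not they belong to it: a germ is smooth
  iff its expression in the coordinates is. An atlas is fixed and need not be maximal, so this
  is what lets coordinates be changed without changing the manifold.\<close>

definition good_chart :: "'a mfd \<Rightarrow> 'a set \<Rightarrow> ('a \<Rightarrow> nat \<Rightarrow> real) \<Rightarrow> bool"
  where "good_chart M U u \<longleftrightarrow> chart (mtop M) (mdim M) U u \<and>
    (\<forall>q\<in>U. \<forall>f. smooth_near M q f \<longleftrightarrow> Cinf_at (mdim M) (u q) (\<lambda>x. f (inv_into U u x)))"

lemma good_chart_chart: "good_chart M U u \<Longrightarrow> chart (mtop M) (mdim M) U u"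
  by (simp add: good_chart_def)

lemma good_chart_smooth_near:
  "good_chart M U u \<Longrightarrow> q \<in> U \<Longrightarrow> smooth_near M q f \<longleftrightarrow> Cinf_at (mdim M) (u q) (\<lambda>x. f (inv_into U u x))"
  by (simp add: good_chart_def)

lemma chart_openin: "chart T n U u \<Longrightarrow> openin T U"
  by (simp add: chart_def)

lemma chart_openin_image: "chart T n U u \<Longrightarrow> openin (Euclidean_space n) (u ` U)"
  by (simp add: chart_def)

lemma chart_in_Euclidean: "chart T n U u \<Longrightarrow> q \<in> U \<Longrightarrow> u q \<in> topspace (Euclidean_space n)"
  using openin_Euclidean_space_sub[OF chart_openin_image] by blast

lemma chart_inv: "chart T n U u \<Longrightarrow> q \<in> U \<Longrightarrow> inv_into U u (u q) = q"
  by (rule inv_into_f_f[OF chart_inj])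

lemma chart_preimage_openin:
  assumes ch: "chart T n U u" and B: "openin (Euclidean_space n) B"
  shows "openin T {q\<in>U. u q \<in> B}"
proof -
  have c: "continuous_map (subtopology T U) (subtopology (Euclidean_space n) (u ` U)) u"
    using ch by (simp add: chart_def homeomorphic_imp_continuous_map)
  have "openin (subtopology T U) {q\<in>topspace (subtopology T U). u q \<in> B \<inter> u ` U}"
    by (rule openin_continuous_map_preimage[OF c]) (rule openin_subtopology_Int[OF B])
  moreover have "{q\<in>topspace (subtopology T U). u q \<in> B \<inter> u ` U} = {q\<in>U. u q \<in> B}"
    using openin_subset[OF chart_openin[OF ch]] by auto
  ultimately show ?thesis
    using openin_trans_full[OF _ chart_openin[OF ch]] by metis
qed

lemma smooth_nearI: "openin (mtop M) U \<Longrightarrow> p \<in> U \<Longrightarrow> smooth_fun_on M U f \<Longrightarrow> smooth_near M p f"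
  unfolding smooth_near_def by (intro exI conjI)

lemma atlas_good_chart:
  assumes M: "manifold M" and V: "(V, \<phi>) \<in> matlas M"
  shows "good_chart M V \<phi>"
  unfolding good_chart_def
proof (intro conjI ballI allI iffI)
  show ch: "chart (mtop M) (mdim M) V \<phi>" by (rule manifold_chart[OF M V])
  fix q f assume q: "q \<in> V"
  {
    assume "smooth_near M q f"
    then obtain W where W: "openin (mtop M) W" "q \<in> W" "smooth_fun_on M W f"
      unfolding smooth_near_def by (elim exE conjE)
    show "Cinf_at (mdim M) (\<phi> q) (\<lambda>x. f (inv_into V \<phi> x))"
      by (rule Cinf_atI[OF openin_chart_image[OF ch W(1)]])
        (use q W(2,3) V in \<open>auto simp: smooth_fun_on_def\<close>)
  next
    assume "Cinf_at (mdim M) (\<phi> q) (\<lambda>x. f (inv_into V \<phi> x))"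
    then obtain W where W: "openin (Euclidean_space (mdim M)) W" "\<phi> q \<in> W"
      "Cinf_on (mdim M) W (\<lambda>x. f (inv_into V \<phi> x))"
      unfolding Cinf_at_def by (elim exE conjE)
    define U where "U = {q\<in>V. \<phi> q \<in> W}"
    have U: "openin (mtop M) U" unfolding U_def by (rule chart_preimage_openin[OF ch W(1)])
    have "Cinf_on (mdim M) (\<psi> ` (V' \<inter> U)) (\<lambda>x. f (inv_into V' \<psi> x))" if V': "(V', \<psi>) \<in> matlas M" for V' \<psi>
    proof -
      note ch' = manifold_chart[OF M V']
      have o: "openin (Euclidean_space (mdim M)) (\<psi> ` (V' \<inter> U))"
        by (rule openin_chart_image[OF ch' U])
      have "Cinf_on (mdim M) (\<psi> ` (V' \<inter> V)) (\<lambda>x. \<phi> (inv_into V' \<psi> x) i)" if "i < mdim M" for i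
        using M V V' that unfolding manifold_def by fast
      then have g: "Cinf_on (mdim M) (\<psi> ` (V' \<inter> U)) (\<lambda>x. \<phi> (inv_into V' \<psi> x) i)" if "i < mdim M" for i
        by (rule Cinf_on_subset[OF _ o]) (use that in \<open>auto simp: U_def\<close>)
      have "Cinf_on (mdim M) (\<psi> ` (V' \<inter> U)) (\<lambda>x. (\<lambda>x. f (inv_into V \<phi> x)) (\<phi> (inv_into V' \<psi> x)))"
        by (rule Cinf_on_compose[where g = "\<lambda>x. \<phi> (inv_into V' \<psi> x)", OF o W(1) _ W(3) g])
          (auto simp: U_def chart_inv[OF ch'])
      then show ?thesis
        by (rule Cinf_on_cong_subset[OF _ o subset_refl])
          (auto simp: U_def chart_inv[OF ch'] chart_inv[OF ch])
    qed
    then have "smooth_fun_on M U f" unfolding smooth_fun_on_def by blast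
    then show "smooth_near M q f"
      by (intro smooth_nearI[OF U]) (simp_all add: U_def q W(2))
  }
qed

lemma manifold_atlas_at:
  assumes "manifold M" "p \<in> mcarrier M"
  obtains V \<phi> where "(V, \<phi>) \<in> matlas M" "p \<in> V"
  using assms unfolding manifold_def by blast

lemma smooth_near_carrier: "smooth_near M p f \<Longrightarrow> p \<in> mcarrier M"
  unfolding smooth_near_def using openin_subset by blast

lemma good_chart_coord:
  assumes g: "good_chart M U u" and q: "q \<in> U" and h: "Cinf_at (mdim M) (u q) h"
  shows "smooth_near M q (\<lambda>x. h (u x))"
  unfolding good_chart_smooth_near[OF g q]
  by (rule Cinf_at_cong[OF h chart_openin_image[OF good_chart_chart[OF g]]])
    (use q in \<open>auto simp: chart_inv[OF good_chart_chart[OF g]]\<close>)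

lemma smooth_near_coord:
  assumes g: "good_chart M U u" and q: "q \<in> U"
  shows "smooth_near M q (\<lambda>x. u x i)"
  by (rule good_chart_coord[OF g q, of "\<lambda>x. x i"])
    (rule Cinf_atI[OF chart_openin_image[OF good_chart_chart[OF g]] imageI[OF q]
       Cinf_on_coord[OF chart_openin_image[OF good_chart_chart[OF g]]]])

lemma Euclidean_homeomorphic_map:
  assumes B: "openin (Euclidean_space n) B" and D: "openin (Euclidean_space n) (\<theta> ` B)"
    and inv: "\<And>x. x \<in> B \<Longrightarrow> \<eta> (\<theta> x) = x"
    and \<theta>: "\<And>i. i < n \<Longrightarrow> continuous_on B (\<lambda>x. \<theta> x i)"
    and \<eta>: "\<And>i. i < n \<Longrightarrow> continuous_on (\<theta> ` B) (\<lambda>x. \<eta> x i)"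
  shows "homeomorphic_map (subtopology (Euclidean_space n) B) (subtopology (Euclidean_space n) (\<theta> ` B)) \<theta>"
proof -
  have "continuous_on B \<theta>"
    by (rule continuous_on_Euclidean_map[OF B _ \<theta>]) (use openin_Euclidean_space_sub[OF D] in auto)
  moreover have "continuous_on (\<theta> ` B) \<eta>"
    by (rule continuous_on_Euclidean_map[OF D _ \<eta>]) (use openin_Euclidean_space_sub[OF B] inv in auto)
  ultimately have "homeomorphic_maps (subtopology (Euclidean_space n) B) (subtopology (Euclidean_space n) (\<theta> ` B)) \<theta> \<eta>"
    unfolding subtopology_Euclidean[OF openin_subset[OF B]] subtopology_Euclidean[OF openin_subset[OF D]]
      homeomorphic_maps_def
    using inv by (auto simp: continuous_map_in_subtopology)
  then show ?thesis by (rule homeomorphic_maps_imp_map)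
qed

text \<open>A diffeomorphism between open subsets of the coordinate space turns compatible coordinates into
  compatible coordinates.\<close>

lemma good_chart_compose:
  assumes g: "good_chart M U u" and B: "openin (Euclidean_space (mdim M)) B" "B \<subseteq> u ` U"
    and D: "openin (Euclidean_space (mdim M)) (\<theta> ` B)"
    and inv: "\<And>x. x \<in> B \<Longrightarrow> \<eta> (\<theta> x) = x"
    and \<theta>: "\<And>i. i < mdim M \<Longrightarrow> Cinf_on (mdim M) B (\<lambda>x. \<theta> x i)"
    and \<eta>: "\<And>i. i < mdim M \<Longrightarrow> Cinf_on (mdim M) (\<theta> ` B) (\<lambda>x. \<eta> x i)"
  shows "good_chart M {q\<in>U. u q \<in> B} (\<lambda>q. \<theta> (u q))"
proof -
  define U' where "U' = {q\<in>U. u q \<in> B}"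
  define u' where "u' = (\<lambda>q. \<theta> (u q))"
  note ch = good_chart_chart[OF g]
  have U': "openin (mtop M) U'" "U' \<subseteq> U" "u ` U' = B"
    using chart_preimage_openin[OF ch B(1)] B(2) by (auto simp: U'_def)
  then have im: "u' ` U' = \<theta> ` B" unfolding u'_def by (metis image_image)
  have "homeomorphic_map (subtopology (mtop M) U) (subtopology (Euclidean_space (mdim M)) (u ` U)) u"
    using ch by (simp add: chart_def)
  then have "homeomorphic_map (subtopology (subtopology (mtop M) U) U')
      (subtopology (subtopology (Euclidean_space (mdim M)) (u ` U)) B) u"
    by (rule homeomorphic_map_subtopologies)
      (use U' openin_subset[OF chart_openin[OF ch]] openin_subset[OF chart_openin_image[OF ch]] in auto)
  then have "homeomorphic_map (subtopology (mtop M) U') (subtopology (Euclidean_space (mdim M)) B) u"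
    using U'(2) B(2) by (simp add: subtopology_subtopology Int_absorb1)
  from homeomorphic_map_compose[OF this Euclidean_homeomorphic_map[OF B(1) D inv]]
  have "homeomorphic_map (subtopology (mtop M) U') (subtopology (Euclidean_space (mdim M)) (\<theta> ` B)) u'"
    using Cinf_on_continuous[OF B(1) \<theta>] Cinf_on_continuous[OF D \<eta>] by (simp add: o_def u'_def)
  then have ch': "chart (mtop M) (mdim M) U' u'"
    unfolding chart_def im using U'(1) D by simp
  have "smooth_near M q f \<longleftrightarrow> Cinf_at (mdim M) (u' q) (\<lambda>x. f (inv_into U' u' x))" if q: "q \<in> U'" for q f
  proof -
    have qU: "q \<in> U" "u q \<in> B" using q by (auto simp: U'_def)
    have inv': "inv_into U u x = inv_into U' u' (\<theta> x)" if x: "x \<in> B" for x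
    proof -
      obtain y where y: "y \<in> U'" "x = u y" using x U'(3) by blast
      show ?thesis using chart_inv[OF ch' y(1)] chart_inv[OF ch, of y] y U'(2) by (auto simp: u'_def)
    qed
    show ?thesis
      unfolding good_chart_smooth_near[OF g qU(1)]
    proof
      assume a: "Cinf_at (mdim M) (u q) (\<lambda>x. f (inv_into U u x))"
      have "Cinf_at (mdim M) (u' q) (\<lambda>y. (\<lambda>x. f (inv_into U u x)) (\<eta> y))"
        by (rule Cinf_at_compose[where g = \<eta> and f = "\<lambda>x. f (inv_into U u x)", OF _ D _ _ \<eta>])
          (use a inv[OF qU(2)] qU(2) inv openin_Euclidean_space_sub[OF B(1)] in \<open>auto simp: u'_def\<close>)
      then show "Cinf_at (mdim M) (u' q) (\<lambda>x. f (inv_into U' u' x))"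
        by (rule Cinf_at_cong[OF _ D]) (use qU(2) inv inv' in \<open>auto simp: u'_def\<close>)
    next
      assume a: "Cinf_at (mdim M) (u' q) (\<lambda>x. f (inv_into U' u' x))"
      have "Cinf_at (mdim M) (u q) (\<lambda>y. (\<lambda>x. f (inv_into U' u' x)) (\<theta> y))"
        by (rule Cinf_at_compose[where g = \<theta> and f = "\<lambda>x. f (inv_into U' u' x)", OF _ B(1) qU(2) _ \<theta>])
          (use a openin_Euclidean_space_sub[OF D] in \<open>auto simp: u'_def\<close>)
      then show "Cinf_at (mdim M) (u q) (\<lambda>x. f (inv_into U u x))"
        by (rule Cinf_at_cong[OF _ B(1) qU(2)]) (use inv' in auto)
    qed
  qed
  then show ?thesis using ch' unfolding good_chart_def U'_def[symmetric] u'_def[symmetric] by blast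
qed

definition swap_coords :: "nat \<Rightarrow> nat \<Rightarrow> (nat \<Rightarrow> real) \<Rightarrow> nat \<Rightarrow> real"
  where "swap_coords j k x = (\<lambda>i. if i = j then x k else if i = k then x j else x i)"

lemma swap_coords_swap: "swap_coords j k (swap_coords j k x) = x"
  by (auto simp: swap_coords_def)

lemma good_chart_swap:
  assumes g: "good_chart M U u" and jk: "j < mdim M" "k < mdim M"
  shows "good_chart M U (\<lambda>q. swap_coords j k (u q))"
proof -
  let ?n = "mdim M" and ?s = "swap_coords j k"
  note ch = good_chart_chart[OF g]
  have coord: "Cinf_on ?n W (\<lambda>x. ?s x i)" if "openin (Euclidean_space ?n) W" for W i
    using Cinf_on_coord[OF that] by (cases "i = j"; cases "i = k") (simp_all add: swap_coords_def)
  have E: "?s x \<in> topspace (Euclidean_space ?n)" if "x \<in> topspace (Euclidean_space ?n)" for x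
    using that jk by (auto simp: swap_coords_def topspace_Euclidean_space)
  have im: "?s ` u ` U = {x\<in>topspace (Euclidean_space ?n). ?s x \<in> u ` U}"
  proof (intro equalityI subsetI)
    fix x assume "x \<in> {x\<in>topspace (Euclidean_space ?n). ?s x \<in> u ` U}"
    then show "x \<in> ?s ` u ` U" using swap_coords_swap[of j k x] by (metis (no_types, lifting) imageI mem_Collect_eq)
  qed (use E swap_coords_swap chart_in_Euclidean[OF ch] in auto)
  have "openin (Euclidean_space ?n) {x\<in>topspace (Euclidean_space ?n). ?s x \<in> u ` U}"
    by (rule openin_Euclidean_preimage[OF openin_topspace chart_openin_image[OF ch] E Cinf_on_continuous[OF openin_topspace coord[OF openin_topspace]]])
  then have o: "openin (Euclidean_space ?n) (?s ` u ` U)" unfolding im .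
  have "good_chart M {q\<in>U. u q \<in> u ` U} (\<lambda>q. ?s (u q))"
    by (rule good_chart_compose[OF g chart_openin_image[OF ch] subset_refl o swap_coords_swap coord[OF chart_openin_image[OF ch]] coord[OF o]])
  moreover have "{q\<in>U. u q \<in> u ` U} = U" by auto
  ultimately show ?thesis by simp
qed

subsection \<open>Smooth maps at a point\<close>

text \<open>Smoothness at a point in terms of germs of functions, without charts and without reference to the
  carriers: it composes trivially, is inherited by open submanifolds, and is exactly what tangent
  maps, themselves defined on germs, require.\<close>

definition smooth_at :: "'a mfd \<Rightarrow> 'b mfd \<Rightarrow> 'a \<Rightarrow> ('a \<Rightarrow> 'b) \<Rightarrow> bool"
  where "smooth_at M N p f \<longleftrightarrow> (\<forall>g. smooth_near N (f p) g \<longrightarrow> smooth_near M p (\<lambda>x. g (f x)))"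

lemma smooth_atD: "smooth_at M N p f \<Longrightarrow> smooth_near N (f p) g \<Longrightarrow> smooth_near M p (\<lambda>x. g (f x))"
  by (simp add: smooth_at_def)

lemma smooth_at_coordI:
  assumes M: "manifold M" and g: "good_chart N V w"
    and U: "openin (mtop M) U" "p \<in> U" "\<And>x. x \<in> U \<Longrightarrow> f x \<in> V"
    and w: "\<And>i. i < mdim N \<Longrightarrow> smooth_near M p (\<lambda>x. w (f x) i)"
  shows "smooth_at M N p f"
  unfolding smooth_at_def
proof (intro allI impI)
  fix h assume h: "smooth_near N (f p) h"
  let ?n = "mdim M" and ?m = "mdim N"
  have "p \<in> mcarrier M" using U(1,2) openin_subset by blast
  then obtain A a where A: "(A, a) \<in> matlas M" "p \<in> A" using manifold_atlas_at[OF M] by blast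
  note ga = atlas_good_chart[OF M A(1)] and chA = manifold_chart[OF M A(1)]
  have "\<exists>W. openin (Euclidean_space ?n) W \<and> a p \<in> W \<and> (\<forall>i<?m. Cinf_on ?n W (\<lambda>x. w (f (inv_into A a x)) i))"
  proof (rule Cinf_at_common[OF chart_in_Euclidean[OF chA A(2)]])
    show "Cinf_at ?n (a p) (\<lambda>x. w (f (inv_into A a x)) i)" if "i < ?m" for i
      using w[OF that] good_chart_smooth_near[OF ga A(2), of "\<lambda>x. w (f x) i"] by simp
  qed
  then obtain W where W: "openin (Euclidean_space ?n) W" "a p \<in> W"
    "\<And>i. i < ?m \<Longrightarrow> Cinf_on ?n W (\<lambda>x. w (f (inv_into A a x)) i)" by blast
  define B where "B = W \<inter> a ` (A \<inter> U)"
  have B: "openin (Euclidean_space ?n) B" "a p \<in> B"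
    using W openin_chart_image[OF chA U(1)] U(2) A(2) by (auto simp: B_def)
  have fB: "f (inv_into A a x) \<in> V" if "x \<in> B" for x
    using that U(3) chart_inv[OF chA] by (auto simp: B_def)
  have fp: "f (inv_into A a (a p)) = f p" using chart_inv[OF chA A(2)] by simp
  have hN: "Cinf_at ?m (w (f p)) (\<lambda>x. h (inv_into V w x))"
    using h good_chart_smooth_near[OF g U(3)[OF U(2)]] by simp
  have "Cinf_at ?n (a p) (\<lambda>x. (\<lambda>x. h (inv_into V w x)) (w (f (inv_into A a x))))"
  proof (rule Cinf_at_compose[where g = "\<lambda>x. w (f (inv_into A a x))" and f = "\<lambda>x. h (inv_into V w x)", OF _ B])
    show "Cinf_at ?m (w (f (inv_into A a (a p)))) (\<lambda>x. h (inv_into V w x))" using hN fp by simp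
    show "w (f (inv_into A a y)) \<in> topspace (Euclidean_space ?m)" if "y \<in> B" for y
      by (rule chart_in_Euclidean[OF good_chart_chart[OF g] fB[OF that]])
    show "Cinf_on ?n B (\<lambda>y. w (f (inv_into A a y)) i)" if "i < ?m" for i
      by (rule Cinf_on_subset[OF W(3)[OF that] B(1)]) (simp add: B_def)
  qed
  then have "Cinf_at ?n (a p) (\<lambda>x. h (f (inv_into A a x)))"
    by (rule Cinf_at_cong[OF _ B]) (simp add: chart_inv[OF good_chart_chart[OF g] fB])
  then show "smooth_near M p (\<lambda>x. h (f x))" using good_chart_smooth_near[OF ga A(2)] by simp
qed

lemma smooth_map_imp_smooth_at:
  assumes M: "manifold M" and N: "manifold N" and f: "smooth_map M N f" and p: "p \<in> mcarrier M"
  shows "smooth_at M N p f"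
proof -
  have cf: "continuous_map (mtop M) (mtop N) f" using f by (simp add: smooth_map_def)
  then have "f p \<in> mcarrier N" using p by (auto simp: continuous_map_def)
  then obtain W \<psi> where W: "(W, \<psi>) \<in> matlas N" "f p \<in> W" using manifold_atlas_at[OF N] by blast
  obtain V \<phi> where V: "(V, \<phi>) \<in> matlas M" "p \<in> V" using manifold_atlas_at[OF M p] by blast
  have o: "openin (mtop M) {x\<in>mcarrier M. f x \<in> W}"
    by (rule openin_continuous_map_preimage[OF cf chart_openin[OF manifold_chart[OF N W(1)]]])
  have eq: "V \<inter> f -` W = V \<inter> {x\<in>mcarrier M. f x \<in> W}"
    using openin_subset[OF chart_openin[OF manifold_chart[OF M V(1)]]] by auto
  have o2: "openin (Euclidean_space (mdim M)) (\<phi> ` (V \<inter> f -` W))"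
    unfolding eq by (rule openin_chart_image[OF manifold_chart[OF M V(1)] o])
  show ?thesis
  proof (rule smooth_at_coordI[OF M atlas_good_chart[OF N W(1)] o])
    show "smooth_near M p (\<lambda>x. \<psi> (f x) i)" if i: "i < mdim N" for i
    proof -
      have "Cinf_on (mdim M) (\<phi> ` (V \<inter> f -` W)) (\<lambda>x. \<psi> (f (inv_into V \<phi> x)) i)"
        using f V(1) W(1) i unfolding smooth_map_def by fast
      then have "Cinf_at (mdim M) (\<phi> p) (\<lambda>x. \<psi> (f (inv_into V \<phi> x)) i)"
        by (rule Cinf_atI[OF o2, rotated]) (use V(2) W(2) in auto)
      then show ?thesis using good_chart_smooth_near[OF atlas_good_chart[OF M V(1)] V(2)] by simp
    qed
  qed (use p W(2) in auto)
qed

lemma smooth_mapI: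
  assumes M: "manifold M" and N: "manifold N" and cf: "continuous_map (mtop M) (mtop N) f"
    and f: "\<And>p. p \<in> mcarrier M \<Longrightarrow> smooth_at M N p f"
  shows "smooth_map M N f"
  unfolding smooth_map_def
proof (intro conjI cf, clarify)
  fix V \<phi> W \<psi> i assume V: "(V, \<phi>) \<in> matlas M" and W: "(W, \<psi>) \<in> matlas N" and i: "i < mdim N"
  have o: "openin (mtop M) {x\<in>mcarrier M. f x \<in> W}"
    by (rule openin_continuous_map_preimage[OF cf chart_openin[OF manifold_chart[OF N W]]])
  have eq: "V \<inter> f -` W = V \<inter> {x\<in>mcarrier M. f x \<in> W}"
    using openin_subset[OF chart_openin[OF manifold_chart[OF M V]]] by auto
  show "Cinf_on (mdim M) (\<phi> ` (V \<inter> f -` W)) (\<lambda>x. \<psi> (f (inv_into V \<phi> x)) i)"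
  proof (rule Cinf_on_locally)
    show "openin (Euclidean_space (mdim M)) (\<phi> ` (V \<inter> f -` W))"
      unfolding eq by (rule openin_chart_image[OF manifold_chart[OF M V] o])
    fix x assume "x \<in> \<phi> ` (V \<inter> f -` W)"
    then obtain q where q: "q \<in> V" "f q \<in> W" "x = \<phi> q" by auto
    have "q \<in> mcarrier M" using openin_subset[OF chart_openin[OF manifold_chart[OF M V]]] q(1) by auto
    from smooth_atD[OF f[OF this] smooth_near_coord[OF atlas_good_chart[OF N W] q(2)]]
    have "Cinf_at (mdim M) (\<phi> q) (\<lambda>x. \<psi> (f (inv_into V \<phi> x)) i)"
      using good_chart_smooth_near[OF atlas_good_chart[OF M V] q(1)] by simp
    then show "\<exists>B. openin (Euclidean_space (mdim M)) B \<and> x \<in> B \<and> Cinf_on (mdim M) B (\<lambda>x. \<psi> (f (inv_into V \<phi> x)) i)"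
      unfolding Cinf_at_def q(3) .
  qed
qed

section \<open>Tangent vectors in coordinates\<close>

context
  fixes M :: "'a mfd" and p :: 'a and v :: "'a tvec"
  assumes v: "v \<in> tangent M p"
begin

lemma tangent_not: "\<not> smooth_near M p f \<Longrightarrow> v f = 0"
  using v unfolding tangent_def by blast

lemma tangent_add: "smooth_near M p f \<Longrightarrow> smooth_near M p g \<Longrightarrow> v (\<lambda>x. f x + g x) = v f + v g"
  using v unfolding tangent_def by blast

lemma tangent_cmult: "smooth_near M p f \<Longrightarrow> v (\<lambda>x. c * f x) = c * v f"
  using v unfolding tangent_def by blast

lemma tangent_mult:
  "smooth_near M p f \<Longrightarrow> smooth_near M p g \<Longrightarrow> v (\<lambda>x. f x * g x) = f p * v g + v f * g p"
  using v unfolding tangent_def by blast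

lemma tangent_const: "v (\<lambda>x. c) = 0"
proof (cases "p \<in> mcarrier M")
  case True
  have 1: "smooth_near M p (\<lambda>x. 1)" by (rule smooth_near_const[OF True])
  have "v (\<lambda>x. 1) = 0" using tangent_mult[OF 1 1] by simp
  then show ?thesis using tangent_cmult[OF 1, of c] by simp
next
  case False
  then have "\<not> smooth_near M p (\<lambda>x. c)" by (meson smooth_near_carrier)
  then show ?thesis by (rule tangent_not)
qed

end

lemma smooth_near_diff:
  assumes "manifold M" "smooth_near M p f" "smooth_near M p g"
  shows "smooth_near M p (\<lambda>x. f x - g x)"
  using smooth_near_add[OF assms(1,2) smooth_near_cmult[OF assms(1) smooth_near_carrier[OF assms(2)] assms(3), of "-1"]]
  by simp

lemma smooth_near_sum:
  assumes "manifold M" "p \<in> mcarrier M" "\<And>i. i \<in> A \<Longrightarrow> smooth_near M p (f i)"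
  shows "smooth_near M p (\<lambda>x. \<Sum>i\<in>A. f i x)"
  using assms(3)
  by (induction A rule: infinite_finite_induct)
    (auto intro: smooth_near_const[OF assms(2)] smooth_near_add[OF assms(1)])

lemma tangent_sum:
  assumes M: "manifold M" and p: "p \<in> mcarrier M" and v: "v \<in> tangent M p"
    and f: "\<And>i. i \<in> A \<Longrightarrow> smooth_near M p (f i)"
  shows "v (\<lambda>x. \<Sum>i\<in>A. f i x) = (\<Sum>i\<in>A. v (f i))"
  using f
  by (induction A rule: infinite_finite_induct)
    (simp_all add: tangent_const[OF v] tangent_add[OF v] smooth_near_sum[OF M p])

lemma zero_tangent: "(\<lambda>f. 0) \<in> tangent M p"
  by (simp add: tangent_def)

lemma add_tangent: "v \<in> tangent M p \<Longrightarrow> w \<in> tangent M p \<Longrightarrow> (\<lambda>f. v f + w f) \<in> tangent M p"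
  unfolding tangent_def by (auto simp: algebra_simps)

lemma cmult_tangent: "v \<in> tangent M p \<Longrightarrow> (\<lambda>f. c * v f) \<in> tangent M p"
  unfolding tangent_def by (auto simp: algebra_simps)

lemma sum_tangent:
  "(\<And>i. i \<in> A \<Longrightarrow> v i \<in> tangent M p) \<Longrightarrow> (\<lambda>f. \<Sum>i\<in>A. c i * v i f) \<in> tangent M p"
proof (induction A rule: infinite_finite_induct)
  case (insert i A)
  then show ?case
    using add_tangent[OF cmult_tangent[of "v i" M p "c i"], of "\<lambda>f. \<Sum>i\<in>A. c i * v i f"] by simp
qed (simp_all add: zero_tangent)

text \<open>A tangent vector is determined by its values on coordinates: in the expansion of \<open>f\<close> given by
  Hadamard's lemma, the product rule annihilates everything except \<open>v (u\<^sub>i) * h\<^sub>i (u q)\<close>.\<close>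

theorem tangent_expansion:
  assumes M: "manifold M" and g: "good_chart M U u" and q: "q \<in> U"
    and v: "v \<in> tangent M q" and f: "smooth_near M q f"
  shows "v f = (\<Sum>i<mdim M. v (\<lambda>x. u x i) * partial_deriv i (\<lambda>y. f (inv_into U u y)) (u q))"
proof -
  let ?n = "mdim M"
  note ch = good_chart_chart[OF g]
  have qM: "q \<in> mcarrier M" using openin_subset[OF chart_openin[OF ch]] q by blast
  define F where "F = (\<lambda>y. f (inv_into U u y))"
  obtain W where W: "openin (Euclidean_space ?n) W" "u q \<in> W" "Cinf_on ?n W F"
    using f unfolding good_chart_smooth_near[OF g q] Cinf_at_def F_def by (elim exE conjE)
  have "openin (Euclidean_space ?n) (W \<inter> u ` U)" "u q \<in> W \<inter> u ` U"
    using W chart_openin_image[OF ch] q by auto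
  then obtain e where e: "e > 0" "cube ?n (u q) e \<subseteq> W \<inter> u ` U"
    using openin_contains_cube by metis
  define C where "C = cube ?n (u q) e"
  have C: "openin (Euclidean_space ?n) C" "u q \<in> C"
    unfolding C_def by (rule openin_cube) (rule cube_self[OF chart_in_Euclidean[OF ch q] e(1)])
  have "Cinf_on ?n C F" by (rule Cinf_on_subset[OF W(3) C(1)]) (use e(2) C_def in auto)
  then obtain h where h: "\<And>i. i < ?n \<Longrightarrow> Cinf_on ?n C (h i)"
    "\<And>i. i < ?n \<Longrightarrow> h i (u q) = partial_deriv i F (u q)"
    "\<And>x. x \<in> C \<Longrightarrow> F x = F (u q) + (\<Sum>i<?n. (x i - u q i) * h i x)"
    using Hadamard_lemma[of ?n "u q" e F] C(2) unfolding C_def by metis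
  define U' where "U' = {x\<in>U. u x \<in> C}"
  have U': "openin (mtop M) U'" "q \<in> U'"
    unfolding U'_def using chart_preimage_openin[OF ch C(1)] q C(2) by auto
  define k where "k = (\<lambda>i x. (u x i - u q i) * h i (u x))"
  have d: "smooth_near M q (\<lambda>x. u x i - u q i)" for i
    by (rule smooth_near_diff[OF M smooth_near_coord[OF g q] smooth_near_const[OF qM]])
  have hs: "smooth_near M q (\<lambda>x. h i (u x))" if "i < ?n" for i
    by (rule good_chart_coord[OF g q Cinf_atI[OF C h(1)[OF that]]])
  have ks: "smooth_near M q (k i)" if "i < ?n" for i
    unfolding k_def by (rule smooth_near_mult[OF M d hs[OF that]])
  have vd: "v (\<lambda>x. u x i - u q i) = v (\<lambda>x. u x i)" for i
    using tangent_add[OF v smooth_near_coord[OF g q, of i] smooth_near_const[OF qM, of "- u q i"]]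
      tangent_const[OF v] by simp
  have vk: "v (k i) = v (\<lambda>x. u x i) * partial_deriv i F (u q)" if "i < ?n" for i
    using tangent_mult[OF v d[of i] hs[OF that]] vd[of i] h(2)[OF that] unfolding k_def by simp
  have "v f = v (\<lambda>x. f q + (\<Sum>i<?n. k i x))"
  proof (rule tangent_cong[OF M U' _ v])
    fix x assume "x \<in> U'"
    then show "f x = f q + (\<Sum>i<?n. k i x)"
      using h(3)[of "u x"] chart_inv[OF ch] q by (simp add: U'_def F_def k_def)
  qed
  also have "\<dots> = v (\<lambda>x. \<Sum>i<?n. k i x)"
    using tangent_add[OF v smooth_near_const[OF qM, of "f q"] smooth_near_sum[OF M qM, of "{..<?n}" k]]
      ks tangent_const[OF v] by simp
  also have "\<dots> = (\<Sum>i<?n. v (k i))" by (rule tangent_sum[OF M qM v]) (use ks in simp)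
  also have "\<dots> = (\<Sum>i<?n. v (\<lambda>x. u x i) * partial_deriv i F (u q))" using vk by simp
  finally show ?thesis unfolding F_def .
qed

lemma tangent_eqI:
  assumes M: "manifold M" and g: "good_chart M U u" and q: "q \<in> U"
    and v: "v \<in> tangent M q" and w: "w \<in> tangent M q"
    and eq: "\<And>i. i < mdim M \<Longrightarrow> v (\<lambda>x. u x i) = w (\<lambda>x. u x i)"
  shows "v = w"
proof
  fix f show "v f = w f"
  proof (cases "smooth_near M q f")
    case True
    then show ?thesis
      using tangent_expansion[OF M g q v] tangent_expansion[OF M g q w] eq by simp
  qed (simp add: tangent_not[OF v] tangent_not[OF w])
qed

definition coord_vec :: "'a mfd \<Rightarrow> 'a set \<Rightarrow> ('a \<Rightarrow> nat \<Rightarrow> real) \<Rightarrow> 'a \<Rightarrow> nat \<Rightarrow> 'a tvec"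
  where "coord_vec M U u q i =
    (\<lambda>f. if smooth_near M q f then partial_deriv i (\<lambda>y. f (inv_into U u y)) (u q) else 0)"

lemma coord_vec_tangent:
  assumes M: "manifold M" and g: "good_chart M U u" and q: "q \<in> U" and i: "i < mdim M"
  shows "coord_vec M U u q i \<in> tangent M q"
proof -
  note ch = good_chart_chart[OF g]
  have qM: "q \<in> mcarrier M" using openin_subset[OF chart_openin[OF ch]] q by blast
  let ?d = "\<lambda>f. partial_deriv i (\<lambda>y. f (inv_into U u y)) (u q)"
  have der: "((\<lambda>t. f (inv_into U u ((u q)(i := t)))) has_real_derivative ?d f) (at (u q i))"
    if "smooth_near M q f" for f
    using Cinf_at_has_derivative[OF _ i] that good_chart_smooth_near[OF g q] by blast
  have "?d (\<lambda>x. f x + h x) = ?d f + ?d h" if "smooth_near M q f" "smooth_near M q h" for f h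
    by (rule partial_deriv_eqI) (rule DERIV_add[OF der[OF that(1)] der[OF that(2)]])
  moreover have "?d (\<lambda>x. c * f x) = c * ?d f" if "smooth_near M q f" for f c
    by (rule partial_deriv_eqI) (rule DERIV_cmult[OF der[OF that]])
  moreover have "?d (\<lambda>x. f x * h x) = f q * ?d h + ?d f * h q" if "smooth_near M q f" "smooth_near M q h" for f h
    using DERIV_mult'[OF der[OF that(1)] der[OF that(2)]] chart_inv[OF ch q]
    by (intro partial_deriv_eqI) simp
  ultimately show ?thesis
    unfolding tangent_def coord_vec_def
    by (simp add: smooth_near_add[OF M] smooth_near_mult[OF M] smooth_near_cmult[OF M qM])
qed

lemma coord_vec_coord:
  assumes g: "good_chart M U u" and q: "q \<in> U" and i: "i < mdim M"
  shows "coord_vec M U u q i (\<lambda>x. u x j) = (if i = j then 1 else 0)"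
proof -
  note ch = good_chart_chart[OF g]
  have "partial_deriv i (\<lambda>y. u (inv_into U u y) j) (u q) = (if i = j then 1 else 0)"
  proof (rule partial_deriv_eqI)
    have ev: "\<forall>\<^sub>F t in nhds (u q i). ((u q)(i := t)) j = u (inv_into U u ((u q)(i := t))) j"
      using eventually_upd_in[OF chart_openin_image[OF ch] imageI[OF q] i]
      by eventually_elim (simp add: f_inv_into_f del: fun_upd_apply)
    have "((\<lambda>t. ((u q)(i := t)) j) has_real_derivative (if i = j then 1 else 0)) (at (u q i))"
      by (cases "i = j") (auto intro!: derivative_eq_intros)
    then show "((\<lambda>t. u (inv_into U u ((u q)(i := t))) j) has_real_derivative (if i = j then 1 else 0)) (at (u q i))"
      by (rule DERIV_cong_ev[OF refl ev refl, THEN iffD1])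
  qed
  then show ?thesis using smooth_near_coord[OF g q] by (simp add: coord_vec_def)
qed

lemma tangent_coord_vec_expansion:
  assumes M: "manifold M" and g: "good_chart M U u" and q: "q \<in> U" and v: "v \<in> tangent M q"
  shows "v = (\<lambda>f. \<Sum>i<mdim M. v (\<lambda>x. u x i) * coord_vec M U u q i f)"
proof (rule tangent_eqI[OF M g q v])
  show "(\<lambda>f. \<Sum>i<mdim M. v (\<lambda>x. u x i) * coord_vec M U u q i f) \<in> tangent M q"
    by (rule sum_tangent) (use coord_vec_tangent[OF M g q] in simp)
  show "v (\<lambda>x. u x j) = (\<Sum>i<mdim M. v (\<lambda>x. u x i) * coord_vec M U u q i (\<lambda>x. u x j))" if "j < mdim M" for j
    using that by (simp add: coord_vec_coord[OF g q] if_distrib sum.delta cong: if_cong)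
qed

subsection \<open>Tangent maps\<close>

lemma tmap_tangent:
  assumes N: "manifold N" and f: "smooth_at M N p f" and fp: "f p \<in> mcarrier N" and v: "v \<in> tangent M p"
  shows "tmap N f p v \<in> tangent N (f p)"
  unfolding tangent_def tmap_def mem_Collect_eq
  using tangent_add[OF v] tangent_cmult[OF v] tangent_mult[OF v] smooth_atD[OF f]
  by (simp add: smooth_near_add[OF N] smooth_near_mult[OF N] smooth_near_cmult[OF N fp])

lemma tmap_compose:
  assumes "smooth_at N P (f p) h"
  shows "tmap P (\<lambda>x. h (f x)) p v = tmap P h (f p) (tmap N f p v)"
  using smooth_atD[OF assms] by (auto simp: tmap_def fun_eq_iff)

lemma smooth_at_compose:
  assumes "smooth_at M N p f" "smooth_at N P (f p) h"
  shows "smooth_at M P p (\<lambda>x. h (f x))"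
  unfolding smooth_at_def
proof (intro allI impI)
  fix g assume "smooth_near P (h (f p)) g"
  then show "smooth_near M p (\<lambda>x. g (h (f x)))"
    using smooth_atD[OF assms(1), of "\<lambda>y. g (h y)"] smooth_atD[OF assms(2)] by blast
qed

lemma smooth_at_cong:
  assumes M: "manifold M" and U: "openin (mtop M) U" "p \<in> U" and eq: "\<And>x. x \<in> U \<Longrightarrow> f x = g x"
    and f: "smooth_at M N p f"
  shows "smooth_at M N p g"
  unfolding smooth_at_def
proof (intro allI impI)
  fix h assume "smooth_near N (g p) h"
  then have "smooth_near M p (\<lambda>x. h (f x))" using smooth_atD[OF f] eq[OF U(2)] by simp
  then show "smooth_near M p (\<lambda>x. h (g x))"
    by (rule smooth_near_cong[OF M U, rotated]) (simp add: eq)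
qed

lemma smooth_at_ident: "smooth_at M M p (\<lambda>x. x)"
  by (simp add: smooth_at_def)

lemma smooth_at_const: "p \<in> mcarrier M \<Longrightarrow> smooth_at M N p (\<lambda>x. c)"
  by (simp add: smooth_at_def smooth_near_const)

lemma tmap_cong:
  assumes M: "manifold M" and U: "openin (mtop M) U" "p \<in> U" and eq: "\<And>x. x \<in> U \<Longrightarrow> f x = g x"
    and v: "v \<in> tangent M p"
  shows "tmap N f p v = tmap N g p v"
proof
  fix h
  have "v (\<lambda>x. h (f x)) = v (\<lambda>x. h (g x))"
    by (rule tangent_cong[OF M U _ v]) (simp add: eq)
  then show "tmap N f p v h = tmap N g p v h" using eq[OF U(2)] by (simp add: tmap_def)
qed

lemma tmap_ident: "v \<in> tangent M p \<Longrightarrow> tmap M (\<lambda>x. x) p v = v"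
  using tangent_not by (fastforce simp: tmap_def)

lemma tmap_const: "v \<in> tangent M p \<Longrightarrow> tmap N (\<lambda>x. c) p v = (\<lambda>g. 0)"
  using tangent_const by (fastforce simp: tmap_def)

lemma tmap_add: "tmap N f p (\<lambda>g. v g + w g) = (\<lambda>g. tmap N f p v g + tmap N f p w g)"
  by (auto simp: tmap_def)

lemma tmap_cmult: "tmap N f p (\<lambda>g. c * v g) = (\<lambda>g. c * tmap N f p v g)"
  by (auto simp: tmap_def)

lemma tmap_local_inverse:
  assumes M: "manifold M" and U: "openin (mtop M) U" "p \<in> U"
    and inv: "\<And>x. x \<in> U \<Longrightarrow> g (f x) = x" and g: "smooth_at N M (f p) g" and v: "v \<in> tangent M p"
  shows "tmap M g (f p) (tmap N f p v) = v"
proof -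
  have "tmap M g (f p) (tmap N f p v) = tmap M (\<lambda>x. g (f x)) p v"
    by (rule tmap_compose[symmetric, of N M f p g, OF g])
  also have "\<dots> = tmap M (\<lambda>x. x) p v"
    by (rule tmap_cong[OF M U _ v]) (rule inv)
  finally show ?thesis using tmap_ident[OF v] by simp
qed

subsection \<open>Completing independent functions to coordinates\<close>

text \<open>The inverse function theorem in the form used below. The functions enter the coordinate system one
  at a time: the expansion of the given \<open>v\<close> shows that \<open>f k\<close> has a nonzero partial derivative in a
  coordinate not yet replaced, since \<open>v\<close> annihilates the coordinates \<open>f 0, \<dots>, f (k - 1)\<close>; that
  coordinate gives way to \<open>f k\<close> and is moved to position \<open>k\<close>. The triangular form of the
  independence hypothesis is what surjectivity of a tangent map yields, without linear algebra.\<close>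

theorem complete_to_chart:
  fixes f :: "nat \<Rightarrow> 'a \<Rightarrow> real"
  assumes M: "manifold M" and p: "p \<in> mcarrier M"
    and f: "\<And>k. k < K \<Longrightarrow> smooth_near M p (f k)"
    and indep: "\<And>k. k < K \<Longrightarrow> \<exists>v\<in>tangent M p. v (f k) \<noteq> 0 \<and> (\<forall>i<k. v (f i) = 0)"
  shows "\<exists>U u. good_chart M U u \<and> p \<in> U \<and> K \<le> mdim M \<and> (\<forall>x\<in>U. \<forall>k<K. u x k = f k x)"
  using f indep
proof (induction K)
  case 0
  obtain V \<phi> where "(V, \<phi>) \<in> matlas M" "p \<in> V" using manifold_atlas_at[OF M p] by blast
  then show ?case using atlas_good_chart[OF M] by blast
next
  case (Suc K)
  let ?n = "mdim M"
  obtain U u where g: "good_chart M U u" and pU: "p \<in> U" and K: "K \<le> ?n"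
    and uf: "\<And>x k. x \<in> U \<Longrightarrow> k < K \<Longrightarrow> u x k = f k x"
    using Suc.IH[OF Suc.prems(1)[OF less_SucI] Suc.prems(2)[OF less_SucI]] by blast
  note ch = good_chart_chart[OF g]
  obtain v where v: "v \<in> tangent M p" "v (f K) \<noteq> 0" "\<And>i. i < K \<Longrightarrow> v (f i) = 0"
    using Suc.prems(2)[OF lessI] by blast
  have fK: "smooth_near M p (f K)" by (rule Suc.prems(1)[OF lessI])
  define F where "F = (\<lambda>y. f K (inv_into U u y))"
  have "v (f K) = (\<Sum>i<?n. v (\<lambda>x. u x i) * partial_deriv i F (u p))"
    unfolding F_def by (rule tangent_expansion[OF M g pU v(1) fK])
  then obtain j where j: "j < ?n" "v (\<lambda>x. u x j) * partial_deriv j F (u p) \<noteq> 0"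
    using v(2) by (metis (no_types, lifting) lessThan_iff sum.neutral)
  have jK: "\<not> j < K"
  proof
    assume "j < K"
    then have "v (\<lambda>x. u x j) = v (f j)"
      by (intro tangent_cong[OF M chart_openin[OF ch] pU _ v(1)]) (rule uf)
    then show False using v(3)[OF \<open>j < K\<close>] j(2) by simp
  qed
  have Kn: "K < ?n" using jK j(1) by simp
  obtain W where W: "openin (Euclidean_space ?n) W" "u p \<in> W" "Cinf_on ?n W F"
    using fK unfolding good_chart_smooth_near[OF g pU] Cinf_at_def F_def by (elim exE conjE)
  define W' where "W' = W \<inter> u ` U"
  have W': "openin (Euclidean_space ?n) W'" "u p \<in> W'" "W' \<subseteq> u ` U"
    using W chart_openin_image[OF ch] pU by (auto simp: W'_def)
  have F: "Cinf_on ?n W' F" by (rule Cinf_on_subset[OF W(3) W'(1)]) (simp add: W'_def)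
  have nz: "partial_deriv j F (u p) \<noteq> 0" using j(2) by auto
  obtain C \<eta> where C: "openin (Euclidean_space ?n) C" "u p \<in> C" "C \<subseteq> W'"
    "openin (Euclidean_space ?n) ((\<lambda>x. x(j := F x)) ` C)"
    "\<And>x. x \<in> C \<Longrightarrow> \<eta> (x(j := F x)) = x"
    "\<And>l. Cinf_on ?n ((\<lambda>x. x(j := F x)) ` C) (\<lambda>y. \<eta> y l)"
    by (rule coordinate_change[OF W'(1) F W'(2) j(1) nz]) (rule that)
  have "Cinf_on ?n C (\<lambda>x. (x(j := F x)) l)" for l
    by (cases "l = j") (simp_all add: Cinf_on_subset[OF F C(1,3)] Cinf_on_coord[OF C(1)])
  then have g1: "good_chart M {q\<in>U. u q \<in> C} (\<lambda>q. (\<lambda>x. x(j := F x)) (u q))"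
    using good_chart_compose[where \<theta> = "\<lambda>x. x(j := F x)" and \<eta> = \<eta>, OF g C(1) _ C(4,5) _ C(6)] C(3) W'(3)
    by (simp only: subset_trans)
  note g2 = good_chart_swap[OF g1 j(1) Kn]
  show ?case
  proof (intro exI conjI ballI allI impI)
    show "good_chart M {q\<in>U. u q \<in> C} (\<lambda>q. swap_coords j K ((u q)(j := F (u q))))" using g2 by simp
    show "p \<in> {q\<in>U. u q \<in> C}" using pU C(2) by simp
    show "Suc K \<le> ?n" using Kn by simp
    fix x k assume x: "x \<in> {q\<in>U. u q \<in> C}" and k: "k < Suc K"
    have "F (u x) = f K x" using chart_inv[OF ch] x by (simp add: F_def)
    then show "swap_coords j K ((u x)(j := F (u x))) k = f k x"
      using k jK uf[of x k] x by (auto simp: swap_coords_def less_Suc_eq)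
  qed
qed

section \<open>Open submanifolds, products and Euclidean spaces as manifolds\<close>

lemma mdim_open_mfd [simp]: "mdim (open_mfd M U) = mdim M"
  by (simp add: open_mfd_def)

lemma mcarrier_open_mfd: "openin (mtop M) U \<Longrightarrow> mcarrier (open_mfd M U) = U"
  using openin_subset by (fastforce simp: open_mfd_def)

lemma open_mfd_open_mfd: "V \<subseteq> U \<Longrightarrow> open_mfd (open_mfd M U) V = open_mfd M V"
proof -
  assume "V \<subseteq> U"
  then have "U \<inter> V = V" by blast
  then show ?thesis
    by (simp add: open_mfd_def subtopology_subtopology image_image split_beta Int_assoc)
qed

lemma chart_restrict:
  assumes ch: "chart T n V \<phi>" and U: "openin T U"
  shows "chart T n (V \<inter> U) \<phi>"
  unfolding chart_def
proof (intro conjI)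
  show "openin T (V \<inter> U)" using chart_openin[OF ch] U by blast
  show o: "openin (Euclidean_space n) (\<phi> ` (V \<inter> U))" by (rule openin_chart_image[OF ch U])
  have "homeomorphic_map (subtopology T V) (subtopology (Euclidean_space n) (\<phi> ` V)) \<phi>"
    using ch by (simp add: chart_def)
  then have "homeomorphic_map (subtopology (subtopology T V) (V \<inter> U))
      (subtopology (subtopology (Euclidean_space n) (\<phi> ` V)) (\<phi> ` (V \<inter> U))) \<phi>"
    by (rule homeomorphic_map_subtopologies)
      (use openin_subset[OF chart_openin[OF ch]] openin_subset[OF o] in auto)
  moreover have "V \<inter> (V \<inter> U) = V \<inter> U" "\<phi> ` V \<inter> \<phi> ` (V \<inter> U) = \<phi> ` (V \<inter> U)" by auto
  ultimately show "homeomorphic_map (subtopology T (V \<inter> U)) (subtopology (Euclidean_space n) (\<phi> ` (V \<inter> U))) \<phi>"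
    by (simp add: subtopology_subtopology)
qed

lemma manifold_open_mfd:
  assumes M: "manifold M" and U: "openin (mtop M) U"
  shows "manifold (open_mfd M U)"
proof -
  have atl: "matlas (open_mfd M U) = (\<lambda>(V, \<phi>). (V \<inter> U, \<phi>)) ` matlas M"
    and top: "mtop (open_mfd M U) = subtopology (mtop M) U" by (simp_all add: open_mfd_def)
  have ch: "chart (subtopology (mtop M) U) (mdim M) (V \<inter> U) \<phi>" if V: "(V, \<phi>) \<in> matlas M" for V \<phi>
    using chart_restrict[OF manifold_chart[OF M V] U] U
    by (simp add: chart_def subtopology_subtopology openin_open_subtopology Int_absorb1 Int_commute Int_left_commute)
  have tr: "Cinf_on (mdim M) (\<phi> ` ((V \<inter> U) \<inter> (W \<inter> U))) (\<lambda>x. \<psi> (inv_into (V \<inter> U) \<phi> x) i)"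
    if V: "(V, \<phi>) \<in> matlas M" and W: "(W, \<psi>) \<in> matlas M" and i: "i < mdim M" for V \<phi> W \<psi> i
  proof (rule Cinf_on_cong_subset)
    show "Cinf_on (mdim M) (\<phi> ` (V \<inter> W)) (\<lambda>x. \<psi> (inv_into V \<phi> x) i)"
      using M V W i unfolding manifold_def by fast
    show "openin (Euclidean_space (mdim M)) (\<phi> ` ((V \<inter> U) \<inter> (W \<inter> U)))"
      using openin_chart_image[OF chart_restrict[OF manifold_chart[OF M V] U] openin_Int[OF chart_openin[OF manifold_chart[OF M W]] U]] .
    show "\<psi> (inv_into V \<phi> x) i = \<psi> (inv_into (V \<inter> U) \<phi> x) i" if "x \<in> \<phi> ` ((V \<inter> U) \<inter> (W \<inter> U))" for x
      using that chart_inv[OF manifold_chart[OF M V]]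
        chart_inv[OF chart_restrict[OF manifold_chart[OF M V] U]] by auto
  qed auto
  have "(\<Union>(V, \<phi>)\<in>matlas M. V) = mcarrier M" using M by (simp add: manifold_def)
  then have cover: "(\<Union>(V, \<phi>)\<in>matlas (open_mfd M U). V) = mcarrier (open_mfd M U)"
    unfolding atl mcarrier_open_mfd[OF U] using openin_subset[OF U] by (fastforce simp: split_beta)
  have "Hausdorff_space (subtopology (mtop M) U)" "second_countable (subtopology (mtop M) U)"
    using M by (simp_all add: manifold_def Hausdorff_space_subtopology second_countable_subtopology)
  moreover have "\<forall>(V, \<phi>)\<in>matlas (open_mfd M U). chart (subtopology (mtop M) U) (mdim M) V \<phi>"
    unfolding atl using ch by auto
  moreover have "\<forall>(V, \<phi>)\<in>matlas (open_mfd M U). \<forall>(W, \<psi>)\<in>matlas (open_mfd M U). \<forall>i<mdim M.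
      Cinf_on (mdim M) (\<phi> ` (V \<inter> W)) (\<lambda>x. \<psi> (inv_into V \<phi> x) i)"
    unfolding atl using tr by auto
  ultimately show ?thesis
    unfolding manifold_def mdim_open_mfd top using cover by (simp only: top simp_thms)
qed

context
  fixes M :: "'a mfd" and U
  assumes M: "manifold M" and U: "openin (mtop M) U"
begin

lemma smooth_at_from_open_mfd: "p \<in> U \<Longrightarrow> smooth_at (open_mfd M U) N p f \<longleftrightarrow> smooth_at M N p f"
  by (simp add: smooth_at_def smooth_near_open_mfd[OF M U])

lemma smooth_at_into_open_mfd: "f p \<in> U \<Longrightarrow> smooth_at N (open_mfd M U) p f \<longleftrightarrow> smooth_at N M p f"
  by (simp add: smooth_at_def smooth_near_open_mfd[OF M U])

lemma tmap_open_mfd: "f p \<in> U \<Longrightarrow> tmap (open_mfd M U) f p = tmap M f p"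
  by (simp add: tmap_def smooth_near_open_mfd[OF M U] fun_eq_iff)

lemma cotangent_open_mfd: "p \<in> U \<Longrightarrow> cotangent (open_mfd M U) p = cotangent M p"
  by (simp add: cotangent_def tangent_open_mfd[OF M U])

lemma annihilator_open_mfd: "p \<in> U \<Longrightarrow> annihilator (open_mfd M U) p = annihilator M p"
  by (simp add: annihilator_def cotangent_open_mfd fun_eq_iff)

lemma sharp_open_mfd: "p \<in> U \<Longrightarrow> sharp (open_mfd M U) \<Xi> p = sharp M \<Xi> p"
  by (simp add: sharp_def cotangent_open_mfd tangent_open_mfd[OF M U] fun_eq_iff)

lemma isotropic_open_mfd: "p \<in> U \<Longrightarrow> isotropic (open_mfd M U) \<Xi> p = isotropic M \<Xi> p"
  by (simp add: isotropic_def sharp_open_mfd cotangent_open_mfd annihilator_open_mfd fun_eq_iff)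

end

lemma second_countable_prod_topology:
  assumes X: "second_countable X" and Y: "second_countable Y"
  shows "second_countable (prod_topology X Y)"
proof -
  obtain B where B: "countable B" "\<And>V. V \<in> B \<Longrightarrow> openin X V"
    "\<And>U x. openin X U \<Longrightarrow> x \<in> U \<Longrightarrow> \<exists>V\<in>B. x \<in> V \<and> V \<subseteq> U"
    using X unfolding second_countable_def by metis
  obtain C where C: "countable C" "\<And>V. V \<in> C \<Longrightarrow> openin Y V"
    "\<And>U x. openin Y U \<Longrightarrow> x \<in> U \<Longrightarrow> \<exists>V\<in>C. x \<in> V \<and> V \<subseteq> U"
    using Y unfolding second_countable_def by metis
  show ?thesis
    unfolding second_countable_def
  proof (intro exI[of _ "(\<lambda>(V, W). V \<times> W) ` (B \<times> C)"] conjI allI impI)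
    show "countable ((\<lambda>(V, W). V \<times> W) ` (B \<times> C))" using B(1) C(1) by blast
    show "\<forall>V\<in>(\<lambda>(V, W). V \<times> W) ` (B \<times> C). openin (prod_topology X Y) V"
      using B(2) C(2) by (auto simp: openin_prod_Times_iff)
    fix U z assume z: "openin (prod_topology X Y) U \<and> z \<in> U"
    obtain x y where xy: "z = (x, y)" by (cases z)
    then obtain P Q where PQ: "openin X P" "openin Y Q" "x \<in> P" "y \<in> Q" "P \<times> Q \<subseteq> U"
      using z unfolding openin_prod_topology_alt by blast
    obtain V where V: "V \<in> B" "x \<in> V" "V \<subseteq> P" using B(3)[OF PQ(1,3)] by blast
    obtain W where W: "W \<in> C" "y \<in> W" "W \<subseteq> Q" using C(3)[OF PQ(2,4)] by blast
    show "\<exists>V\<in>(\<lambda>(V, W). V \<times> W) ` (B \<times> C). z \<in> V \<and> V \<subseteq> U"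
      by (rule bexI[of _ "V \<times> W"]) (use V W PQ(5) xy in auto)
  qed
qed

definition fst_coords :: "nat \<Rightarrow> (nat \<Rightarrow> real) \<Rightarrow> nat \<Rightarrow> real"
  where "fst_coords m z = (\<lambda>i. if i < m then z i else 0)"

definition snd_coords :: "nat \<Rightarrow> (nat \<Rightarrow> real) \<Rightarrow> nat \<Rightarrow> real"
  where "snd_coords m z = (\<lambda>i. z (m + i))"

lemma concat_coords_nth:
  "i < m \<Longrightarrow> concat_coords m x y i = x i" "\<not> i < m \<Longrightarrow> concat_coords m x y i = y (i - m)"
  by (simp_all add: concat_coords_def)

lemma fst_coords_concat: "x \<in> topspace (Euclidean_space m) \<Longrightarrow> fst_coords m (concat_coords m x y) = x"
  by (auto simp: fst_coords_def concat_coords_def topspace_Euclidean_space fun_eq_iff)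

lemma snd_coords_concat: "snd_coords m (concat_coords m x y) = y"
  by (simp add: snd_coords_def concat_coords_def)

lemma concat_fst_snd_coords: "concat_coords m (fst_coords m z) (snd_coords m z) = z"
  by (auto simp: fst_coords_def snd_coords_def concat_coords_def fun_eq_iff)

lemma concat_coords_in_Euclidean:
  "y \<in> topspace (Euclidean_space n) \<Longrightarrow> concat_coords m x y \<in> topspace (Euclidean_space (m + n))"
  by (auto simp: concat_coords_def topspace_Euclidean_space)

lemma fst_coords_in_Euclidean: "fst_coords m z \<in> topspace (Euclidean_space m)"
  by (simp add: fst_coords_def topspace_Euclidean_space)

lemma snd_coords_in_Euclidean:
  "z \<in> topspace (Euclidean_space (m + n)) \<Longrightarrow> snd_coords m z \<in> topspace (Euclidean_space n)"
  by (simp add: snd_coords_def topspace_Euclidean_space)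

lemma Cinf_on_fst_coords:
  assumes "openin (Euclidean_space n) W" shows "Cinf_on n W (\<lambda>z. fst_coords m z i)"
  using Cinf_on_coord[OF assms] by (cases "i < m") (simp_all add: fst_coords_def Cinf_on_const)

lemma Cinf_on_snd_coords:
  assumes "openin (Euclidean_space n) W" shows "Cinf_on n W (\<lambda>z. snd_coords m z i)"
  using Cinf_on_coord[OF assms] by (simp add: snd_coords_def)

lemma continuous_map_into_Euclidean:
  assumes "\<And>i. continuous_map X euclideanreal (\<lambda>x. f x i)"
    and "\<And>x. x \<in> topspace X \<Longrightarrow> f x \<in> topspace (Euclidean_space n)"
  shows "continuous_map X (Euclidean_space n) f"
  unfolding Euclidean_space_def continuous_map_in_subtopology
  using assms by (auto simp: continuous_map_componentwise_UNIV topspace_Euclidean_space)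

lemma continuous_map_Euclidean_coord: "continuous_map (Euclidean_space n) euclideanreal (\<lambda>x. x i)"
  unfolding Euclidean_space_def by (intro continuous_map_from_subtopology continuous_map_product_coordinates) simp

lemma openin_fst_snd_coords:
  assumes A: "openin (Euclidean_space m) A" and B: "openin (Euclidean_space n) B"
  shows "openin (Euclidean_space (m + n)) {z\<in>topspace (Euclidean_space (m + n)). fst_coords m z \<in> A \<and> snd_coords m z \<in> B}"
proof -
  let ?E = "topspace (Euclidean_space (m + n))"
  have "openin (Euclidean_space (m + n)) {z\<in>?E. fst_coords m z \<in> A}"
    by (rule openin_Euclidean_preimage[OF openin_topspace A fst_coords_in_Euclidean
          Cinf_on_continuous[OF openin_topspace Cinf_on_fst_coords[OF openin_topspace]]])
  moreover have "openin (Euclidean_space (m + n)) {z\<in>?E. snd_coords m z \<in> B}"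
    by (rule openin_Euclidean_preimage[OF openin_topspace B snd_coords_in_Euclidean
          Cinf_on_continuous[OF openin_topspace Cinf_on_snd_coords[OF openin_topspace]]])
  moreover have "{z\<in>?E. fst_coords m z \<in> A \<and> snd_coords m z \<in> B} = {z\<in>?E. fst_coords m z \<in> A} \<inter> {z\<in>?E. snd_coords m z \<in> B}"
    by blast
  ultimately show ?thesis by (simp only: openin_Int)
qed

lemma concat_image:
  assumes "\<And>p. p \<in> V \<Longrightarrow> \<phi> p \<in> topspace (Euclidean_space m)" "\<And>q. q \<in> W \<Longrightarrow> \<psi> q \<in> topspace (Euclidean_space n)"
  shows "(\<lambda>(p, q). concat_coords m (\<phi> p) (\<psi> q)) ` (V \<times> W) =
    {z\<in>topspace (Euclidean_space (m + n)). fst_coords m z \<in> \<phi> ` V \<and> snd_coords m z \<in> \<psi> ` W}"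
    (is "?c ` _ = ?Z")
proof (intro equalityI subsetI)
  fix z assume "z \<in> ?c ` (V \<times> W)"
  then obtain p q where pq: "p \<in> V" "q \<in> W" "z = concat_coords m (\<phi> p) (\<psi> q)" by auto
  show "z \<in> ?Z"
    unfolding pq(3) using pq(1,2) assms by (simp add: fst_coords_concat snd_coords_concat concat_coords_in_Euclidean)
next
  fix z assume "z \<in> ?Z"
  then obtain p q where "p \<in> V" "q \<in> W" "fst_coords m z = \<phi> p" "snd_coords m z = \<psi> q" by auto
  then have "z = ?c (p, q)" using concat_fst_snd_coords[of m z] by simp
  then show "z \<in> ?c ` (V \<times> W)" using \<open>p \<in> V\<close> \<open>q \<in> W\<close> by blast
qed

lemma chart_inv_continuous_map:
  assumes ch: "chart T n V \<phi>"
  shows "continuous_map (subtopology (Euclidean_space n) (\<phi> ` V)) (subtopology T V) (inv_into V \<phi>)"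
proof -
  obtain k where k: "homeomorphic_maps (subtopology T V) (subtopology (Euclidean_space n) (\<phi> ` V)) \<phi> k"
    using ch unfolding chart_def homeomorphic_map_maps by blast
  show ?thesis
  proof (rule continuous_map_eq)
    show "continuous_map (subtopology (Euclidean_space n) (\<phi> ` V)) (subtopology T V) k"
      using k by (simp add: homeomorphic_maps_def)
    show "k x = inv_into V \<phi> x" if "x \<in> topspace (subtopology (Euclidean_space n) (\<phi> ` V))" for x
      using that k openin_subset[OF chart_openin[OF ch]] chart_inv[OF ch] by (auto simp: homeomorphic_maps_def)
  qed
qed

lemma chart_prod:
  assumes c1: "chart S m V \<phi>" and c2: "chart T n W \<psi>"
  shows "chart (prod_topology S T) (m + n) (V \<times> W) (\<lambda>(p, q). concat_coords m (\<phi> p) (\<psi> q))"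
    and "\<And>z. z \<in> (\<lambda>(p, q). concat_coords m (\<phi> p) (\<psi> q)) ` (V \<times> W) \<Longrightarrow>
      inv_into (V \<times> W) (\<lambda>(p, q). concat_coords m (\<phi> p) (\<psi> q)) z =
      (inv_into V \<phi> (fst_coords m z), inv_into W \<psi> (snd_coords m z))"
proof -
  define c where "c = (\<lambda>(p, q). concat_coords m (\<phi> p) (\<psi> q))"
  define d where "d = (\<lambda>z. (inv_into V \<phi> (fst_coords m z), inv_into W \<psi> (snd_coords m z)))"
  have dc: "d (c x) = x" if "x \<in> V \<times> W" for x
    using that chart_in_Euclidean[OF c1] chart_inv[OF c1] chart_inv[OF c2]
    by (auto simp: c_def d_def fst_coords_concat snd_coords_concat)
  have im: "c ` (V \<times> W) = {z\<in>topspace (Euclidean_space (m + n)). fst_coords m z \<in> \<phi> ` V \<and> snd_coords m z \<in> \<psi> ` W}"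
    unfolding c_def by (rule concat_image) (rule chart_in_Euclidean[OF c1], assumption, rule chart_in_Euclidean[OF c2], assumption)
  have o: "openin (Euclidean_space (m + n)) (c ` (V \<times> W))"
    unfolding im by (rule openin_fst_snd_coords[OF chart_openin_image[OF c1] chart_openin_image[OF c2]])
  have VS: "V \<subseteq> topspace S" "W \<subseteq> topspace T"
    using openin_subset[OF chart_openin[OF c1]] openin_subset[OF chart_openin[OF c2]] by auto
  have h1: "homeomorphic_map (subtopology S V) (subtopology (Euclidean_space m) (\<phi> ` V)) \<phi>"
    and h2: "homeomorphic_map (subtopology T W) (subtopology (Euclidean_space n) (\<psi> ` W)) \<psi>"
    using c1 c2 by (simp_all add: chart_def)
  have coord1: "continuous_map (subtopology S V) euclideanreal (\<lambda>p. \<phi> p i)" for i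
    using continuous_map_compose[OF homeomorphic_imp_continuous_map[OF h1]
        continuous_map_from_subtopology[OF continuous_map_Euclidean_coord[of m i]]] by (simp add: o_def)
  have coord2: "continuous_map (subtopology T W) euclideanreal (\<lambda>p. \<psi> p i)" for i
    using continuous_map_compose[OF homeomorphic_imp_continuous_map[OF h2]
        continuous_map_from_subtopology[OF continuous_map_Euclidean_coord[of n i]]] by (simp add: o_def)
  let ?P = "prod_topology (subtopology S V) (subtopology T W)"
  have cc: "continuous_map ?P (Euclidean_space (m + n)) c"
  proof (rule continuous_map_into_Euclidean)
    show "continuous_map ?P euclideanreal (\<lambda>x. c x i)" for i
    proof (cases "i < m")
      case True
      then show ?thesis
        using continuous_map_compose[OF continuous_map_fst coord1[of i], of "subtopology T W"]
        by (simp add: c_def o_def split_beta concat_coords_def)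
    next
      case False
      then show ?thesis
        using continuous_map_compose[OF continuous_map_snd coord2[of "i - m"], of "subtopology S V"]
        by (simp add: c_def o_def split_beta concat_coords_def)
    qed
    show "c x \<in> topspace (Euclidean_space (m + n))" if "x \<in> topspace ?P" for x
      using that im by auto
  qed
  note inv1 = chart_inv_continuous_map[OF c1] and inv2 = chart_inv_continuous_map[OF c2]
  let ?Z = "subtopology (Euclidean_space (m + n)) (c ` (V \<times> W))"
  have f: "continuous_map ?Z (subtopology (Euclidean_space m) (\<phi> ` V)) (fst_coords m)"
    unfolding continuous_map_in_subtopology
  proof
    show "continuous_map ?Z (Euclidean_space m) (fst_coords m)"
    proof (rule continuous_map_into_Euclidean[OF _ fst_coords_in_Euclidean])
      show "continuous_map ?Z euclideanreal (\<lambda>z. fst_coords m z i)" for i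
        using continuous_map_from_subtopology[OF continuous_map_Euclidean_coord[of "m + n" i]]
        by (cases "i < m") (simp_all add: fst_coords_def)
    qed
  qed (use im in auto)
  have s: "continuous_map ?Z (subtopology (Euclidean_space n) (\<psi> ` W)) (snd_coords m)"
    unfolding continuous_map_in_subtopology
  proof
    show "continuous_map ?Z (Euclidean_space n) (snd_coords m)"
    proof (rule continuous_map_into_Euclidean)
      show "continuous_map ?Z euclideanreal (\<lambda>z. snd_coords m z i)" for i
        using continuous_map_from_subtopology[OF continuous_map_Euclidean_coord[of "m + n" "m + i"]]
        by (simp add: snd_coords_def)
    qed (use snd_coords_in_Euclidean in auto)
  qed (use im in auto)
  have cd: "continuous_map ?Z ?P d"
    unfolding d_def using continuous_map_compose[OF f inv1] continuous_map_compose[OF s inv2]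
    by (intro continuous_map_pairedI) (simp_all add: o_def)
  have "homeomorphic_maps ?P ?Z c d"
    unfolding homeomorphic_maps_def
  proof (intro conjI ballI)
    show "continuous_map ?P ?Z c" using cc VS by (auto simp: continuous_map_in_subtopology)
    show "d (c x) = x" if "x \<in> topspace ?P" for x using that dc by auto
    show "c (d z) = z" if "z \<in> topspace ?Z" for z using that dc by auto
  qed (rule cd)
  then have "homeomorphic_map (subtopology (prod_topology S T) (V \<times> W)) ?Z c"
    unfolding subtopology_Times by (rule homeomorphic_maps_imp_map)
  then have ch: "chart (prod_topology S T) (m + n) (V \<times> W) c"
    unfolding chart_def using o chart_openin[OF c1] chart_openin[OF c2] by (simp add: openin_prod_Times_iff)
  then show "chart (prod_topology S T) (m + n) (V \<times> W) (\<lambda>(p, q). concat_coords m (\<phi> p) (\<psi> q))"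
    unfolding c_def .
  fix z assume "z \<in> (\<lambda>(p, q). concat_coords m (\<phi> p) (\<psi> q)) ` (V \<times> W)"
  then obtain x where x: "x \<in> V \<times> W" "z = c x" unfolding c_def by blast
  show "inv_into (V \<times> W) (\<lambda>(p, q). concat_coords m (\<phi> p) (\<psi> q)) z =
      (inv_into V \<phi> (fst_coords m z), inv_into W \<psi> (snd_coords m z))"
    using chart_inv[OF ch x(1)] dc[OF x(1)] unfolding x(2) c_def[symmetric] by (simp add: d_def)
qed

lemma mdim_prod_mfd [simp]: "mdim (prod_mfd M N) = mdim M + mdim N"
  by (simp add: prod_mfd_def)

lemma mtop_prod_mfd [simp]: "mtop (prod_mfd M N) = prod_topology (mtop M) (mtop N)"
  by (simp add: prod_mfd_def)

lemma prod_mfd_atlas: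
  "(V, \<phi>) \<in> matlas M \<Longrightarrow> (W, \<psi>) \<in> matlas N \<Longrightarrow>
    (V \<times> W, \<lambda>(p, q). concat_coords (mdim M) (\<phi> p) (\<psi> q)) \<in> matlas (prod_mfd M N)"
  by (force simp: prod_mfd_def)

lemma manifold_prod_mfd:
  assumes M: "manifold M" and N: "manifold N"
  shows "manifold (prod_mfd M N)"
proof -
  let ?m = "mdim M" and ?n = "mdim N"
  have atl: "matlas (prod_mfd M N) = (\<lambda>((V, \<phi>), (W, \<psi>)). (V \<times> W, \<lambda>(p, q). concat_coords ?m (\<phi> p) (\<psi> q)))
      ` (matlas M \<times> matlas N)" by (simp add: prod_mfd_def)
  have ch: "chart (prod_topology (mtop M) (mtop N)) (?m + ?n) (V \<times> W) (\<lambda>(p, q). concat_coords ?m (\<phi> p) (\<psi> q))"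
    if "(V, \<phi>) \<in> matlas M" "(W, \<psi>) \<in> matlas N" for V \<phi> W \<psi>
    by (rule chart_prod(1)[OF manifold_chart[OF M that(1)] manifold_chart[OF N that(2)]])
  have tr: "Cinf_on (?m + ?n) ((\<lambda>(p, q). concat_coords ?m (\<phi> p) (\<psi> q)) ` ((V \<times> W) \<inter> (V' \<times> W')))
      (\<lambda>z. (\<lambda>(p, q). concat_coords ?m (\<phi>' p) (\<psi>' q)) (inv_into (V \<times> W) (\<lambda>(p, q). concat_coords ?m (\<phi> p) (\<psi> q)) z) i)"
    if V: "(V, \<phi>) \<in> matlas M" and W: "(W, \<psi>) \<in> matlas N" and V': "(V', \<phi>') \<in> matlas M" and W': "(W', \<psi>') \<in> matlas N"
      and i: "i < ?m + ?n" for V \<phi> W \<psi> V' \<phi>' W' \<psi>' i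
  proof -
    let ?c = "\<lambda>(p, q). concat_coords ?m (\<phi> p) (\<psi> q)"
    define Z where "Z = ?c ` ((V \<times> W) \<inter> (V' \<times> W'))"
    note cV = manifold_chart[OF M V] and cV' = manifold_chart[OF M V']
      and cW = manifold_chart[OF N W] and cW' = manifold_chart[OF N W']
    have Z: "openin (Euclidean_space (?m + ?n)) Z"
      unfolding Z_def
      by (rule openin_chart_image[OF ch[OF V W]])
        (simp add: openin_prod_Times_iff chart_openin[OF cV'] chart_openin[OF cW'])
    have Zf: "fst_coords ?m z \<in> \<phi> ` (V \<inter> V')" and Zs: "snd_coords ?m z \<in> \<psi> ` (W \<inter> W')"
      and inv: "inv_into (V \<times> W) ?c z = (inv_into V \<phi> (fst_coords ?m z), inv_into W \<psi> (snd_coords ?m z))"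
      if z: "z \<in> Z" for z
    proof -
      show "inv_into (V \<times> W) ?c z = (inv_into V \<phi> (fst_coords ?m z), inv_into W \<psi> (snd_coords ?m z))"
        by (rule chart_prod(2)[OF cV cW]) (use z in \<open>auto simp: Z_def\<close>)
      obtain p q where pq: "p \<in> V \<inter> V'" "q \<in> W \<inter> W'" "z = concat_coords ?m (\<phi> p) (\<psi> q)"
        using z unfolding Z_def by auto
      show "fst_coords ?m z \<in> \<phi> ` (V \<inter> V')" "snd_coords ?m z \<in> \<psi> ` (W \<inter> W')"
        using pq(1,2) chart_in_Euclidean[OF cV] unfolding pq(3) by (simp_all add: fst_coords_concat snd_coords_concat)
    qed
    show ?thesis
    proof (cases "i < ?m")
      case True
      have "Cinf_on (?m + ?n) Z (\<lambda>z. (\<lambda>x. \<phi>' (inv_into V \<phi> x) i) (fst_coords ?m z))"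
      proof (rule Cinf_on_compose[where g = "fst_coords ?m" and f = "\<lambda>x. \<phi>' (inv_into V \<phi> x) i", OF Z _ Zf])
        show "openin (Euclidean_space ?m) (\<phi> ` (V \<inter> V'))" by (rule openin_chart_image[OF cV chart_openin[OF cV']])
        show "Cinf_on ?m (\<phi> ` (V \<inter> V')) (\<lambda>x. \<phi>' (inv_into V \<phi> x) i)"
          using M V V' True unfolding manifold_def by fast
      qed (assumption, rule Cinf_on_fst_coords[OF Z])
      then have "Cinf_on (?m + ?n) Z (\<lambda>z. (\<lambda>(p, q). concat_coords ?m (\<phi>' p) (\<psi>' q)) (inv_into (V \<times> W) ?c z) i)"
        by (rule Cinf_on_cong_subset[OF _ Z subset_refl]) (simp add: inv concat_coords_nth True)
      then show ?thesis unfolding Z_def .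
    next
      case False
      have "Cinf_on (?m + ?n) Z (\<lambda>z. (\<lambda>x. \<psi>' (inv_into W \<psi> x) (i - ?m)) (snd_coords ?m z))"
      proof (rule Cinf_on_compose[where g = "snd_coords ?m" and f = "\<lambda>x. \<psi>' (inv_into W \<psi> x) (i - ?m)", OF Z _ Zs])
        show "openin (Euclidean_space ?n) (\<psi> ` (W \<inter> W'))" by (rule openin_chart_image[OF cW chart_openin[OF cW']])
        have "i - ?m < ?n" using i False by simp
        then show "Cinf_on ?n (\<psi> ` (W \<inter> W')) (\<lambda>x. \<psi>' (inv_into W \<psi> x) (i - ?m))"
          using N W W' unfolding manifold_def by fast
      qed (assumption, rule Cinf_on_snd_coords[OF Z])
      then have "Cinf_on (?m + ?n) Z (\<lambda>z. (\<lambda>(p, q). concat_coords ?m (\<phi>' p) (\<psi>' q)) (inv_into (V \<times> W) ?c z) i)"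
        by (rule Cinf_on_cong_subset[OF _ Z subset_refl]) (simp add: inv concat_coords_nth False)
      then show ?thesis unfolding Z_def .
    qed
  qed
  have "(\<Union>(V, \<phi>)\<in>matlas M. V) = mcarrier M" "(\<Union>(V, \<phi>)\<in>matlas N. V) = mcarrier N"
    using M N by (simp_all add: manifold_def)
  then have cover: "(\<Union>(V, \<phi>)\<in>matlas (prod_mfd M N). V) = mcarrier M \<times> mcarrier N"
    unfolding atl by (fastforce simp: split_beta)
  have "Hausdorff_space (prod_topology (mtop M) (mtop N))" "second_countable (prod_topology (mtop M) (mtop N))"
    using M N by (simp_all add: manifold_def Hausdorff_space_prod_topology second_countable_prod_topology)
  moreover have "\<forall>(V, \<phi>)\<in>matlas (prod_mfd M N). chart (prod_topology (mtop M) (mtop N)) (?m + ?n) V \<phi>"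
    unfolding atl using ch by auto
  moreover have "\<forall>(V, \<phi>)\<in>matlas (prod_mfd M N). \<forall>(W, \<psi>)\<in>matlas (prod_mfd M N). \<forall>i<?m + ?n.
      Cinf_on (?m + ?n) (\<phi> ` (V \<inter> W)) (\<lambda>x. \<psi> (inv_into V \<phi> x) i)"
    unfolding atl using tr by fast
  ultimately show ?thesis
    unfolding manifold_def mdim_prod_mfd mtop_prod_mfd using cover by simp
qed

definition eucl_mfd :: "nat \<Rightarrow> (nat \<Rightarrow> real) mfd"
  where "eucl_mfd n = \<lparr>mtop = Euclidean_space n, mdim = n,
    matlas = {(topspace (Euclidean_space n), \<lambda>x. x)}\<rparr>"

lemma manifold_eucl_mfd: "manifold (eucl_mfd n)"
proof -
  obtain B :: "(nat \<Rightarrow> real) set set" where B: "countable B" "\<And>C. C \<in> B \<Longrightarrow> open C"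
    "\<And>S. open S \<Longrightarrow> \<exists>U. U \<subseteq> B \<and> S = \<Union>U" by (rule univ_second_countable) (rule that)
  have "second_countable (euclidean :: (nat \<Rightarrow> real) topology)"
    unfolding second_countable_def
  proof (intro exI[of _ B] conjI allI impI)
    fix U and x :: "nat \<Rightarrow> real" assume "openin euclidean U \<and> x \<in> U"
    then obtain A where "A \<subseteq> B" "U = \<Union>A" "x \<in> U" using B(3)[of U] by auto
    then show "\<exists>V\<in>B. x \<in> V \<and> V \<subseteq> U" by blast
  qed (use B in auto)
  then have sc: "second_countable (Euclidean_space n)"
    by (metis Euclidean_space_eq_top_of_set second_countable_subtopology)
  have inv: "inv_into (topspace (Euclidean_space n)) (\<lambda>x. x) y = y" if "y \<in> topspace (Euclidean_space n)" for y
    using inv_into_f_f[of "\<lambda>x. x" "topspace (Euclidean_space n)" y] that by simp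
  have "Cinf_on n (topspace (Euclidean_space n)) (\<lambda>x. inv_into (topspace (Euclidean_space n)) (\<lambda>x. x) x i)" for i
    by (rule Cinf_on_cong_subset[OF Cinf_on_coord[OF openin_topspace, of n i] openin_topspace subset_refl])
      (simp add: inv)
  then show ?thesis
    using sc Hausdorff_Euclidean_space homeomorphic_map_id[of "Euclidean_space n" "Euclidean_space n"]
    unfolding manifold_def eucl_mfd_def chart_def by (simp add: id_def)
qed

subsection \<open>Tangent spaces of a product\<close>

context
  fixes N :: "'b mfd" and L :: "'l mfd"
  assumes N: "manifold N" and L: "manifold L"
begin

lemma smooth_at_fst:
  assumes "q \<in> mcarrier (prod_mfd N L)"
  shows "smooth_at (prod_mfd N L) N q fst"
proof -
  obtain n l where q: "q = (n, l)" "n \<in> mcarrier N" "l \<in> mcarrier L" using assms by (cases q) auto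
  obtain V \<phi> where V: "(V, \<phi>) \<in> matlas N" "n \<in> V" using manifold_atlas_at[OF N q(2)] .
  obtain W \<psi> where W: "(W, \<psi>) \<in> matlas L" "l \<in> W" using manifold_atlas_at[OF L q(3)] .
  note g = atlas_good_chart[OF manifold_prod_mfd[OF N L] prod_mfd_atlas[OF V(1) W(1)]]
  have qVW: "q \<in> V \<times> W" using q V W by simp
  show ?thesis
  proof (rule smooth_at_coordI[OF manifold_prod_mfd[OF N L] atlas_good_chart[OF N V(1)] chart_openin[OF good_chart_chart[OF g]] qVW])
    show "fst x \<in> V" if "x \<in> V \<times> W" for x using that by auto
    show "smooth_near (prod_mfd N L) q (\<lambda>x. \<phi> (fst x) i)" if "i < mdim N" for i
      using smooth_near_coord[OF g qVW, of i] that by (simp add: split_beta concat_coords_def)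
  qed
qed

lemma smooth_at_snd:
  assumes "q \<in> mcarrier (prod_mfd N L)"
  shows "smooth_at (prod_mfd N L) L q snd"
proof -
  obtain n l where q: "q = (n, l)" "n \<in> mcarrier N" "l \<in> mcarrier L" using assms by (cases q) auto
  obtain V \<phi> where V: "(V, \<phi>) \<in> matlas N" "n \<in> V" using manifold_atlas_at[OF N q(2)] .
  obtain W \<psi> where W: "(W, \<psi>) \<in> matlas L" "l \<in> W" using manifold_atlas_at[OF L q(3)] .
  note g = atlas_good_chart[OF manifold_prod_mfd[OF N L] prod_mfd_atlas[OF V(1) W(1)]]
  have qVW: "q \<in> V \<times> W" using q V W by simp
  show ?thesis
  proof (rule smooth_at_coordI[OF manifold_prod_mfd[OF N L] atlas_good_chart[OF L W(1)] chart_openin[OF good_chart_chart[OF g]] qVW])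
    show "snd x \<in> W" if "x \<in> V \<times> W" for x using that by auto
    show "smooth_near (prod_mfd N L) q (\<lambda>x. \<psi> (snd x) i)" if "i < mdim L" for i
      using smooth_near_coord[OF g qVW, of "mdim N + i"] by (simp add: split_beta concat_coords_def)
  qed
qed

lemma smooth_at_pair:
  assumes M: "manifold M" and p: "p \<in> mcarrier M" and f: "smooth_at M N p f" and h: "smooth_at M L p h"
    and cf: "continuous_map (mtop M) (mtop N) f" and ch: "continuous_map (mtop M) (mtop L) h"
  shows "smooth_at M (prod_mfd N L) p (\<lambda>x. (f x, h x))"
proof -
  have "f p \<in> mcarrier N" "h p \<in> mcarrier L" using cf ch p by (auto simp: continuous_map_def)
  obtain V \<phi> where V: "(V, \<phi>) \<in> matlas N" "f p \<in> V" using manifold_atlas_at[OF N \<open>f p \<in> mcarrier N\<close>] .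
  obtain W \<psi> where W: "(W, \<psi>) \<in> matlas L" "h p \<in> W" using manifold_atlas_at[OF L \<open>h p \<in> mcarrier L\<close>] .
  note g = atlas_good_chart[OF manifold_prod_mfd[OF N L] prod_mfd_atlas[OF V(1) W(1)]]
  define U where "U = {x\<in>mcarrier M. f x \<in> V} \<inter> {x\<in>mcarrier M. h x \<in> W}"
  have U: "openin (mtop M) U" "p \<in> U"
    unfolding U_def
    using openin_continuous_map_preimage[OF cf chart_openin[OF manifold_chart[OF N V(1)]]]
      openin_continuous_map_preimage[OF ch chart_openin[OF manifold_chart[OF L W(1)]]] p V W by auto
  show ?thesis
  proof (rule smooth_at_coordI[OF M g U])
    show "(f x, h x) \<in> V \<times> W" if "x \<in> U" for x using that by (auto simp: U_def)
    have 1: "smooth_near M p (\<lambda>x. \<phi> (f x) i)" for i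
      by (rule smooth_atD[OF f smooth_near_coord[OF atlas_good_chart[OF N V(1)] V(2)]])
    have 2: "smooth_near M p (\<lambda>x. \<psi> (h x) i)" for i
      by (rule smooth_atD[OF h smooth_near_coord[OF atlas_good_chart[OF L W(1)] W(2)]])
    show "smooth_near M p (\<lambda>x. (case (f x, h x) of (p, q) \<Rightarrow> concat_coords (mdim N) (\<phi> p) (\<psi> q)) i)" for i
      using 1[of i] 2[of "i - mdim N"] by (cases "i < mdim N") (simp_all add: concat_coords_def)
  qed
qed

lemma smooth_at_slice:
  assumes n: "n \<in> mcarrier N" and l: "l \<in> mcarrier L"
  shows "smooth_at N (prod_mfd N L) n (\<lambda>x. (x, l))"
  by (rule smooth_at_pair[OF N n smooth_at_ident smooth_at_const[OF n]]) (use l in auto)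

lemma smooth_at_slice':
  assumes n: "n \<in> mcarrier N" and l: "l \<in> mcarrier L"
  shows "smooth_at L (prod_mfd N L) l (\<lambda>y. (n, y))"
  by (rule smooth_at_pair[OF L l smooth_at_const[OF l] smooth_at_ident]) (use n in auto)

lemma tangent_prod_eqI:
  assumes q: "q \<in> mcarrier (prod_mfd N L)" and v: "v \<in> tangent (prod_mfd N L) q" and w: "w \<in> tangent (prod_mfd N L) q"
    and 1: "tmap N fst q v = tmap N fst q w" and 2: "tmap L snd q v = tmap L snd q w"
  shows "v = w"
proof -
  obtain n l where ql: "q = (n, l)" "n \<in> mcarrier N" "l \<in> mcarrier L" using q by (cases q) auto
  obtain V \<phi> where V: "(V, \<phi>) \<in> matlas N" "n \<in> V" using manifold_atlas_at[OF N ql(2)] .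
  obtain W \<psi> where W: "(W, \<psi>) \<in> matlas L" "l \<in> W" using manifold_atlas_at[OF L ql(3)] .
  note g = atlas_good_chart[OF manifold_prod_mfd[OF N L] prod_mfd_atlas[OF V(1) W(1)]]
  have qVW: "q \<in> V \<times> W" using ql V W by simp
  show ?thesis
  proof (rule tangent_eqI[OF manifold_prod_mfd[OF N L] g qVW v w])
    fix i
    have "smooth_near N (fst q) (\<lambda>x. \<phi> x i)" "smooth_near L (snd q) (\<lambda>x. \<psi> x j)" for j
      using smooth_near_coord[OF atlas_good_chart[OF N V(1)] V(2)]
        smooth_near_coord[OF atlas_good_chart[OF L W(1)] W(2)] ql(1) by simp_all
    then have "v (\<lambda>x. \<phi> (fst x) i) = w (\<lambda>x. \<phi> (fst x) i)"
      "v (\<lambda>x. \<psi> (snd x) (i - mdim N)) = w (\<lambda>x. \<psi> (snd x) (i - mdim N))"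
      using fun_cong[OF 1, of "\<lambda>x. \<phi> x i"] fun_cong[OF 2, of "\<lambda>x. \<psi> x (i - mdim N)"]
      by (simp_all add: tmap_def)
    then show "v (\<lambda>x. (case x of (p, q) \<Rightarrow> concat_coords (mdim N) (\<phi> p) (\<psi> q)) i) =
        w (\<lambda>x. (case x of (p, q) \<Rightarrow> concat_coords (mdim N) (\<phi> p) (\<psi> q)) i)"
      by (cases "i < mdim N") (simp_all add: split_beta concat_coords_def)
  qed
qed

text \<open>A vector of the product is determined by its two projections, and the slice through \<open>q\<close> realises
  every vector whose second projection is 0. In this form \<open>TN \<times> 0\<close> can be compared with the kernel of
  a tangent map on \<open>M\<close>.\<close>

theorem dist_times_zero_eq_ker_snd:
  assumes q: "q \<in> mcarrier (prod_mfd N L)"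
  shows "dist_times_zero N L (tangent N) q = ker_tmap (prod_mfd N L) L snd q"
proof -
  let ?Q = "prod_mfd N L"
  obtain n l where ql: "q = (n, l)" "n \<in> mcarrier N" "l \<in> mcarrier L" using q by (cases q) auto
  have sl: "smooth_at N ?Q n (\<lambda>x. (x, l))" by (rule smooth_at_slice[OF ql(2,3)])
  have c1: "tmap N fst q (tmap ?Q (\<lambda>x. (x, l)) n v) = v" if v: "v \<in> tangent N n" for v
  proof -
    have "smooth_at ?Q N ((\<lambda>x. (x, l)) n) fst" using smooth_at_fst[OF q] ql(1) by simp
    from tmap_compose[where f = "\<lambda>x. (x, l)" and h = fst, OF this, of v]
    show ?thesis using tmap_ident[OF v] ql(1) by simp
  qed
  have c2: "tmap L snd q (tmap ?Q (\<lambda>x. (x, l)) n v) = (\<lambda>g. 0)" if v: "v \<in> tangent N n" for v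
  proof -
    have "smooth_at ?Q L ((\<lambda>x. (x, l)) n) snd" using smooth_at_snd[OF q] ql(1) by simp
    from tmap_compose[where f = "\<lambda>x. (x, l)" and h = snd, OF this, of v]
    show ?thesis using tmap_const[OF v, of L l] ql(1) by simp
  qed
  have T: "tmap ?Q (\<lambda>x. (x, l)) n v \<in> tangent ?Q q" if v: "v \<in> tangent N n" for v
    using tmap_tangent[OF manifold_prod_mfd[OF N L] sl _ v] ql q by simp
  have D: "dist_times_zero N L (tangent N) q = tmap ?Q (\<lambda>x. (x, l)) n ` tangent N n"
    by (simp add: dist_times_zero_def ql(1))
  show ?thesis
    unfolding D
  proof (intro equalityI subsetI)
    fix w assume "w \<in> tmap ?Q (\<lambda>x. (x, l)) n ` tangent N n"
    then show "w \<in> ker_tmap ?Q L snd q" using T c2 by (auto simp: ker_tmap_def)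
  next
    fix w assume "w \<in> ker_tmap ?Q L snd q"
    then have w: "w \<in> tangent ?Q q" "tmap L snd q w = (\<lambda>g. 0)" by (simp_all add: ker_tmap_def)
    define v where "v = tmap N fst q w"
    have v: "v \<in> tangent N n"
      using tmap_tangent[OF N smooth_at_fst[OF q] _ w(1)] ql by (simp add: v_def)
    have "w = tmap ?Q (\<lambda>x. (x, l)) n v"
      by (rule tangent_prod_eqI[OF q w(1) T[OF v]]) (use c1[OF v] c2[OF v] w(2) in \<open>simp_all add: v_def\<close>)
    then show "w \<in> tmap ?Q (\<lambda>x. (x, l)) n ` tangent N n" using v by blast
  qed
qed

lemma tmap_snd_surj:
  assumes q: "q \<in> mcarrier (prod_mfd N L)"
  shows "tmap L snd q ` tangent (prod_mfd N L) q = tangent L (snd q)"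
proof (intro equalityI subsetI)
  let ?Q = "prod_mfd N L"
  obtain n l where ql: "q = (n, l)" "n \<in> mcarrier N" "l \<in> mcarrier L" using q by (cases q) auto
  {
    fix w assume "w \<in> tmap L snd q ` tangent ?Q q"
    then show "w \<in> tangent L (snd q)"
      using tmap_tangent[OF L smooth_at_snd[OF q]] ql by auto
  next
    fix w assume "w \<in> tangent L (snd q)"
    then have w: "w \<in> tangent L l" using ql(1) by simp
    have sl: "smooth_at L ?Q l (\<lambda>y. (n, y))" by (rule smooth_at_slice'[OF ql(2,3)])
    have "smooth_at ?Q L ((\<lambda>y. (n, y)) l) snd" using smooth_at_snd[OF q] ql(1) by simp
    from tmap_compose[where f = "\<lambda>y. (n, y)" and h = snd, OF this, of w]
    have "w = tmap L snd q (tmap ?Q (\<lambda>y. (n, y)) l w)" using tmap_ident[OF w] ql(1) by simp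
    moreover have "tmap ?Q (\<lambda>y. (n, y)) l w \<in> tangent ?Q q"
      using tmap_tangent[OF manifold_prod_mfd[OF N L] sl _ w] q ql(1) by simp
    ultimately show "w \<in> tmap L snd q ` tangent ?Q q" by blast
  }
qed

end

section \<open>Poisson tensors\<close>

lemma differential_cotangent: "differential M f p \<in> cotangent M p"
  by (auto simp: cotangent_def differential_def add_tangent cmult_tangent)

lemma cotangent_add:
  "\<alpha> \<in> cotangent M p \<Longrightarrow> v \<in> tangent M p \<Longrightarrow> w \<in> tangent M p \<Longrightarrow> \<alpha> (\<lambda>f. v f + w f) = \<alpha> v + \<alpha> w"
  by (simp add: cotangent_def)

lemma cotangent_cmult:
  "\<alpha> \<in> cotangent M p \<Longrightarrow> v \<in> tangent M p \<Longrightarrow> \<alpha> (\<lambda>f. c * v f) = c * \<alpha> v"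
  by (simp add: cotangent_def)

lemma cotangent_outside: "\<alpha> \<in> cotangent M p \<Longrightarrow> v \<notin> tangent M p \<Longrightarrow> \<alpha> v = 0"
  by (simp add: cotangent_def)

lemma cotangentI:
  assumes "\<And>v. v \<notin> tangent M p \<Longrightarrow> \<alpha> v = 0"
    and "\<And>v w. v \<in> tangent M p \<Longrightarrow> w \<in> tangent M p \<Longrightarrow> \<alpha> (\<lambda>f. v f + w f) = \<alpha> v + \<alpha> w"
    and "\<And>c v. v \<in> tangent M p \<Longrightarrow> \<alpha> (\<lambda>f. c * v f) = c * \<alpha> v"
  shows "\<alpha> \<in> cotangent M p"
  unfolding cotangent_def mem_Collect_eq by (intro conjI allI ballI impI assms)

lemma cotangent_sum:
  assumes \<alpha>: "\<alpha> \<in> cotangent M p" and v: "\<And>i. i \<in> A \<Longrightarrow> v i \<in> tangent M p"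
  shows "\<alpha> (\<lambda>f. \<Sum>i\<in>A. c i * v i f) = (\<Sum>i\<in>A. c i * \<alpha> (v i))"
proof -
  note add = cotangent_add[OF \<alpha>] and cm = cotangent_cmult[OF \<alpha>]
  have 0: "\<alpha> (\<lambda>f. 0) = 0" using cm[OF zero_tangent, of 0] by simp
  show ?thesis
    using v
    by (induction A rule: infinite_finite_induct)
      (simp_all add: 0 add[OF cmult_tangent sum_tangent] cm)
qed

context
  fixes M :: "'a mfd" and \<Xi> :: "'a bivector" and p
  assumes P: "poisson_manifold M \<Xi>" and p: "p \<in> mcarrier M"
begin

lemma manifold_poisson: "manifold M"
  using P by (simp add: poisson_manifold_def)

lemma poisson_bilinear:
  assumes "\<alpha> \<in> cotangent M p" "\<beta> \<in> cotangent M p"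
  shows "(\<forall>\<gamma>\<in>cotangent M p. \<Xi> p (\<lambda>v. \<alpha> v + \<beta> v) \<gamma> = \<Xi> p \<alpha> \<gamma> + \<Xi> p \<beta> \<gamma>) \<and>
    (\<forall>c. \<Xi> p (\<lambda>v. c * \<alpha> v) \<beta> = c * \<Xi> p \<alpha> \<beta>)"
proof -
  have "\<forall>\<alpha>\<in>cotangent M p. \<forall>\<beta>\<in>cotangent M p. \<Xi> p \<alpha> \<beta> = - \<Xi> p \<beta> \<alpha> \<and>
      (\<forall>\<gamma>\<in>cotangent M p. \<Xi> p (\<lambda>v. \<alpha> v + \<beta> v) \<gamma> = \<Xi> p \<alpha> \<gamma> + \<Xi> p \<beta> \<gamma>) \<and>
      (\<forall>c. \<Xi> p (\<lambda>v. c * \<alpha> v) \<beta> = c * \<Xi> p \<alpha> \<beta>)"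
    by (rule bspec[OF conjunct1[OF conjunct2[OF P[unfolded poisson_manifold_def]]] p])
  from bspec[OF bspec[OF this assms(1)] assms(2)] show ?thesis by (rule conjunct2)
qed

lemma poisson_add:
  "\<alpha> \<in> cotangent M p \<Longrightarrow> \<beta> \<in> cotangent M p \<Longrightarrow> \<gamma> \<in> cotangent M p \<Longrightarrow>
    \<Xi> p (\<lambda>v. \<alpha> v + \<beta> v) \<gamma> = \<Xi> p \<alpha> \<gamma> + \<Xi> p \<beta> \<gamma>"
  by (rule bspec[OF conjunct1[OF poisson_bilinear]])

lemma poisson_cmult:
  "\<alpha> \<in> cotangent M p \<Longrightarrow> \<beta> \<in> cotangent M p \<Longrightarrow> \<Xi> p (\<lambda>v. c * \<alpha> v) \<beta> = c * \<Xi> p \<alpha> \<beta>"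
  by (rule spec[OF conjunct2[OF poisson_bilinear]])

lemma poisson_sum:
  assumes \<beta>: "\<beta> \<in> cotangent M p" and \<alpha>: "\<And>i. i \<in> A \<Longrightarrow> \<alpha> i \<in> cotangent M p"
  shows "(\<lambda>v. \<Sum>i\<in>A. c i * \<alpha> i v) \<in> cotangent M p \<and>
    \<Xi> p (\<lambda>v. \<Sum>i\<in>A. c i * \<alpha> i v) \<beta> = (\<Sum>i\<in>A. c i * \<Xi> p (\<alpha> i) \<beta>)"
proof -
  have 0: "(\<lambda>v. 0) \<in> cotangent M p" by (simp add: cotangent_def)
  have 00: "\<Xi> p (\<lambda>v. 0) \<beta> = 0" using poisson_cmult[OF 0 \<beta>, of 0] by simp
  have add: "(\<lambda>v. a v + b v) \<in> cotangent M p" if "a \<in> cotangent M p" "b \<in> cotangent M p" for a b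
    using that by (simp add: cotangent_def algebra_simps)
  have cm: "(\<lambda>v. c * a v) \<in> cotangent M p" if "a \<in> cotangent M p" for a c
    using that by (simp add: cotangent_def algebra_simps)
  show ?thesis
    using \<alpha>
  proof (induction A rule: infinite_finite_induct)
    case (insert i A)
    have i: "\<alpha> i \<in> cotangent M p" by (rule insert.prems) simp
    have IH: "(\<lambda>v. \<Sum>i\<in>A. c i * \<alpha> i v) \<in> cotangent M p"
      "\<Xi> p (\<lambda>v. \<Sum>i\<in>A. c i * \<alpha> i v) \<beta> = (\<Sum>i\<in>A. c i * \<Xi> p (\<alpha> i) \<beta>)"
      using insert.IH[OF insert.prems] by auto
    show ?case
      using add[OF cm[OF i] IH(1), of "c i"] poisson_add[OF cm[OF i] IH(1) \<beta>, of "c i"]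
        poisson_cmult[OF i \<beta>, of "c i"] IH(2) insert.hyps by simp
  qed (simp_all add: 0 00)
qed

lemma cotangent_separates:
  assumes v: "v \<in> tangent M p" and w: "w \<in> tangent M p"
    and eq: "\<And>\<alpha>. \<alpha> \<in> cotangent M p \<Longrightarrow> \<alpha> v = \<alpha> w"
  shows "v = w"
proof
  fix f show "v f = w f"
    using eq[OF differential_cotangent[of M f p]] v w by (simp add: differential_def)
qed

text \<open>Finite dimension enters here: in coordinates \<open>u\<close>, the functional \<open>\<alpha> \<mapsto> \<Xi>(\<alpha>, \<beta>)\<close> on covectors is
  evaluation at the vector with components \<open>\<Xi>(du\<^sub>i, \<beta>)\<close>, because \<open>\<alpha>\<close> is a combination of the \<open>du\<^sub>i\<close>.
  That vector is unique since differentials of functions separate tangent vectors.\<close>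

theorem sharp_tangent:
  assumes \<beta>: "\<beta> \<in> cotangent M p"
  shows "sharp M \<Xi> p \<beta> \<in> tangent M p" and "\<And>\<alpha>. \<alpha> \<in> cotangent M p \<Longrightarrow> \<alpha> (sharp M \<Xi> p \<beta>) = \<Xi> p \<alpha> \<beta>"
proof -
  obtain U u where U: "(U, u) \<in> matlas M" "p \<in> U" using manifold_atlas_at[OF manifold_poisson p] .
  note g = atlas_good_chart[OF manifold_poisson U(1)]
  let ?n = "mdim M"
  define e where "e = coord_vec M U u p"
  define du where "du = (\<lambda>i. differential M (\<lambda>x. u x i) p)"
  have e: "e i \<in> tangent M p" if "i < ?n" for i
    unfolding e_def by (rule coord_vec_tangent[OF manifold_poisson g U(2) that])
  define v where "v = (\<lambda>f. \<Sum>i<?n. \<Xi> p (du i) \<beta> * e i f)"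
  have v: "v \<in> tangent M p" unfolding v_def by (rule sum_tangent) (simp add: e)
  have \<alpha>v: "\<alpha> v = \<Xi> p \<alpha> \<beta>" if \<alpha>: "\<alpha> \<in> cotangent M p" for \<alpha>
  proof -
    have "\<alpha> w = (\<Sum>i<?n. \<alpha> (e i) * du i w)" for w
    proof (cases "w \<in> tangent M p")
      case True
      have "\<alpha> w = \<alpha> (\<lambda>f. \<Sum>i<?n. w (\<lambda>x. u x i) * e i f)"
        using tangent_coord_vec_expansion[OF manifold_poisson g U(2) True] unfolding e_def by simp
      also have "\<dots> = (\<Sum>i<?n. w (\<lambda>x. u x i) * \<alpha> (e i))"
        by (rule cotangent_sum[OF \<alpha>]) (simp add: e)
      finally show ?thesis using True by (simp add: du_def differential_def mult.commute)
    next
      case False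
      then show ?thesis using \<alpha> by (simp add: du_def differential_def cotangent_def)
    qed
    then have \<alpha>eq: "\<alpha> = (\<lambda>w. \<Sum>i<?n. \<alpha> (e i) * du i w)" by (rule ext)
    have "\<alpha> v = (\<Sum>i<?n. \<Xi> p (du i) \<beta> * \<alpha> (e i))"
      unfolding v_def by (rule cotangent_sum[OF \<alpha>]) (simp add: e)
    also have "\<dots> = (\<Sum>i<?n. \<alpha> (e i) * \<Xi> p (du i) \<beta>)" by (simp add: mult.commute)
    also have "\<dots> = \<Xi> p (\<lambda>w. \<Sum>i<?n. \<alpha> (e i) * du i w) \<beta>"
      by (rule conjunct2[OF poisson_sum[OF \<beta>], symmetric]) (simp add: du_def differential_cotangent)
    also have "\<dots> = \<Xi> p \<alpha> \<beta>" unfolding \<alpha>eq[symmetric] ..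
    finally show ?thesis .
  qed
  have "sharp M \<Xi> p \<beta> = v"
    unfolding sharp_def
    by (rule the_equality) (use v \<alpha>v cotangent_separates in auto)
  then show "sharp M \<Xi> p \<beta> \<in> tangent M p" "\<And>\<alpha>. \<alpha> \<in> cotangent M p \<Longrightarrow> \<alpha> (sharp M \<Xi> p \<beta>) = \<Xi> p \<alpha> \<beta>"
    using v \<alpha>v by simp_all
qed

end

lemma hamiltonian_vf_tangent:
  "poisson_manifold M \<Xi> \<Longrightarrow> p \<in> mcarrier M \<Longrightarrow> hamiltonian_vf M \<Xi> H p \<in> tangent M p"
  unfolding hamiltonian_vf_def by (rule sharp_tangent(1)[OF _ _ differential_cotangent])

text \<open>By definition \<open>\<Phi>\<^sup>*\<Xi>\<close> is \<open>\<Xi>\<close> conjugated by the tangent map of \<open>\<Phi>\<close> and its transpose, and the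
  transpose carries the annihilator of \<open>\<Phi>\<^sub>* V\<close> onto that of \<open>V\<close>. Only the tangent map at one point
  matters, so \<open>\<Phi>\<close> may be inverted locally.\<close>

theorem sharp_ann_pullback:
  assumes P: "poisson_manifold M \<Xi>" and \<Phi>q: "\<Phi> q \<in> mcarrier M"
    and bij: "bij_betw (tmap M \<Phi> q) (tangent P q) (tangent M (\<Phi> q))"
    and V: "V \<subseteq> tangent P q"
  shows "tmap M \<Phi> q ` (sharp P (pullback_bivector P M \<Xi> \<Phi>) q ` annihilator P q V) =
    sharp M \<Xi> (\<Phi> q) ` annihilator M (\<Phi> q) (tmap M \<Phi> q ` V)"
    and "sharp P (pullback_bivector P M \<Xi> \<Phi>) q ` annihilator P q V \<subseteq> tangent P q"
proof -
  define T where "T = tmap M \<Phi> q"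
  define Ti where "Ti = inv_into (tangent P q) T"
  define A where "A = cotmap P M \<Phi> q"
  define Ai where "Ai = inv_into (cotangent M (\<Phi> q)) A"
  define B where "B = pullback_bivector P M \<Xi> \<Phi>"
  have T: "inj_on T (tangent P q)" "T ` tangent P q = tangent M (\<Phi> q)"
    using bij by (simp_all add: T_def bij_betw_def)
  have Tadd: "T (\<lambda>g. v g + w g) = (\<lambda>g. T v g + T w g)" and Tcm: "T (\<lambda>g. c * v g) = (\<lambda>g. c * T v g)" for v w c
    unfolding T_def by (rule tmap_add, rule tmap_cmult)
  have TiT: "Ti (T v) = v" if "v \<in> tangent P q" for v using T(1) that by (simp add: Ti_def)
  have TTi: "Ti w \<in> tangent P q" "T (Ti w) = w" if "w \<in> tangent M (\<Phi> q)" for w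
    using that TiT unfolding T(2)[symmetric] by auto
  have Ap: "A \<beta> v = \<beta> (T v)" if "v \<in> tangent P q" for \<beta> v using that by (simp add: A_def T_def cotmap_def)
  have A0: "A \<beta> v = 0" if "v \<notin> tangent P q" for \<beta> v using that by (simp add: A_def cotmap_def)
  have TP: "T v \<in> tangent M (\<Phi> q)" if "v \<in> tangent P q" for v using T(2) that by blast
  have Acot: "A \<beta> \<in> cotangent P q" if \<beta>: "\<beta> \<in> cotangent M (\<Phi> q)" for \<beta>
    by (rule cotangentI)
      (simp_all add: A0 Ap add_tangent cmult_tangent Tadd Tcm TP cotangent_add[OF \<beta>] cotangent_cmult[OF \<beta>])
  have Ainj: "inj_on A (cotangent M (\<Phi> q))"
  proof (rule inj_onI)
    fix \<beta> \<gamma> assume bc: "\<beta> \<in> cotangent M (\<Phi> q)" "\<gamma> \<in> cotangent M (\<Phi> q)" "A \<beta> = A \<gamma>"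
    have "\<beta> w = \<gamma> w" for w
    proof (cases "w \<in> tangent M (\<Phi> q)")
      case True
      show ?thesis using Ap[OF TTi(1)[OF True], of \<beta>] Ap[OF TTi(1)[OF True], of \<gamma>] bc(3) TTi(2)[OF True] by simp
    qed (simp add: cotangent_outside[OF bc(1)] cotangent_outside[OF bc(2)])
    then show "\<beta> = \<gamma>" by (rule ext)
  qed
  have Asurj: "\<exists>\<beta>\<in>cotangent M (\<Phi> q). A \<beta> = \<gamma>" if \<gamma>: "\<gamma> \<in> cotangent P q" for \<gamma>
  proof -
    define \<beta> where "\<beta> = (\<lambda>w. if w \<in> tangent M (\<Phi> q) then \<gamma> (Ti w) else 0)"
    have Tiadd: "Ti (\<lambda>g. v g + w g) = (\<lambda>g. Ti v g + Ti w g)"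
      if "v \<in> tangent M (\<Phi> q)" "w \<in> tangent M (\<Phi> q)" for v w
      using TiT[OF add_tangent[OF TTi(1)[OF that(1)] TTi(1)[OF that(2)]]] TTi(2) that unfolding Tadd by simp
    have Ticm: "Ti (\<lambda>g. c * v g) = (\<lambda>g. c * Ti v g)" if "v \<in> tangent M (\<Phi> q)" for v c
      using TiT[OF cmult_tangent[OF TTi(1)[OF that], of c]] TTi(2) that unfolding Tcm by simp
    have "\<beta> \<in> cotangent M (\<Phi> q)"
      by (rule cotangentI)
        (simp_all add: \<beta>_def add_tangent cmult_tangent Tiadd Ticm cotangent_add[OF \<gamma>] cotangent_cmult[OF \<gamma>] TTi(1))
    moreover have "A \<beta> = \<gamma>"
    proof
      fix v show "A \<beta> v = \<gamma> v"
        by (cases "v \<in> tangent P q")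
          (simp_all add: A0 Ap \<beta>_def TP TiT cotangent_outside[OF \<gamma>])
    qed
    ultimately show ?thesis by blast
  qed
  have AiA: "Ai (A \<beta>) = \<beta>" if "\<beta> \<in> cotangent M (\<Phi> q)" for \<beta> using Ainj that by (simp add: Ai_def)
  have ann: "A ` annihilator M (\<Phi> q) (T ` V) = annihilator P q V"
  proof (intro equalityI subsetI)
    fix \<gamma> assume "\<gamma> \<in> A ` annihilator M (\<Phi> q) (T ` V)"
    then show "\<gamma> \<in> annihilator P q V" using Acot Ap V by (auto simp: annihilator_def subset_iff)
  next
    fix \<gamma> assume \<gamma>: "\<gamma> \<in> annihilator P q V"
    then obtain \<beta> where \<beta>: "\<beta> \<in> cotangent M (\<Phi> q)" "A \<beta> = \<gamma>" using Asurj by (auto simp: annihilator_def)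
    have "\<beta> (T v) = 0" if "v \<in> V" for v
      using \<gamma> \<beta>(2) Ap[of v \<beta>] V that by (auto simp: annihilator_def)
    then have "\<beta> \<in> annihilator M (\<Phi> q) (T ` V)" using \<beta>(1) by (auto simp: annihilator_def)
    then show "\<gamma> \<in> A ` annihilator M (\<Phi> q) (T ` V)" using \<beta>(2) by blast
  qed
  have sharp: "T (sharp P B q (A \<beta>)) = sharp M \<Xi> (\<Phi> q) \<beta>" "sharp P B q (A \<beta>) \<in> tangent P q" if \<beta>: "\<beta> \<in> cotangent M (\<Phi> q)" for \<beta>
  proof -
    note s = sharp_tangent(1)[OF P \<Phi>q \<beta>]
    have Bq: "B q \<alpha> (A \<beta>) = \<alpha> (Ti (sharp M \<Xi> (\<Phi> q) \<beta>))" for \<alpha>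
      using AiA[OF \<beta>] by (simp add: B_def pullback_bivector_def Ti_def T_def Ai_def A_def)
    have "sharp P B q (A \<beta>) = Ti (sharp M \<Xi> (\<Phi> q) \<beta>)"
      unfolding sharp_def[of P] Bq
    proof (rule the_equality)
      fix v assume v: "v \<in> tangent P q \<and> (\<forall>\<alpha>\<in>cotangent P q. \<alpha> v = \<alpha> (Ti (sharp M \<Xi> (\<Phi> q) \<beta>)))"
      show "v = Ti (sharp M \<Xi> (\<Phi> q) \<beta>)"
      proof
        fix f
        have "differential P f q v = differential P f q (Ti (sharp M \<Xi> (\<Phi> q) \<beta>))"
          using bspec[OF conjunct2[OF v] differential_cotangent[of P f q]] .
        then show "v f = Ti (sharp M \<Xi> (\<Phi> q) \<beta>) f"
          using conjunct1[OF v] TTi(1)[OF s] by (simp add: differential_def)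
      qed
    qed (use TTi(1)[OF s] in simp)
    then show "T (sharp P B q (A \<beta>)) = sharp M \<Xi> (\<Phi> q) \<beta>" "sharp P B q (A \<beta>) \<in> tangent P q"
      using TTi[OF s] by simp_all
  qed
  have "T ` sharp P B q ` annihilator P q V = (\<lambda>\<beta>. T (sharp P B q (A \<beta>))) ` annihilator M (\<Phi> q) (T ` V)"
    unfolding ann[symmetric] by (simp add: image_image)
  also have "\<dots> = sharp M \<Xi> (\<Phi> q) ` annihilator M (\<Phi> q) (T ` V)"
    by (rule image_cong[OF refl]) (simp add: sharp annihilator_def)
  finally show "tmap M \<Phi> q ` (sharp P (pullback_bivector P M \<Xi> \<Phi>) q ` annihilator P q V) =
      sharp M \<Xi> (\<Phi> q) ` annihilator M (\<Phi> q) (tmap M \<Phi> q ` V)" unfolding T_def B_def .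
  have "sharp P B q ` annihilator P q V \<subseteq> tangent P q"
    unfolding ann[symmetric] using sharp(2) by (auto simp: annihilator_def)
  then show "sharp P (pullback_bivector P M \<Xi> \<Phi>) q ` annihilator P q V \<subseteq> tangent P q" unfolding B_def .
qed

section \<open>Transport of integral submanifolds\<close>

text \<open>The part of \<open>S\<close> in \<open>W\<close> is carried over to the image under \<open>\<Phi>\<close> by relabelling its points. Its own
  topology is kept, as \<open>S\<close> may be merely immersed.\<close>

theorem integral_submanifold_transport:
  assumes P: "manifold P" and M: "manifold M" and W: "openin (mtop P) W" and inj: "inj_on \<Phi> W"
    and cont: "continuous_map (subtopology (mtop P) W) (mtop M) \<Phi>"
    and smooth: "\<And>q. q \<in> W \<Longrightarrow> smooth_at P M q \<Phi>"
    and tinj: "\<And>q. q \<in> W \<Longrightarrow> inj_on (tmap M \<Phi> q) (tangent P q)"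
    and D': "\<And>q. q \<in> W \<Longrightarrow> D' (\<Phi> q) = tmap M \<Phi> q ` D q"
    and S: "integral_submanifold P D S" and p: "p \<in> mcarrier S" "p \<in> W"
  shows "\<exists>S'. \<Phi> p \<in> mcarrier S' \<and> integral_submanifold M D' S'"
proof -
  have mS: "manifold S" and incl: "smooth_map S P (\<lambda>x. x)"
    and Si: "\<And>q. q \<in> mcarrier S \<Longrightarrow> inj_on (tmap P (\<lambda>x. x) q) (tangent S q)"
    and SD: "\<And>q. q \<in> mcarrier S \<Longrightarrow> tmap P (\<lambda>x. x) q ` tangent S q = D q"
    and SP: "mcarrier S \<subseteq> mcarrier P"
    using S by (auto simp: integral_submanifold_def)
  have ci: "continuous_map (mtop S) (mtop P) (\<lambda>x. x)" using incl by (simp add: smooth_map_def)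
  define A where "A = {x\<in>mcarrier S. x \<in> W}"
  have A: "openin (mtop S) A" unfolding A_def by (rule openin_continuous_map_preimage[OF ci W])
  define S0 where "S0 = open_mfd S A"
  have m0: "manifold S0" unfolding S0_def by (rule manifold_open_mfd[OF mS A])
  have c0: "mcarrier S0 = A" unfolding S0_def by (rule mcarrier_open_mfd[OF A])
  have inj0: "inj_on \<Phi> (mcarrier S0)" unfolding c0 by (rule inj_on_subset[OF inj]) (auto simp: A_def)
  define S' where "S' = transport_mfd \<Phi> S0"
  have m': "manifold S'" unfolding S'_def by (rule manifold_transport[OF m0 inj0])
  have c': "mcarrier S' = \<Phi> ` A" unfolding S'_def mcarrier_transport[OF m0 inj0] c0 ..
  have incl_at: "smooth_at S P x (\<lambda>x. x)" if "x \<in> A" for x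
    by (rule smooth_map_imp_smooth_at[OF mS P incl]) (use that A_def in auto)
  have tS0: "tangent S0 x = tangent S x" if "x \<in> A" for x
    unfolding S0_def by (rule tangent_open_mfd[OF mS A that])
  have near: "smooth_near S' (\<Phi> x) g" if x: "x \<in> A" and g: "smooth_near M (\<Phi> x) g" for x g
  proof -
    have "smooth_near P x (\<lambda>y. g (\<Phi> y))" using smooth_atD[OF smooth g] x by (simp add: A_def)
    then have "smooth_near S x (\<lambda>y. g (\<Phi> y))" using smooth_atD[OF incl_at[OF x]] by simp
    then have "smooth_near S0 x (\<lambda>y. g (\<Phi> y))" unfolding S0_def using smooth_near_open_mfd[OF mS A x] by simp
    then show ?thesis
      unfolding S'_def using smooth_near_transport[OF m0 inj0] x c0 by simp
  qed
  have \<Phi>M: "\<Phi> x \<in> mcarrier M" if "x \<in> A" for x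
    using cont that openin_subset[OF W] by (auto simp: continuous_map_def A_def)
  have comp: "tmap M (\<lambda>y. y) (\<Phi> x) (tmap S' \<Phi> x v) = tmap M \<Phi> x (tmap P (\<lambda>y. y) x v)" if x: "x \<in> A" for x v
  proof
    fix g show "tmap M (\<lambda>y. y) (\<Phi> x) (tmap S' \<Phi> x v) g = tmap M \<Phi> x (tmap P (\<lambda>y. y) x v) g"
      using near[OF x, of g] smooth_atD[OF smooth, of x g] x by (auto simp: tmap_def A_def)
  qed
  have tS': "tangent S' (\<Phi> x) = tmap S' \<Phi> x ` tangent S x" if x: "x \<in> A" for x
    using tangent_transport[OF m0 inj0, of x] tS0[OF x] x c0 unfolding S'_def by simp
  have DP: "D x \<subseteq> tangent P x" if x: "x \<in> A" for x
  proof
    fix y assume "y \<in> D x"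
    then have "y \<in> tmap P (\<lambda>x. x) x ` tangent S x" using SD[of x] x by (simp add: A_def)
    then show "y \<in> tangent P x"
      using tmap_tangent[OF P incl_at[OF x]] x SP by (auto simp: A_def)
  qed
  have "integral_submanifold M D' S'"
    unfolding integral_submanifold_def
  proof (intro conjI ballI m')
    show "mcarrier S' \<subseteq> mcarrier M" unfolding c' using \<Phi>M by auto
    have cS': "continuous_map (mtop S') (mtop M) (\<lambda>x. x)"
    proof -
      have "continuous_map (mtop S') (mtop S0) (inv_into (mcarrier S0) \<Phi>)"
        unfolding S'_def by (rule homeomorphic_imp_continuous_map[OF homeo_transport_inv[OF m0 inj0]])
      moreover have "continuous_map (mtop S0) (subtopology (mtop P) W) (\<lambda>x. x)"
        unfolding S0_def open_mfd_def continuous_map_in_subtopology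
        using continuous_map_from_subtopology[OF ci] by (auto simp: A_def)
      ultimately have "continuous_map (mtop S') (subtopology (mtop P) W) (inv_into (mcarrier S0) \<Phi>)"
        using continuous_map_compose by (fastforce simp: o_def)
      from continuous_map_compose[OF this cont]
      have "continuous_map (mtop S') (mtop M) (\<lambda>x. \<Phi> (inv_into (mcarrier S0) \<Phi> x))" by (simp add: o_def)
      then show ?thesis
        by (rule continuous_map_eq) (auto simp: c' c0 f_inv_into_f)
    qed
    show "smooth_map S' M (\<lambda>x. x)"
    proof (rule smooth_mapI[OF m' M cS'])
      show "smooth_at S' M y (\<lambda>x. x)" if "y \<in> mcarrier S'" for y
        using that near unfolding c' smooth_at_def by auto
    qed
    fix y assume "y \<in> mcarrier S'"
    then obtain x where x: "x \<in> A" "y = \<Phi> x" unfolding c' by auto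
    have xS: "x \<in> mcarrier S" "x \<in> W" using x(1) by (auto simp: A_def)
    have i: "inj_on (\<lambda>v. tmap M \<Phi> x (tmap P (\<lambda>y. y) x v)) (tangent S x)"
    proof -
      have "inj_on (tmap M \<Phi> x \<circ> tmap P (\<lambda>y. y) x) (tangent S x)"
        by (rule comp_inj_on[OF Si[OF xS(1)]])
          (rule inj_on_subset[OF tinj[OF xS(2)]], use DP[OF x(1)] SD[OF xS(1)] in simp)
      then show ?thesis by (simp add: o_def)
    qed
    show "inj_on (tmap M (\<lambda>x. x) y) (tangent S' y)"
      unfolding x(2) tS'[OF x(1)]
      by (rule inj_onI) (use i comp[OF x(1)] in \<open>auto dest: inj_onD\<close>)
    show "tmap M (\<lambda>x. x) y ` tangent S' y = D' y"
      unfolding x(2) tS'[OF x(1)] image_image comp[OF x(1)] D'[OF xS(2)] SD[OF xS(1), symmetric] ..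
  qed
  moreover have "\<Phi> p \<in> mcarrier S'" unfolding c' using p by (auto simp: A_def)
  ultimately show ?thesis by blast
qed

section \<open>Local diffeomorphisms and kernels of tangent maps\<close>

text \<open>Germs already see the topology: the function that is 0 on an open set \<open>A\<close> and 1 elsewhere is smooth
  at the points of \<open>A\<close>, and if \<open>f p\<close> is such a point, its composite with \<open>f\<close> can be
  continuous at \<open>p\<close> only if \<open>f\<close> maps a neighbourhood of \<open>p\<close> into \<open>A\<close>.\<close>

lemma smooth_at_imp_continuous_map:
  assumes M: "manifold M" and N: "manifold N"
    and f: "\<And>p. p \<in> mcarrier M \<Longrightarrow> f p \<in> mcarrier N" "\<And>p. p \<in> mcarrier M \<Longrightarrow> smooth_at M N p f"
  shows "continuous_map (mtop M) (mtop N) f"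
  unfolding continuous_map_def
proof (intro conjI allI impI)
  show "f \<in> mcarrier M \<rightarrow> mcarrier N" using f(1) by blast
  fix A assume A: "openin (mtop N) A"
  show "openin (mtop M) {x\<in>mcarrier M. f x \<in> A}"
  proof (subst openin_subopen, intro ballI)
    fix x assume "x \<in> {x\<in>mcarrier M. f x \<in> A}"
    then have x: "x \<in> mcarrier M" "f x \<in> A" by auto
    define h :: "'b \<Rightarrow> real" where "h = (\<lambda>z. if z \<in> A then 0 else 1)"
    have "smooth_near N (f x) h"
      by (rule smooth_near_cong[OF N A x(2) _ smooth_near_const[OF f(1)[OF x(1)], of 0]]) (simp add: h_def)
    then have near: "smooth_near M x (\<lambda>y. h (f y))" by (rule smooth_atD[OF f(2)[OF x(1)]])
    obtain V \<phi> where V: "(V, \<phi>) \<in> matlas M" "x \<in> V" using manifold_atlas_at[OF M x(1)] .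
    note g = atlas_good_chart[OF M V(1)] and ch = manifold_chart[OF M V(1)]
    define k where "k = (\<lambda>y. h (f (inv_into V \<phi> y)))"
    obtain W where W: "openin (Euclidean_space (mdim M)) W" "\<phi> x \<in> W" "Cinf_on (mdim M) W k"
      using near unfolding good_chart_smooth_near[OF g V(2)] Cinf_at_def k_def by (elim exE conjE)
    define W' where "W' = {y\<in>W. 1 - k y > 0}"
    have W': "openin (Euclidean_space (mdim M)) W'"
      unfolding W'_def by (intro openin_pos[OF W(1)] continuous_intros Cinf_on_continuous[OF W(1,3)])
    have kx: "k (\<phi> y) = h (f y)" if "y \<in> V" for y using chart_inv[OF ch that] by (simp add: k_def)
    have 1: "openin (mtop M) {y\<in>V. \<phi> y \<in> W'}" by (rule chart_preimage_openin[OF ch W'])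
    have 2: "x \<in> {y\<in>V. \<phi> y \<in> W'}" using V(2) W(2) kx[OF V(2)] x(2) by (simp add: W'_def h_def)
    have 3: "f y \<in> A" if "y \<in> V" "\<phi> y \<in> W'" for y
      using that kx[OF that(1)] by (auto simp: W'_def h_def split: if_splits)
    show "\<exists>T. openin (mtop M) T \<and> x \<in> T \<and> T \<subseteq> {x\<in>mcarrier M. f x \<in> A}"
      by (rule exI[of _ "{y\<in>V. \<phi> y \<in> W'}"]) (use 1 2 3 openin_subset[OF chart_openin[OF ch]] in auto)
  qed
qed

lemma smooth_map_if_smooth_at:
  assumes "manifold M" "manifold N"
    and "\<And>p. p \<in> mcarrier M \<Longrightarrow> f p \<in> mcarrier N" "\<And>p. p \<in> mcarrier M \<Longrightarrow> smooth_at M N p f"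
  shows "smooth_map M N f"
  by (rule smooth_mapI[OF assms(1,2) smooth_at_imp_continuous_map[OF assms] assms(4)])

lemma tmap_bij_betw:
  assumes P: "manifold P" and M: "manifold M" and W: "openin (mtop P) W" "q \<in> W" and U: "openin (mtop M) U"
    and \<Phi>: "\<And>x. x \<in> W \<Longrightarrow> \<Phi> x \<in> U" "\<And>x. x \<in> W \<Longrightarrow> \<Psi> (\<Phi> x) = x"
    and \<Psi>: "\<And>y. y \<in> U \<Longrightarrow> \<Psi> y \<in> W" "\<And>y. y \<in> U \<Longrightarrow> \<Phi> (\<Psi> y) = y"
    and s: "smooth_at P M q \<Phi>" "smooth_at M P (\<Phi> q) \<Psi>"
  shows "\<And>v. v \<in> tangent P q \<Longrightarrow> tmap P \<Psi> (\<Phi> q) (tmap M \<Phi> q v) = v"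
    and "\<And>w. w \<in> tangent M (\<Phi> q) \<Longrightarrow> tmap M \<Phi> q (tmap P \<Psi> (\<Phi> q) w) = w"
    and "bij_betw (tmap M \<Phi> q) (tangent P q) (tangent M (\<Phi> q))"
proof -
  show 1: "tmap P \<Psi> (\<Phi> q) (tmap M \<Phi> q v) = v" if "v \<in> tangent P q" for v
    by (rule tmap_local_inverse[OF P W \<Phi>(2) s(2) that])
  have s': "smooth_at P M (\<Psi> (\<Phi> q)) \<Phi>" using s(1) \<Phi>(2)[OF W(2)] by simp
  show 2: "tmap M \<Phi> q (tmap P \<Psi> (\<Phi> q) w) = w" if "w \<in> tangent M (\<Phi> q)" for w
    using tmap_local_inverse[OF M U \<Phi>(1)[OF W(2)] \<Psi>(2) s' that] \<Phi>(2)[OF W(2)] by simp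
  have \<Phi>q: "\<Phi> q \<in> mcarrier M" using \<Phi>(1)[OF W(2)] openin_subset[OF U] by blast
  have q: "\<Psi> (\<Phi> q) \<in> mcarrier P" "\<Psi> (\<Phi> q) = q" using \<Phi>(2)[OF W(2)] W openin_subset[OF W(1)] by auto
  show "bij_betw (tmap M \<Phi> q) (tangent P q) (tangent M (\<Phi> q))"
  proof (rule bij_betw_byWitness[where f' = "tmap P \<Psi> (\<Phi> q)"])
    show "tmap M \<Phi> q ` tangent P q \<subseteq> tangent M (\<Phi> q)" using tmap_tangent[OF M s(1) \<Phi>q] by blast
    show "tmap P \<Psi> (\<Phi> q) ` tangent M (\<Phi> q) \<subseteq> tangent P q"
      using tmap_tangent[OF P s(2) q(1)] unfolding q(2) by blast
  qed (use 1 2 in blast)+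
qed

lemma ker_tmap_coords:
  assumes M: "manifold M" and L: "manifold L" and f: "smooth_at M L x f"
    and g: "good_chart L B z" and fx: "f x \<in> B"
  shows "ker_tmap M L f x = {v\<in>tangent M x. \<forall>i<mdim L. v (\<lambda>y. z (f y) i) = 0}"
proof (intro equalityI subsetI)
  have near: "smooth_near L (f x) (\<lambda>y. z y i)" for i by (rule smooth_near_coord[OF g fx])
  fix v
  {
    assume "v \<in> ker_tmap M L f x"
    then have v: "v \<in> tangent M x" "tmap L f x v = (\<lambda>g. 0)" by (simp_all add: ker_tmap_def)
    have "v (\<lambda>y. z (f y) i) = 0" for i
      using fun_cong[OF v(2), of "\<lambda>y. z y i"] near[of i] by (simp add: tmap_def)
    then show "v \<in> {v\<in>tangent M x. \<forall>i<mdim L. v (\<lambda>y. z (f y) i) = 0}" using v(1) by simp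
  next
    assume "v \<in> {v\<in>tangent M x. \<forall>i<mdim L. v (\<lambda>y. z (f y) i) = 0}"
    then have v: "v \<in> tangent M x" "\<And>i. i < mdim L \<Longrightarrow> v (\<lambda>y. z (f y) i) = 0" by auto
    have fL: "f x \<in> mcarrier L" using fx openin_subset[OF chart_openin[OF good_chart_chart[OF g]]] by blast
    have "tmap L f x v = (\<lambda>g. 0)"
      by (rule tangent_eqI[OF L g fx tmap_tangent[OF L f fL v(1)] zero_tangent])
        (simp add: tmap_def near v(2))
    then show "v \<in> ker_tmap M L f x" using v(1) by (simp add: ker_tmap_def)
  }
qed

lemma tmap_slice_image:
  assumes N: "manifold N" and L: "manifold L" and n: "n \<in> mcarrier N" and l: "l \<in> mcarrier L"
    and \<Sigma>: "smooth_at (prod_mfd N L) M (n, l) \<Sigma>"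
  shows "tmap M (\<lambda>x. \<Sigma> (x, l)) n ` tangent N n = tmap M \<Sigma> (n, l) ` ker_tmap (prod_mfd N L) L snd (n, l)"
proof -
  let ?s = "tmap (prod_mfd N L) (\<lambda>x. (x, l)) n"
  have comp: "tmap M (\<lambda>x. \<Sigma> (x, l)) n v = tmap M \<Sigma> (n, l) (?s v)" for v
    by (rule tmap_compose[where f = "\<lambda>x. (x, l)" and h = \<Sigma>]) (rule \<Sigma>)
  have slice: "?s ` tangent N n = ker_tmap (prod_mfd N L) L snd (n, l)"
    using dist_times_zero_eq_ker_snd[OF N L, of "(n, l)"] n l by (simp add: dist_times_zero_def)
  show ?thesis unfolding comp slice[symmetric] by (rule image_image[symmetric])
qed

section \<open>From complete solutions to integrability\<close>

text \<open>Near a preimage of \<open>m\<close> the map \<open>\<Sigma>\<close> has an inverse \<open>S\<close>, and \<open>F\<close> is the \<open>\<Lambda>\<close>-component of \<open>S\<close>. Then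
  the kernel of the tangent map of \<open>F\<close> is the image under \<open>\<Sigma>\<close> of \<open>TN \<times> 0\<close>, i.e. the tangent spaces
  of the solutions \<open>\<sigma>\<^sub>\<lambda>\<close>. These are isotropic, contain \<open>X\<close> by the Hamilton-Jacobi equation, and the
  integral submanifolds on \<open>N \<times> \<Lambda>\<close> are transported by \<open>\<Sigma>\<close>.\<close>

theorem complete_solution_imp_nci:
  assumes P: "poisson_manifold M \<Xi>" and N: "manifold N" and \<pi>: "fibration M N \<pi>"
    and sol: "isotropic_complete_solution M \<Xi> N \<pi> (hamiltonian_vf M \<Xi> H) L \<Sigma>"
    and int: "integrable_dist (prod_mfd N L) (sharp_ann (prod_mfd N L) (pullback_bivector (prod_mfd N L) M \<Xi> \<Sigma>)
      (dist_times_zero N L (tangent N)))"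
    and m: "m \<in> mcarrier M"
  shows "\<exists>U. openin (mtop M) U \<and> m \<in> U \<and> nci (open_mfd M U) \<Xi> (hamiltonian_vf M \<Xi> H)"
proof -
  define Q where "Q = prod_mfd N L"
  define X where "X = hamiltonian_vf M \<Xi> H"
  have M: "manifold M" using P by (simp add: poisson_manifold_def)
  have cs: "complete_solution M N \<pi> X L \<Sigma>"
    and iso: "\<And>l. l \<in> mcarrier L \<Longrightarrow> isotropic_section M \<Xi> N (\<lambda>n. \<Sigma> (n, l))"
    using sol by (simp_all add: isotropic_complete_solution_def X_def)
  have L: "manifold L" and ld: "local_diffeo Q M \<Sigma>" and surj: "\<Sigma> ` mcarrier Q = mcarrier M"
    and hje: "\<And>l. l \<in> mcarrier L \<Longrightarrow> HJE_solution M N \<pi> X (\<lambda>n. \<Sigma> (n, l))"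
    using cs by (simp_all add: complete_solution_def Q_def)
  have mQ: "manifold Q" unfolding Q_def by (rule manifold_prod_mfd[OF N L])
  obtain q0 where q0: "q0 \<in> mcarrier Q" "\<Sigma> q0 = m" using surj m by (metis imageE)
  obtain W where W: "openin (mtop Q) W" "q0 \<in> W" and U: "openin (mtop M) (\<Sigma> ` W)"
    and df: "diffeo (open_mfd Q W) (open_mfd M (\<Sigma> ` W)) \<Sigma>"
    using ld q0(1) unfolding local_diffeo_def by metis
  define U where "U = \<Sigma> ` W"
  have U: "openin (mtop M) U" using U by (simp add: U_def)
  note mW = manifold_open_mfd[OF mQ W(1)] and mU = manifold_open_mfd[OF M U]
  note cW = mcarrier_open_mfd[OF W(1)] and cU = mcarrier_open_mfd[OF U]
  define S where "S = inv_into W \<Sigma>"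
  have inj: "inj_on \<Sigma> W" and sm\<Sigma>: "smooth_map (open_mfd Q W) (open_mfd M U) \<Sigma>"
    and smS: "smooth_map (open_mfd M U) (open_mfd Q W) S"
    using df by (simp_all add: diffeo_def bij_betw_def cW U_def S_def)
  have \<Sigma>U: "\<Sigma> x \<in> U" "S (\<Sigma> x) = x" if "x \<in> W" for x using that inj by (simp_all add: U_def S_def)
  have SW: "S y \<in> W" "\<Sigma> (S y) = y" if "y \<in> U" for y
    using that unfolding U_def S_def by (simp_all add: inv_into_into f_inv_into_f)
  have WQ: "x \<in> mcarrier Q" if "x \<in> W" for x using that openin_subset[OF W(1)] by blast
  have s\<Sigma>: "smooth_at Q M x \<Sigma>" if x: "x \<in> W" for x
    using smooth_map_imp_smooth_at[OF mW mU sm\<Sigma>, of x] x \<Sigma>U(1)[OF x]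
    by (simp add: cW smooth_at_from_open_mfd[OF mQ W(1)] smooth_at_into_open_mfd[OF M U])
  have sS: "smooth_at M Q y S" if y: "y \<in> U" for y
    using smooth_map_imp_smooth_at[OF mU mW smS, of y] y SW(1)[OF y]
    by (simp add: cU smooth_at_from_open_mfd[OF M U] smooth_at_into_open_mfd[OF mQ W(1)])
  have tm: "\<And>v. v \<in> tangent Q x \<Longrightarrow> tmap Q S (\<Sigma> x) (tmap M \<Sigma> x v) = v"
    "\<And>w. w \<in> tangent M (\<Sigma> x) \<Longrightarrow> tmap M \<Sigma> x (tmap Q S (\<Sigma> x) w) = w"
    "bij_betw (tmap M \<Sigma> x) (tangent Q x) (tangent M (\<Sigma> x))" if x: "x \<in> W" for x
    using tmap_bij_betw[where \<Phi> = \<Sigma> and \<Psi> = S, OF mQ M W(1) x U \<Sigma>U SW s\<Sigma>[OF x] sS[OF \<Sigma>U(1)[OF x]]] by auto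
  define Lo where "Lo = snd ` W"
  have Lo: "openin (mtop L) Lo"
    using W(1) open_map_snd[of "mtop N" "mtop L"] unfolding Lo_def Q_def open_map_def by simp
  define L' where "L' = open_mfd L Lo"
  have mL': "manifold L'" unfolding L'_def by (rule manifold_open_mfd[OF L Lo])
  have cL': "mcarrier L' = Lo" unfolding L'_def by (rule mcarrier_open_mfd[OF Lo])
  define F where "F = (\<lambda>y. snd (S y))"
  have FLo: "F y \<in> Lo" if "y \<in> U" for y using SW(1)[OF that] by (auto simp: F_def Lo_def)
  have snd_at: "smooth_at Q L x snd" if "x \<in> W" for x
    using smooth_at_snd[OF N L] WQ[OF that] unfolding Q_def by blast
  have sF: "smooth_at M L y F" if y: "y \<in> U" for y
    unfolding F_def by (rule smooth_at_compose[OF sS[OF y]]) (rule snd_at[OF SW(1)[OF y]])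
  have tF: "tmap L F (\<Sigma> x) (tmap M \<Sigma> x v) = tmap L snd x v" if x: "x \<in> W" and v: "v \<in> tangent Q x" for x v
  proof -
    have "smooth_at Q L (S (\<Sigma> x)) snd" using snd_at[OF x] \<Sigma>U(2)[OF x] by simp
    from tmap_compose[where f = S and h = snd, OF this, of "tmap M \<Sigma> x v"]
    show ?thesis unfolding F_def tm(1)[OF x v] \<Sigma>U(2)[OF x] .
  qed
  have tF': "tmap L' F y = tmap L F y" if "y \<in> U" for y
    unfolding L'_def by (rule tmap_open_mfd[where f = F and p = y, OF L Lo FLo[OF that]])
  have tU: "tangent (open_mfd M U) y = tangent M y" if "y \<in> U" for y by (rule tangent_open_mfd[OF M U that])
  have ker: "ker_tmap (open_mfd M U) L' F (\<Sigma> x) = tmap M \<Sigma> x ` ker_tmap Q L snd x" if x: "x \<in> W" for x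
  proof (intro equalityI subsetI)
    fix w assume "w \<in> ker_tmap (open_mfd M U) L' F (\<Sigma> x)"
    then have w: "w \<in> tangent M (\<Sigma> x)" "tmap L F (\<Sigma> x) w = (\<lambda>g. 0)"
      using tU[OF \<Sigma>U(1)[OF x]] tF'[OF \<Sigma>U(1)[OF x]] by (simp_all add: ker_tmap_def)
    define v where "v = tmap Q S (\<Sigma> x) w"
    have v: "v \<in> tangent Q x" "w = tmap M \<Sigma> x v"
      using tm(2)[OF x w(1)] tmap_tangent[OF mQ sS[OF \<Sigma>U(1)[OF x]] _ w(1)] \<Sigma>U(2)[OF x] WQ[OF x] by (simp_all add: v_def)
    then show "w \<in> tmap M \<Sigma> x ` ker_tmap Q L snd x" using w(2) tF[OF x v(1)] by (auto simp: ker_tmap_def)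
  next
    fix w assume "w \<in> tmap M \<Sigma> x ` ker_tmap Q L snd x"
    then obtain v where v: "v \<in> tangent Q x" "tmap L snd x v = (\<lambda>g. 0)" "w = tmap M \<Sigma> x v"
      by (auto simp: ker_tmap_def)
    have "w \<in> tangent M (\<Sigma> x)" using tm(3)[OF x] v(1,3) by (auto simp: bij_betw_def)
    then show "w \<in> ker_tmap (open_mfd M U) L' F (\<Sigma> x)"
      using tF[OF x v(1)] v(2,3) tU[OF \<Sigma>U(1)[OF x]] tF'[OF \<Sigma>U(1)[OF x]] by (simp add: ker_tmap_def)
  qed
  have slice: "tmap M (\<lambda>a. \<Sigma> (a, l)) n ` tangent N n = ker_tmap (open_mfd M U) L' F (\<Sigma> (n, l))"
    and nl: "n \<in> mcarrier N" "l \<in> mcarrier L" if x: "(n, l) \<in> W" for n l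
  proof -
    show nl: "n \<in> mcarrier N" "l \<in> mcarrier L" using WQ[OF x] by (simp_all add: Q_def)
    show "tmap M (\<lambda>a. \<Sigma> (a, l)) n ` tangent N n = ker_tmap (open_mfd M U) L' F (\<Sigma> (n, l))"
      unfolding ker[OF x] Q_def by (rule tmap_slice_image[OF N L nl s\<Sigma>[OF x, unfolded Q_def]])
  qed
  have fib: "fibration (open_mfd M U) L' F"
    unfolding fibration_def cU cL'
  proof (intro conjI ballI)
    show "smooth_map (open_mfd M U) L' F"
    proof (rule smooth_map_if_smooth_at[OF mU mL'])
      fix y assume "y \<in> mcarrier (open_mfd M U)"
      then have y: "y \<in> U" by (simp add: cU)
      show "F y \<in> mcarrier L'" using FLo[OF y] by (simp add: cL')
      show "smooth_at (open_mfd M U) L' y F"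
        unfolding L'_def using sF[OF y] FLo[OF y]
        by (simp add: smooth_at_from_open_mfd[OF M U y] smooth_at_into_open_mfd[OF L Lo])
    qed
    show "F ` U = Lo" unfolding U_def Lo_def by (force simp: image_image F_def \<Sigma>U(2))
    fix y assume y: "y \<in> U"
    define x where "x = S y"
    have x: "x \<in> W" "y = \<Sigma> x" using SW[OF y] by (simp_all add: x_def)
    have "tmap L' F y ` tangent (open_mfd M U) y = tmap L F y ` (tmap M \<Sigma> x ` tangent Q x)"
      using tm(3)[OF x(1)] tU[OF y] tF'[OF y] by (simp add: bij_betw_def x(2))
    also have "\<dots> = tmap L snd x ` tangent Q x"
      unfolding image_image x(2) using tF[OF x(1)] by simp
    also have "\<dots> = tangent L (snd x)" unfolding Q_def by (rule tmap_snd_surj[OF N L]) (use WQ[OF x(1)] Q_def in simp)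
    also have "\<dots> = tangent L' (F y)"
      using tangent_open_mfd[OF L Lo FLo[OF y]] by (simp add: L'_def F_def x_def)
    finally show "tmap L' F y ` tangent (open_mfd M U) y = tangent L' (F y)" .
  qed
  have "nci_by (open_mfd M U) \<Xi> X L' F"
    unfolding nci_by_def isotropic_fibration_def cU
  proof (intro conjI ballI mL' fib)
    fix y assume y: "y \<in> U"
    obtain n l where x: "S y = (n, l)" by (cases "S y")
    then have nlW: "(n, l) \<in> W" "\<Sigma> (n, l) = y" using SW[OF y] by simp_all
    note nl' = nl[OF nlW(1)]
    show "isotropic (open_mfd M U) \<Xi> y (ker_tmap (open_mfd M U) L' F y)"
      using iso[OF nl'(2)] nl'(1) slice[OF nlW(1)] nlW(2) isotropic_open_mfd[OF M U y]
      by (auto simp: isotropic_section_def)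
    have e: "tmap M (\<lambda>a. \<Sigma> (a, l)) n (tmap N \<pi> y (X y)) = X y"
      using hje[OF nl'(2)] nl'(1) nlW(2) by (auto simp: HJE_solution_def)
    have yM: "y \<in> mcarrier M" using y openin_subset[OF U] by blast
    have "smooth_at M N y \<pi>" "\<pi> y = n"
      using smooth_map_imp_smooth_at[OF M N _ yM] \<pi> hje[OF nl'(2)] nl'(1) nlW(2)
      by (auto simp: fibration_def HJE_solution_def smooth_section_def)
    then have "tmap N \<pi> y (X y) \<in> tangent N n"
      using tmap_tangent[OF N _ _ hamiltonian_vf_tangent[OF P yM]] nl'(1) by (auto simp: X_def)
    then show "X y \<in> ker_tmap (open_mfd M U) L' F y"
      using slice[OF nlW(1)] e nlW(2) by (metis imageI)
  next
    show "integrable_dist (open_mfd M U) (sharp_ann (open_mfd M U) \<Xi> (ker_tmap (open_mfd M U) L' F))"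
      unfolding integrable_dist_def cU
    proof
      fix y assume y: "y \<in> U"
      define D where "D = sharp_ann Q (pullback_bivector Q M \<Xi> \<Sigma>) (dist_times_zero N L (tangent N))"
      obtain S0 where S0: "S y \<in> mcarrier S0" "integral_submanifold Q D S0"
        using int WQ[OF SW(1)[OF y]] unfolding integrable_dist_def D_def Q_def by blast
      have "\<exists>S'. \<Sigma> (S y) \<in> mcarrier S' \<and>
          integral_submanifold (open_mfd M U) (sharp_ann (open_mfd M U) \<Xi> (ker_tmap (open_mfd M U) L' F)) S'"
      proof (rule integral_submanifold_transport[OF mQ mU W(1) inj _ _ _ _ S0(2,1) SW(1)[OF y]])
        show "continuous_map (subtopology (mtop Q) W) (mtop (open_mfd M U)) \<Sigma>"
          using sm\<Sigma> by (simp add: smooth_map_def open_mfd_def)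
        fix x assume x: "x \<in> W"
        note xU = \<Sigma>U(1)[OF x]
        have tmU: "tmap (open_mfd M U) \<Sigma> x = tmap M \<Sigma> x" by (rule tmap_open_mfd[where f = \<Sigma> and p = x, OF M U xU])
        show "smooth_at Q (open_mfd M U) x \<Sigma>" using s\<Sigma>[OF x] by (simp add: smooth_at_into_open_mfd[where f = \<Sigma> and p = x, OF M U xU])
        show "inj_on (tmap (open_mfd M U) \<Sigma> x) (tangent Q x)" unfolding tmU using tm(3)[OF x] by (simp add: bij_betw_def)
        have dk: "dist_times_zero N L (tangent N) x = ker_tmap Q L snd x"
          unfolding Q_def by (rule dist_times_zero_eq_ker_snd[OF N L]) (use WQ[OF x] Q_def in simp)
        have xM: "\<Sigma> x \<in> mcarrier M" using xU openin_subset[OF U] by blast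
        have "tmap M \<Sigma> x ` D x = sharp M \<Xi> (\<Sigma> x) ` annihilator M (\<Sigma> x) (tmap M \<Sigma> x ` ker_tmap Q L snd x)"
          unfolding D_def sharp_ann_def dk
          by (rule sharp_ann_pullback(1)[OF P xM tm(3)[OF x]]) (auto simp: ker_tmap_def)
        then show "sharp_ann (open_mfd M U) \<Xi> (ker_tmap (open_mfd M U) L' F) (\<Sigma> x) = tmap (open_mfd M U) \<Sigma> x ` D x"
          unfolding tmU sharp_ann_def ker[OF x] sharp_open_mfd[OF M U xU] annihilator_open_mfd[OF M U xU] by simp
      qed
      then show "\<exists>S'. y \<in> mcarrier S' \<and>
          integral_submanifold (open_mfd M U) (sharp_ann (open_mfd M U) \<Xi> (ker_tmap (open_mfd M U) L' F)) S'"
        unfolding SW(2)[OF y] .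
    qed
  qed
  then have "nci (open_mfd M U) \<Xi> X" by (rule nci_by_imp_nci[OF mU])
  moreover have "m \<in> U" using W(2) q0(2) by (auto simp: U_def)
  ultimately show ?thesis using U unfolding X_def by blast
qed

section \<open>From integrability to complete solutions\<close>

lemma mem_cube_concat:
  "z \<in> cube (k + l) c e \<longleftrightarrow> z \<in> topspace (Euclidean_space (k + l)) \<and>
    fst_coords k z \<in> cube k (fst_coords k c) e \<and> snd_coords k z \<in> cube l (snd_coords k c) e"
proof -
  have "(\<forall>i<k + l. \<bar>z i - c i\<bar> < e) \<longleftrightarrow> (\<forall>i<k. \<bar>z i - c i\<bar> < e) \<and> (\<forall>i<l. \<bar>z (k + i) - c (k + i)\<bar> < e)"
    (is "?L \<longleftrightarrow> ?R")
  proof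
    assume R: ?R
    show ?L
    proof (intro allI impI)
      fix i assume "i < k + l"
      then show "\<bar>z i - c i\<bar> < e" using R by (cases "i < k") (auto dest: spec[of _ "i - k"])
    qed
  qed auto
  then show ?thesis
    using snd_coords_in_Euclidean[of z k l] fst_coords_in_Euclidean[of k z]
    by (auto simp: cube_def fst_coords_def snd_coords_def)
qed

lemma sharp_cong: "\<Xi> p = \<Xi>' p \<Longrightarrow> sharp M \<Xi> p = sharp M \<Xi>' p"
  by (simp add: sharp_def fun_eq_iff)

definition isotropic_integrable_solution ::
  "'a mfd \<Rightarrow> 'a bivector \<Rightarrow> 'b mfd \<Rightarrow> ('a \<Rightarrow> 'b) \<Rightarrow> ('a \<Rightarrow> 'a tvec) \<Rightarrow> 'l mfd \<Rightarrow> ('b \<times> 'l \<Rightarrow> 'a) \<Rightarrow> bool"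
  where "isotropic_integrable_solution M \<Xi> N \<pi> X L \<Sigma> \<longleftrightarrow>
    isotropic_complete_solution M \<Xi> N \<pi> X L \<Sigma> \<and>
    (let Q = prod_mfd N L in
      integrable_dist Q (sharp_ann Q (pullback_bivector Q M \<Xi> \<Sigma>) (dist_times_zero N L (image_dist M N \<pi>))))"

text \<open>The common core of both converse directions. The first coordinates of \<open>\<phi>\<close> are those of \<open>\<pi>\<close> in the
  chart \<open>y\<close>, the last \<open>l\<close> coordinates stand for those of \<open>F\<close>, and \<open>K\<close> for the kernel of the tangent
  map of \<open>F\<close>. Over a cube, a point of the base and values of the last coordinates determine a point of
  \<open>M\<close>; this is \<open>\<Sigma>\<close>, with \<open>\<Lambda>\<close> a cube of dimension \<open>l\<close>. In the coordinates \<open>cc\<close> and \<open>\<phi>\<close> it is the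
  identity, hence a diffeomorphism, and \<open>K\<close> is the image of \<open>TN \<times> 0\<close>. So the sections inherit isotropy
  from \<open>K\<close>, and they solve the Hamilton-Jacobi equation because \<open>X\<close> lies in \<open>K\<close>, on which \<open>\<sigma>\<^sub>* \<circ> \<pi>\<^sub>*\<close>
  is the identity.\<close>

theorem adapted_chart_imp_complete_solution:
  assumes P: "poisson_manifold M \<Xi>" and N: "manifold N" and A: "(A, y) \<in> matlas N"
    and g: "good_chart M V \<phi>" and p0: "p0 \<in> V" and dim: "mdim M = mdim N + l"
    and \<pi>A: "\<And>x. x \<in> V \<Longrightarrow> \<pi> x \<in> A"
    and \<pi>\<phi>: "\<And>x i. x \<in> V \<Longrightarrow> i < mdim N \<Longrightarrow> \<phi> x i = y (\<pi> x) i"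
    and K: "\<And>x. x \<in> V \<Longrightarrow> K x = {v\<in>tangent M x. \<forall>i<l. v (\<lambda>z. \<phi> z (mdim N + i)) = 0}"
    and iso: "\<And>x. x \<in> V \<Longrightarrow> isotropic M \<Xi> x (K x)" and X: "\<And>x. x \<in> V \<Longrightarrow> X x \<in> K x"
    and int: "\<And>x. x \<in> V \<Longrightarrow> \<exists>S. x \<in> mcarrier S \<and> integral_submanifold M (sharp_ann M \<Xi> K) S"
  shows "\<exists>U. openin (mtop M) U \<and> p0 \<in> U \<and> openin (mtop N) (\<pi> ` U) \<and>
    fibration (open_mfd M U) (open_mfd N (\<pi> ` U)) \<pi> \<and>
    (\<exists>(L' :: (nat \<Rightarrow> real) mfd) \<Sigma>.
      isotropic_integrable_solution (open_mfd M U) \<Xi> (open_mfd N (\<pi> ` U)) \<pi> X L' \<Sigma>)"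
proof -
  define k where "k = mdim N"
  have M: "manifold M" using P by (simp add: poisson_manifold_def)
  note ch = good_chart_chart[OF g] and chA = manifold_chart[OF N A]
  have n: "mdim M = k + l" by (simp add: dim k_def)
  obtain e where e: "e > 0" "cube (k + l) (\<phi> p0) e \<subseteq> \<phi> ` V"
    using openin_contains_cube[OF chart_openin_image[OF ch] imageI[OF p0]] unfolding n by metis
  define C where "C = cube (k + l) (\<phi> p0) e"
  define Ck where "Ck = cube k (fst_coords k (\<phi> p0)) e"
  define Cl where "Cl = cube l (snd_coords k (\<phi> p0)) e"
  have C: "z \<in> C \<longleftrightarrow> z \<in> topspace (Euclidean_space (k + l)) \<and> fst_coords k z \<in> Ck \<and> snd_coords k z \<in> Cl" for z
    unfolding C_def Ck_def Cl_def by (rule mem_cube_concat)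
  have Co: "openin (Euclidean_space (mdim M)) C" and Cko: "openin (Euclidean_space k) Ck" and Clo: "openin (Euclidean_space l) Cl"
    unfolding n C_def Ck_def Cl_def by (rule openin_cube)+
  have CV: "C \<subseteq> \<phi> ` V" using e(2) by (simp add: C_def)
  define U where "U = {x\<in>V. \<phi> x \<in> C}"
  have U: "openin (mtop M) U" unfolding U_def by (rule chart_preimage_openin[OF ch Co])
  have UV: "x \<in> V" if "x \<in> U" for x using that by (simp add: U_def)
  have UM: "x \<in> mcarrier M" if "x \<in> U" for x using that openin_subset[OF U] by blast
  have p0C: "\<phi> p0 \<in> C" unfolding C_def by (rule cube_self) (use chart_in_Euclidean[OF ch p0] n e(1) in simp_all)
  have p0U: "p0 \<in> U" using p0 p0C by (simp add: U_def)
  have y\<pi>: "y (\<pi> x) = fst_coords k (\<phi> x)" if x: "x \<in> V" for x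
  proof
    fix i show "y (\<pi> x) i = fst_coords k (\<phi> x) i"
      using \<pi>\<phi>[OF x] chart_in_Euclidean[OF chA \<pi>A[OF x]]
      by (auto simp: fst_coords_def k_def topspace_Euclidean_space)
  qed
  define A' where "A' = {a\<in>A. y a \<in> Ck}"
  have A': "openin (mtop N) A'" unfolding A'_def by (rule chart_preimage_openin[OF chA]) (use Cko k_def in simp)
  define N' where "N' = open_mfd N A'"
  define L' where "L' = open_mfd (eucl_mfd l) Cl"
  define Q where "Q = prod_mfd N' L'"
  have El: "openin (mtop (eucl_mfd l)) Cl" using Clo by (simp add: eucl_mfd_def)
  have mN': "manifold N'" unfolding N'_def by (rule manifold_open_mfd[OF N A'])
  have mL': "manifold L'" unfolding L'_def by (rule manifold_open_mfd[OF manifold_eucl_mfd El])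
  have mQ: "manifold Q" unfolding Q_def by (rule manifold_prod_mfd[OF mN' mL'])
  have cN': "mcarrier N' = A'" unfolding N'_def by (rule mcarrier_open_mfd[OF A'])
  have cL': "mcarrier L' = Cl" unfolding L'_def by (rule mcarrier_open_mfd[OF El])
  have dN': "mdim N' = k" by (simp add: N'_def k_def)
  have dL': "mdim L' = l" by (simp add: L'_def eucl_mfd_def)
  define D0 where "D0 = A' \<times> Cl"
  have cQ: "mcarrier Q = D0" by (simp add: Q_def cN' cL' D0_def)
  have ClE: "b \<in> topspace (Euclidean_space l)" if "b \<in> Cl" for b using that openin_subset[OF Clo] by blast
  have atN': "(A', y) \<in> matlas N'"
  proof -
    have "(\<lambda>(V, \<phi>). (V \<inter> A', \<phi>)) (A, y) \<in> matlas N'"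
      unfolding N'_def open_mfd_def mfd.simps by (rule imageI[OF A])
    moreover have "A \<inter> A' = A'" by (auto simp: A'_def)
    ultimately show ?thesis by simp
  qed
  have atL': "(Cl, \<lambda>x. x) \<in> matlas L'"
  proof -
    have "topspace (Euclidean_space l) \<inter> Cl = Cl" using ClE by blast
    then show ?thesis by (simp add: L'_def open_mfd_def eucl_mfd_def)
  qed
  define cc where "cc = (\<lambda>(a, b). concat_coords k (y a) b)"
  have gc: "good_chart Q D0 cc"
    using atlas_good_chart[OF manifold_prod_mfd[OF mN' mL'] prod_mfd_atlas[OF atN' atL']]
    by (simp add: cc_def D0_def Q_def dN')
  have D0: "openin (mtop Q) D0" using openin_topspace[of "mtop Q"] by (simp add: cQ)
  have yE: "y a \<in> topspace (Euclidean_space k)" if "a \<in> A'" for a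
    using chart_in_Euclidean[OF chA, of a] that by (simp add: A'_def k_def)
  have ccC: "cc q \<in> C" if qD: "q \<in> D0" for q
  proof -
    obtain a b where q: "q = (a, b)" "a \<in> A'" "b \<in> Cl" using qD by (auto simp: D0_def)
    show ?thesis
      unfolding C q(1) cc_def prod.case fst_coords_concat[OF yE[OF q(2)]] snd_coords_concat
      using concat_coords_in_Euclidean[OF ClE[OF q(3)]] q by (simp add: A'_def)
  qed
  define \<Sigma> where "\<Sigma> = (\<lambda>q. inv_into V \<phi> (cc q))"
  define G where "G = (\<lambda>x. (\<pi> x, snd_coords k (\<phi> x)))"
  have \<phi>\<Sigma>: "\<phi> (\<Sigma> q) = cc q" and \<Sigma>U: "\<Sigma> q \<in> U" if q: "q \<in> D0" for q
  proof -
    have 1: "cc q \<in> \<phi> ` V" using ccC[OF q] CV by blast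
    show 2: "\<phi> (\<Sigma> q) = cc q" unfolding \<Sigma>_def by (rule f_inv_into_f[OF 1])
    show "\<Sigma> q \<in> U" using inv_into_into[OF 1] 2 ccC[OF q] by (simp add: U_def \<Sigma>_def)
  qed
  have ccG: "cc (G x) = \<phi> x" and GD: "G x \<in> D0" if x: "x \<in> U" for x
  proof -
    show "cc (G x) = \<phi> x" by (simp add: cc_def G_def y\<pi>[OF UV[OF x]] concat_fst_snd_coords)
    have "\<phi> x \<in> C" using x by (simp add: U_def)
    then show "G x \<in> D0" using \<pi>A[OF UV[OF x]] y\<pi>[OF UV[OF x]] unfolding C by (simp add: G_def D0_def A'_def)
  qed
  have \<Sigma>G: "\<Sigma> (G x) = x" if "x \<in> U" for x
    unfolding \<Sigma>_def ccG[OF that] by (rule chart_inv[OF ch UV[OF that]])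
  have G\<Sigma>: "G (\<Sigma> q) = q" if q: "q \<in> D0" for q
  proof -
    have "cc (G (\<Sigma> q)) = cc q" using ccG[OF \<Sigma>U[OF q]] \<phi>\<Sigma>[OF q] by simp
    then show ?thesis
      using chart_inj[OF good_chart_chart[OF gc]] GD[OF \<Sigma>U[OF q]] q by (auto dest: inj_onD)
  qed
  have im\<Sigma>: "\<Sigma> ` D0 = U"
  proof (intro equalityI subsetI)
    fix x assume "x \<in> U"
    then show "x \<in> \<Sigma> ` D0" using \<Sigma>G GD by (metis imageI)
  qed (use \<Sigma>U in blast)
  have \<pi>\<Sigma>: "\<pi> (\<Sigma> (a, b)) = a" if "(a, b) \<in> D0" for a b
    using G\<Sigma>[OF that] by (simp add: G_def)
  have Cl_ne: "snd_coords k (\<phi> p0) \<in> Cl" using p0C C by blast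
  have \<pi>U: "\<pi> ` U = A'"
  proof (intro equalityI subsetI)
    fix a assume "a \<in> \<pi> ` U"
    then show "a \<in> A'" using GD by (auto simp: G_def D0_def)
  next
    fix a assume "a \<in> A'"
    then have q: "(a, snd_coords k (\<phi> p0)) \<in> D0" using Cl_ne by (simp add: D0_def)
    then show "a \<in> \<pi> ` U" using \<pi>\<Sigma>[OF q] \<Sigma>U[OF q] by (metis imageI)
  qed
  have s\<Sigma>: "smooth_at Q M q \<Sigma>" if q: "q \<in> D0" for q
  proof (rule smooth_at_coordI[OF mQ g D0 q])
    show "\<Sigma> x \<in> V" if "x \<in> D0" for x by (rule UV[OF \<Sigma>U[OF that]])
    show "smooth_near Q q (\<lambda>x. \<phi> (\<Sigma> x) i)" for i
      by (rule smooth_near_cong[OF mQ D0 q _ smooth_near_coord[OF gc q, of i]]) (simp add: \<phi>\<Sigma>)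
  qed
  have sG: "smooth_at M Q x G" if x: "x \<in> U" for x
  proof (rule smooth_at_coordI[OF M gc U x GD])
    show "smooth_near M x (\<lambda>x. cc (G x) i)" for i
      by (rule smooth_near_cong[OF M U x _ smooth_near_coord[OF g UV[OF x], of i]]) (simp add: ccG)
  qed
  have tm: "\<And>v. v \<in> tangent Q q \<Longrightarrow> tmap Q G (\<Sigma> q) (tmap M \<Sigma> q v) = v"
    "\<And>w. w \<in> tangent M (\<Sigma> q) \<Longrightarrow> tmap M \<Sigma> q (tmap Q G (\<Sigma> q) w) = w"
    "bij_betw (tmap M \<Sigma> q) (tangent Q q) (tangent M (\<Sigma> q))" if q: "q \<in> D0" for q
    using tmap_bij_betw[where \<Phi> = \<Sigma> and \<Psi> = G, OF mQ M D0 q U \<Sigma>U G\<Sigma> GD \<Sigma>G s\<Sigma>[OF q] sG[OF \<Sigma>U[OF q]]] by auto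
  have dk: "dist_times_zero N' L' (tangent N') q = ker_tmap Q L' snd q" if "q \<in> D0" for q
    unfolding Q_def by (rule dist_times_zero_eq_ker_snd[OF mN' mL']) (use that cQ Q_def in simp)
  have KK: "K (\<Sigma> q) = tmap M \<Sigma> q ` ker_tmap Q L' snd q" if q: "q \<in> D0" for q
  proof -
    have "smooth_at Q L' q snd" unfolding Q_def by (rule smooth_at_snd[OF mN' mL']) (use q cQ Q_def in simp)
    moreover have "snd q \<in> Cl" using q by (auto simp: D0_def)
    ultimately have ker: "ker_tmap Q L' snd q = {v\<in>tangent Q q. \<forall>i<l. v (\<lambda>x. snd x i) = 0}"
      using ker_tmap_coords[OF mQ mL' _ atlas_good_chart[OF mL' atL']] dL' by simp
    have c: "tmap M \<Sigma> q v (\<lambda>z. \<phi> z (k + i)) = v (\<lambda>x. snd x i)" if v: "v \<in> tangent Q q" for v i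
    proof -
      have "tmap M \<Sigma> q v (\<lambda>z. \<phi> z (k + i)) = v (\<lambda>x. \<phi> (\<Sigma> x) (k + i))"
        using smooth_near_coord[OF g UV[OF \<Sigma>U[OF q]]] by (simp add: tmap_def)
      also have "\<dots> = v (\<lambda>x. snd x i)"
        by (rule tangent_cong[OF mQ D0 q _ v]) (simp add: \<phi>\<Sigma> cc_def split_beta concat_coords_nth)
      finally show ?thesis .
    qed
    have KS: "K (\<Sigma> q) = {v\<in>tangent M (\<Sigma> q). \<forall>i<l. v (\<lambda>z. \<phi> z (k + i)) = 0}"
      using K[OF UV[OF \<Sigma>U[OF q]]] by (simp add: k_def)
    show ?thesis
      unfolding KS ker
    proof (intro equalityI subsetI)
      fix w assume w: "w \<in> {v\<in>tangent M (\<Sigma> q). \<forall>i<l. v (\<lambda>z. \<phi> z (k + i)) = 0}"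
      then obtain v where v: "v \<in> tangent Q q" "w = tmap M \<Sigma> q v" using tm(3)[OF q] by (auto simp: bij_betw_def)
      then show "w \<in> tmap M \<Sigma> q ` {v\<in>tangent Q q. \<forall>i<l. v (\<lambda>x. snd x i) = 0}"
        using w c[OF v(1)] by auto
    next
      fix w assume "w \<in> tmap M \<Sigma> q ` {v\<in>tangent Q q. \<forall>i<l. v (\<lambda>x. snd x i) = 0}"
      then obtain v where v: "v \<in> tangent Q q" "\<And>i. i < l \<Longrightarrow> v (\<lambda>x. snd x i) = 0" "w = tmap M \<Sigma> q v" by auto
      then show "w \<in> {v\<in>tangent M (\<Sigma> q). \<forall>i<l. v (\<lambda>z. \<phi> z (k + i)) = 0}"
        using c[OF v(1)] tm(3)[OF q] by (auto simp: bij_betw_def)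
    qed
  qed
  define MU where "MU = open_mfd M U"
  have mMU: "manifold MU" unfolding MU_def by (rule manifold_open_mfd[OF M U])
  have cMU: "mcarrier MU = U" unfolding MU_def by (rule mcarrier_open_mfd[OF U])
  have tMU: "tangent MU x = tangent M x" if "x \<in> U" for x unfolding MU_def by (rule tangent_open_mfd[OF M U that])
  have s\<sigma>: "smooth_at N' M a (\<lambda>a. \<Sigma> (a, b))" if q: "(a, b) \<in> D0" for a b
  proof (rule smooth_at_compose[where f = "\<lambda>a. (a, b)" and h = \<Sigma>])
    show "smooth_at N' Q a (\<lambda>a. (a, b))"
      unfolding Q_def by (rule smooth_at_slice[OF mN' mL']) (use q in \<open>simp_all add: D0_def cN' cL'\<close>)
  qed (rule s\<Sigma>[OF q])
  have slice: "tmap M (\<lambda>a. \<Sigma> (a, b)) a ` tangent N' a = K (\<Sigma> (a, b))" if q: "(a, b) \<in> D0" for a b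
    unfolding KK[OF q] unfolding Q_def
    by (rule tmap_slice_image[OF mN' mL' _ _ s\<Sigma>[OF q, unfolded Q_def]]) (use q in \<open>simp_all add: D0_def cN' cL'\<close>)
  have s\<pi>: "smooth_at M N' x \<pi>" if x: "x \<in> U" for x
  proof -
    have "smooth_at Q N' (G x) fst" unfolding Q_def by (rule smooth_at_fst[OF mN' mL']) (use GD[OF x] cQ Q_def in simp)
    from smooth_at_compose[OF sG[OF x] this] show ?thesis by (simp add: G_def)
  qed
  have \<pi>\<sigma>: "tmap N' \<pi> (\<Sigma> (a, b)) (tmap M (\<lambda>a. \<Sigma> (a, b)) a v) = v"
    if q: "(a, b) \<in> D0" and v: "v \<in> tangent N' a" for a b v
  proof (rule tmap_local_inverse[where g = \<pi> and f = "\<lambda>a. \<Sigma> (a, b)", OF mN' openin_topspace _ _ _ v])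
    show "a \<in> mcarrier N'" using q by (simp add: cN' D0_def)
    show "\<pi> (\<Sigma> (x, b)) = x" if "x \<in> mcarrier N'" for x using \<pi>\<Sigma>[of x b] that q by (simp add: cN' D0_def)
  qed (rule s\<pi>[OF \<Sigma>U[OF q]])
  have \<pi>N': "\<pi> x \<in> mcarrier N'" if "x \<in> U" for x using \<pi>U that cN' by blast
  have tsurj: "tmap N' \<pi> x ` tangent MU x = tangent N' (\<pi> x)" if x: "x \<in> U" for x
  proof (intro equalityI subsetI)
    fix w assume "w \<in> tmap N' \<pi> x ` tangent MU x"
    then show "w \<in> tangent N' (\<pi> x)" using tmap_tangent[OF mN' s\<pi>[OF x] \<pi>N'[OF x]] tMU[OF x] by auto
  next
    fix w assume w: "w \<in> tangent N' (\<pi> x)"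
    define b where "b = snd_coords k (\<phi> x)"
    have q: "(\<pi> x, b) \<in> D0" "\<Sigma> (\<pi> x, b) = x" using GD[OF x] \<Sigma>G[OF x] by (simp_all add: G_def b_def)
    have "tmap M (\<lambda>a. \<Sigma> (a, b)) (\<pi> x) w \<in> tangent M x"
      using tmap_tangent[OF M s\<sigma>[OF q(1)] _ w] q(2) UM[OF x] by simp
    then show "w \<in> tmap N' \<pi> x ` tangent MU x"
      using \<pi>\<sigma>[OF q(1) w] q(2) tMU[OF x] by (metis imageI)
  qed
  have fib: "fibration MU N' \<pi>"
    unfolding fibration_def cMU cN'
  proof (intro conjI ballI \<pi>U tsurj)
    show "smooth_map MU N' \<pi>"
    proof (rule smooth_map_if_smooth_at[OF mMU mN'])
      show "\<pi> x \<in> mcarrier N'" if "x \<in> mcarrier MU" for x using \<pi>N' that cMU by simp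
      show "smooth_at MU N' x \<pi>" if "x \<in> mcarrier MU" for x
        using s\<pi>[OF that[unfolded cMU]] that[unfolded cMU] unfolding MU_def by (simp add: smooth_at_from_open_mfd[OF M U])
    qed
  qed
  have s\<Sigma>': "smooth_at Q MU q \<Sigma>" if "q \<in> D0" for q
    unfolding MU_def using s\<Sigma>[OF that] smooth_at_into_open_mfd[where f = \<Sigma> and p = q, OF M U \<Sigma>U[OF that]] by simp
  have t\<sigma>: "tmap MU (\<lambda>a. \<Sigma> (a, b)) a = tmap M (\<lambda>a. \<Sigma> (a, b)) a" if "(a, b) \<in> D0" for a b
    unfolding MU_def by (rule tmap_open_mfd[where f = "\<lambda>a. \<Sigma> (a, b)" and p = a, OF M U \<Sigma>U[OF that]])
  have df: "diffeo (open_mfd Q D0) (open_mfd MU (\<Sigma> ` D0)) \<Sigma>"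
  proof -
    have MM: "open_mfd MU (\<Sigma> ` D0) = MU" unfolding im\<Sigma> MU_def by (rule open_mfd_open_mfd) simp
    note cD = mcarrier_open_mfd[OF D0] and mD = manifold_open_mfd[OF mQ D0]
    have inv: "inv_into D0 \<Sigma> x = G x" if "x \<in> U" for x
    proof (rule inv_into_f_eq)
      show "inj_on \<Sigma> D0" by (rule inj_on_inverseI) (rule G\<Sigma>)
    qed (use GD \<Sigma>G that in simp_all)
    show ?thesis
      unfolding diffeo_def MM cD cMU
    proof (intro conjI)
      show "bij_betw \<Sigma> D0 U" by (rule bij_betw_byWitness[where f' = G]) (use G\<Sigma> \<Sigma>G \<Sigma>U GD in auto)
      show "smooth_map (open_mfd Q D0) MU \<Sigma>"
      proof (rule smooth_map_if_smooth_at[OF mD mMU])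
        show "\<Sigma> q \<in> mcarrier MU" if "q \<in> mcarrier (open_mfd Q D0)" for q using \<Sigma>U that by (simp add: cMU cD)
        show "smooth_at (open_mfd Q D0) MU q \<Sigma>" if "q \<in> mcarrier (open_mfd Q D0)" for q
          using s\<Sigma>'[OF that[unfolded cD]] that[unfolded cD] by (simp add: smooth_at_from_open_mfd[OF mQ D0])
      qed
      show "smooth_map MU (open_mfd Q D0) (inv_into D0 \<Sigma>)"
      proof (rule smooth_map_if_smooth_at[OF mMU mD])
        fix x assume "x \<in> mcarrier MU"
        then have x: "x \<in> U" by (simp add: cMU)
        then show "inv_into D0 \<Sigma> x \<in> mcarrier (open_mfd Q D0)" by (simp add: cD inv GD)
        have "smooth_at M Q x (inv_into D0 \<Sigma>)"
          by (rule smooth_at_cong[OF M U x _ sG[OF x]]) (simp add: inv)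
        then show "smooth_at MU (open_mfd Q D0) x (inv_into D0 \<Sigma>)"
          unfolding MU_def using inv[OF x] GD[OF x] x
          by (simp add: smooth_at_from_open_mfd[OF M U] smooth_at_into_open_mfd[OF mQ D0])
      qed
    qed
  qed
  have sol: "isotropic_complete_solution MU \<Xi> N' \<pi> X L' \<Sigma>"
    unfolding isotropic_complete_solution_def complete_solution_def
  proof (intro conjI ballI mL')
    show "mdim N' + mdim L' = mdim MU" by (simp add: dN' dL' MU_def n)
    show "\<Sigma> ` mcarrier (prod_mfd N' L') = mcarrier MU" using im\<Sigma> cQ cMU by (simp add: Q_def)
    show "local_diffeo (prod_mfd N' L') MU \<Sigma>"
      unfolding Q_def[symmetric] local_diffeo_def cQ
    proof (intro ballI exI[of _ D0] conjI D0 df)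
      show "openin (mtop MU) (\<Sigma> ` D0)" using openin_topspace[of "mtop MU"] by (simp add: im\<Sigma> cMU)
    qed
    fix b assume "b \<in> mcarrier L'"
    then have q: "(a, b) \<in> D0" if "a \<in> mcarrier N'" for a using that by (simp add: cN' cL' D0_def)
    show "HJE_solution MU N' \<pi> X (\<lambda>a. \<Sigma> (a, b))"
      unfolding HJE_solution_def smooth_section_def
    proof (intro conjI ballI)
      show "smooth_map N' MU (\<lambda>a. \<Sigma> (a, b))"
      proof (rule smooth_map_if_smooth_at[OF mN' mMU])
        show "\<Sigma> (a, b) \<in> mcarrier MU" if "a \<in> mcarrier N'" for a using \<Sigma>U[OF q[OF that]] cMU by simp
        show "smooth_at N' MU a (\<lambda>a. \<Sigma> (a, b))" if "a \<in> mcarrier N'" for a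
          unfolding MU_def using s\<sigma>[OF q[OF that]] \<Sigma>U[OF q[OF that]] by (simp add: smooth_at_into_open_mfd[OF M U])
      qed
      fix a assume a: "a \<in> mcarrier N'"
      show "\<pi> (\<Sigma> (a, b)) = a" by (rule \<pi>\<Sigma>[OF q[OF a]])
      have "X (\<Sigma> (a, b)) \<in> tmap M (\<lambda>a. \<Sigma> (a, b)) a ` tangent N' a"
        unfolding slice[OF q[OF a]] by (rule X[OF UV[OF \<Sigma>U[OF q[OF a]]]])
      then obtain v where v: "v \<in> tangent N' a" "X (\<Sigma> (a, b)) = tmap M (\<lambda>a. \<Sigma> (a, b)) a v" by blast
      show "tmap MU (\<lambda>a. \<Sigma> (a, b)) a (tmap N' \<pi> (\<Sigma> (a, b)) (X (\<Sigma> (a, b)))) = X (\<Sigma> (a, b))"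
        unfolding v(2) t\<sigma>[OF q[OF a]] \<pi>\<sigma>[OF q[OF a] v(1)] ..
    qed
    show "isotropic_section MU \<Xi> N' (\<lambda>a. \<Sigma> (a, b))"
      unfolding isotropic_section_def
    proof
      fix a assume a: "a \<in> mcarrier N'"
      note xU = \<Sigma>U[OF q[OF a]]
      show "isotropic MU \<Xi> (\<Sigma> (a, b)) (tmap MU (\<lambda>a. \<Sigma> (a, b)) a ` tangent N' a)"
        unfolding t\<sigma>[OF q[OF a]] slice[OF q[OF a]]
        using iso[OF UV[OF xU]] isotropic_open_mfd[OF M U xU] by (simp add: MU_def)
    qed
  qed
  define D where "D = sharp_ann Q (pullback_bivector Q MU \<Xi> \<Sigma>) (dist_times_zero N' L' (image_dist MU N' \<pi>))"
  have DM: "D q = tmap Q G (\<Sigma> q) ` sharp_ann M \<Xi> K (\<Sigma> q)" if q: "q \<in> D0" for q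
  proof -
    obtain a b where ab: "q = (a, b)" by (cases q)
    have "image_dist MU N' \<pi> a = tangent N' a"
    proof -
      have "\<Sigma> (a, b) \<in> {m\<in>mcarrier MU. \<pi> m = a}" using \<Sigma>U[OF q] \<pi>\<Sigma> q ab cMU by simp
      moreover have "tmap N' \<pi> m ` tangent MU m = tangent N' a" if "m \<in> {m\<in>mcarrier MU. \<pi> m = a}" for m
        using tsurj[of m] that by (simp add: cMU)
      ultimately show ?thesis unfolding image_dist_def by blast
    qed
    then have dz: "dist_times_zero N' L' (image_dist MU N' \<pi>) q = ker_tmap Q L' snd q"
      using dk[OF q] by (simp add: dist_times_zero_def ab)
    have tq: "tmap MU \<Sigma> q = tmap M \<Sigma> q"
      unfolding MU_def by (rule tmap_open_mfd[where f = \<Sigma> and p = q, OF M U \<Sigma>U[OF q]])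
    have sq: "sharp MU \<Xi> (\<Sigma> q) = sharp M \<Xi> (\<Sigma> q)" and cq: "cotangent MU (\<Sigma> q) = cotangent M (\<Sigma> q)"
      unfolding MU_def by (rule sharp_open_mfd[OF M U \<Sigma>U[OF q]], rule cotangent_open_mfd[OF M U \<Sigma>U[OF q]])
    have mq: "cotmap Q MU \<Sigma> q = cotmap Q M \<Sigma> q" by (intro ext) (simp only: cotmap_def tq)
    have "pullback_bivector Q MU \<Xi> \<Sigma> q = pullback_bivector Q M \<Xi> \<Sigma> q"
      by (intro ext) (simp only: pullback_bivector_def sq cq mq tq)
    from sharp_cong[where \<Xi> = "pullback_bivector Q MU \<Xi> \<Sigma>" and \<Xi>' = "pullback_bivector Q M \<Xi> \<Sigma>", OF this]
    have Dq: "D q = sharp Q (pullback_bivector Q M \<Xi> \<Sigma>) q ` annihilator Q q (ker_tmap Q L' snd q)"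
      unfolding D_def sharp_ann_def dz by simp
    have kt: "ker_tmap Q L' snd q \<subseteq> tangent Q q" by (auto simp: ker_tmap_def)
    note sp = sharp_ann_pullback[OF P UM[OF \<Sigma>U[OF q]] tm(3)[OF q] kt]
    have 1: "tmap M \<Sigma> q ` D q = sharp_ann M \<Xi> K (\<Sigma> q)"
      unfolding Dq sp(1) KK[OF q, symmetric] sharp_ann_def ..
    have "tmap Q G (\<Sigma> q) ` (tmap M \<Sigma> q ` D q) = (\<lambda>v. v) ` D q"
      unfolding image_image by (rule image_cong[OF refl]) (use tm(1)[OF q] sp(2) Dq in blast)
    then show ?thesis unfolding 1 by simp
  qed
  have intQ: "integrable_dist Q D"
    unfolding integrable_dist_def cQ
  proof
    fix q assume q: "q \<in> D0"
    obtain S where S: "\<Sigma> q \<in> mcarrier S" "integral_submanifold M (sharp_ann M \<Xi> K) S"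
      using int[OF UV[OF \<Sigma>U[OF q]]] by blast
    have "\<exists>S'. G (\<Sigma> q) \<in> mcarrier S' \<and> integral_submanifold Q D S'"
    proof (rule integral_submanifold_transport[OF M mQ U _ _ sG _ _ S(2,1) \<Sigma>U[OF q]])
      show "inj_on G U" by (rule inj_on_inverseI) (rule \<Sigma>G)
      show "continuous_map (subtopology (mtop M) U) (mtop Q) G"
      proof -
        have "continuous_map (mtop MU) (mtop Q) G"
        proof (rule smooth_at_imp_continuous_map[OF mMU mQ])
          show "G x \<in> mcarrier Q" if "x \<in> mcarrier MU" for x using GD that by (simp add: cQ cMU)
          show "smooth_at MU Q x G" if "x \<in> mcarrier MU" for x
            using sG[OF that[unfolded cMU]] that[unfolded cMU] unfolding MU_def by (simp add: smooth_at_from_open_mfd[OF M U])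
        qed
        then show ?thesis by (simp add: MU_def open_mfd_def)
      qed
      fix x assume x: "x \<in> U"
      show "inj_on (tmap Q G x) (tangent M x)"
      proof (rule inj_on_inverseI)
        show "tmap M \<Sigma> (G x) (tmap Q G x v) = v" if "v \<in> tangent M x" for v
          using tm(2)[OF GD[OF x], of v] that unfolding \<Sigma>G[OF x] .
      qed
      show "D (G x) = tmap Q G x ` sharp_ann M \<Xi> K x"
        using DM[OF GD[OF x]] unfolding \<Sigma>G[OF x] .
    qed
    then show "\<exists>S'. q \<in> mcarrier S' \<and> integral_submanifold Q D S'" unfolding G\<Sigma>[OF q] .
  qed
  have "isotropic_integrable_solution MU \<Xi> N' \<pi> X L' \<Sigma>"
    unfolding isotropic_integrable_solution_def Let_def using sol intQ unfolding D_def Q_def by (rule conjI)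
  then show ?thesis
    using U p0U A' fib unfolding MU_def N'_def by (intro exI[of _ U]) (auto simp: \<pi>U)
qed

lemma good_chart_restrict:
  assumes g: "good_chart M V u" and W: "openin (mtop M) W"
  shows "good_chart M (V \<inter> W) u"
proof -
  note ch = good_chart_chart[OF g]
  have o: "openin (Euclidean_space (mdim M)) (u ` (V \<inter> W))" by (rule openin_chart_image[OF ch W])
  have "good_chart M {q\<in>V. u q \<in> u ` (V \<inter> W)} (\<lambda>q. (\<lambda>x. x) (u q))"
    by (rule good_chart_compose[where \<theta> = "\<lambda>x. x" and \<eta> = "\<lambda>x. x", OF g o]) (use o in \<open>auto intro: Cinf_on_coord\<close>)
  moreover have "{q\<in>V. u q \<in> u ` (V \<inter> W)} = V \<inter> W" using chart_inj[OF ch] by (auto dest: inj_onD)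
  ultimately show ?thesis by simp
qed

text \<open>Moves the first \<open>l\<close> coordinates, where \<open>complete_to_chart\<close> puts given functions, to the end, where
  \<open>adapted_chart_imp_complete_solution\<close> expects the coordinates of \<open>F\<close>.\<close>

lemma good_chart_rotate:
  assumes g: "good_chart M V u" and n: "mdim M = l + k"
  shows "good_chart M V (\<lambda>q. concat_coords k (snd_coords l (u q)) (fst_coords l (u q)))"
proof -
  note ch = good_chart_chart[OF g]
  let ?E = "topspace (Euclidean_space (l + k))"
  define \<theta> where "\<theta> = (\<lambda>x. concat_coords k (snd_coords l x) (fst_coords l x))"
  define \<eta> where "\<eta> = (\<lambda>x. concat_coords l (snd_coords k x) (fst_coords k x))"
  have \<eta>\<theta>: "\<eta> (\<theta> x) = x" if x: "x \<in> ?E" for x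
    unfolding \<eta>_def \<theta>_def fst_coords_concat[OF snd_coords_in_Euclidean[OF x]] snd_coords_concat concat_fst_snd_coords ..
  have \<theta>\<eta>: "\<theta> (\<eta> x) = x" if x: "x \<in> ?E" for x
  proof -
    have "x \<in> topspace (Euclidean_space (k + l))" using x by (simp add: add.commute)
    from snd_coords_in_Euclidean[OF this]
    show ?thesis unfolding \<eta>_def \<theta>_def by (simp only: fst_coords_concat snd_coords_concat concat_fst_snd_coords)
  qed
  have \<theta>E: "\<theta> x \<in> ?E" and \<eta>E: "\<eta> x \<in> ?E" for x
    unfolding \<theta>_def \<eta>_def
    using concat_coords_in_Euclidean[OF fst_coords_in_Euclidean[of l x], of k "snd_coords l x"]
      concat_coords_in_Euclidean[OF fst_coords_in_Euclidean[of k x], of l "snd_coords k x"]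
    by (simp_all add: add.commute)
  have s: "Cinf_on (l + k) W (\<lambda>x. \<theta> x i)" "Cinf_on (l + k) W (\<lambda>x. \<eta> x i)"
    if "openin (Euclidean_space (l + k)) W" for W i
    using Cinf_on_fst_coords[OF that] Cinf_on_snd_coords[OF that]
    by (cases "i < k"; cases "i < l"; simp add: \<theta>_def \<eta>_def concat_coords_nth)+
  have o: "openin (Euclidean_space (l + k)) (u ` V)" using chart_openin_image[OF ch] n by simp
  have im: "\<theta> ` u ` V = {x\<in>?E. \<eta> x \<in> u ` V}"
  proof (intro equalityI subsetI)
    fix x assume "x \<in> \<theta> ` u ` V"
    then obtain q where "q \<in> V" "x = \<theta> (u q)" by blast
    then show "x \<in> {x\<in>?E. \<eta> x \<in> u ` V}" using \<theta>E \<eta>\<theta>[of "u q"] chart_in_Euclidean[OF ch] n by simp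
  next
    fix x assume "x \<in> {x\<in>?E. \<eta> x \<in> u ` V}"
    then show "x \<in> \<theta> ` u ` V" using \<theta>\<eta>[of x] by (metis (no_types, lifting) imageI mem_Collect_eq)
  qed
  have o': "openin (Euclidean_space (l + k)) (\<theta> ` u ` V)"
    unfolding im by (rule openin_Euclidean_preimage[OF openin_topspace o \<eta>E Cinf_on_continuous[OF openin_topspace s(2)[OF openin_topspace]]])
  have "good_chart M {q\<in>V. u q \<in> u ` V} (\<lambda>q. \<theta> (u q))"
    by (rule good_chart_compose[where \<theta> = \<theta> and \<eta> = \<eta>, OF g])
      (use o o' s \<eta>\<theta> openin_subset[OF o] n in auto)
  moreover have "{q\<in>V. u q \<in> u ` V} = V" by auto
  ultimately show ?thesis by (simp add: \<theta>_def)
qed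

lemma tmap_coord:
  assumes g: "good_chart N A y" and p: "f p \<in> A"
  shows "tmap N f p v (\<lambda>x. y x i) = v (\<lambda>x. y (f x) i)"
  using smooth_near_coord[OF g p] by (simp add: tmap_def)

text \<open>Transversality makes the coordinates of \<open>\<pi>\<close> and of \<open>F\<close> together a coordinate system of \<open>M\<close> near
  \<open>m\<close>: a tangent vector of either base lifts to a vector in the kernel of the other tangent map, which
  gives independence, and a vector annihilated by all of these functions is tangent to both fibres,
  hence 0, which gives the dimension.\<close>

theorem nci_transverse_imp_complete_solution:
  assumes P: "poisson_manifold M \<Xi>" and N: "manifold N" and \<pi>: "fibration M N \<pi>"
    and nci: "nci_by M \<Xi> X L F" and tr: "transverse M N L \<pi> F" and m: "m \<in> mcarrier M"
  shows "\<exists>U. openin (mtop M) U \<and> m \<in> U \<and>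
    (\<exists>(L' :: (nat \<Rightarrow> real) mfd) \<Sigma>.
      isotropic_integrable_solution (open_mfd M U) \<Xi> (open_mfd N (\<pi> ` U)) \<pi> X L' \<Sigma>)"
proof -
  have M: "manifold M" using P by (simp add: poisson_manifold_def)
  have L: "manifold L" and F: "fibration M L F"
    and iso: "\<And>x. x \<in> mcarrier M \<Longrightarrow> isotropic M \<Xi> x (ker_tmap M L F x)"
    and X: "\<And>x. x \<in> mcarrier M \<Longrightarrow> X x \<in> ker_tmap M L F x"
    and int: "integrable_dist M (sharp_ann M \<Xi> (ker_tmap M L F))"
    using nci by (simp_all add: nci_by_def isotropic_fibration_def)
  have sm\<pi>: "smooth_map M N \<pi>" and smF: "smooth_map M L F" using \<pi> F by (simp_all add: fibration_def)
  have c\<pi>: "continuous_map (mtop M) (mtop N) \<pi>" and cF: "continuous_map (mtop M) (mtop L) F"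
    using sm\<pi> smF by (simp_all add: smooth_map_def)
  have \<pi>m: "\<pi> m \<in> mcarrier N" and Fm: "F m \<in> mcarrier L"
    using c\<pi> cF m by (auto simp: continuous_map_def)
  obtain A y where A: "(A, y) \<in> matlas N" "\<pi> m \<in> A" using manifold_atlas_at[OF N \<pi>m] .
  obtain B z where B: "(B, z) \<in> matlas L" "F m \<in> B" using manifold_atlas_at[OF L Fm] .
  note gA = atlas_good_chart[OF N A(1)] and gB = atlas_good_chart[OF L B(1)]
  note s\<pi> = smooth_map_imp_smooth_at[OF M N sm\<pi>] and sF = smooth_map_imp_smooth_at[OF M L smF]
  define k where "k = mdim N"
  define l where "l = mdim L"
  define f where "f = (\<lambda>i x. if i < k then y (\<pi> x) i else z (F x) (i - k))"
  have f1: "f i = (\<lambda>x. y (\<pi> x) i)" if "i < k" for i using that by (simp add: f_def)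
  have f2: "f i = (\<lambda>x. z (F x) (i - k))" if "\<not> i < k" for i using that by (simp add: f_def)
  have fs: "smooth_near M m (f i)" for i
    using smooth_atD[OF s\<pi>[OF m] smooth_near_coord[OF gA A(2), of i]]
      smooth_atD[OF sF[OF m] smooth_near_coord[OF gB B(2), of "i - k"]]
    by (cases "i < k") (simp_all add: f1 f2)
  have v\<pi>: "v (f i) = tmap N \<pi> m v (\<lambda>x. y x i)" if "i < k" for v i
    using tmap_coord[where f = \<pi> and p = m, OF gA A(2)] by (simp add: f1[OF that])
  have vF: "v (f i) = tmap L F m v (\<lambda>x. z x (i - k))" if "\<not> i < k" for v i
    using tmap_coord[where f = F and p = m, OF gB B(2)] by (simp add: f2[OF that])
  have split: "\<exists>a b. v = (\<lambda>g. a g + b g) \<and> a \<in> ker_tmap M N \<pi> m \<and> b \<in> ker_tmap M L F m"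
    if "v \<in> tangent M m" for v
  proof -
    have "{(\<lambda>g. v g + w g) |v w. v \<in> ker_tmap M N \<pi> m \<and> w \<in> ker_tmap M L F m} = tangent M m"
      using tr m unfolding transverse_def by blast
    then show ?thesis using that by blast
  qed
  have indep: "\<exists>v\<in>tangent M m. v (f i) \<noteq> 0 \<and> (\<forall>j<i. v (f j) = 0)" if i: "i < k + l" for i
  proof (cases "i < k")
    case True
    define e where "e = coord_vec N A y (\<pi> m) i"
    have "e \<in> tangent N (\<pi> m)" unfolding e_def by (rule coord_vec_tangent[OF N gA A(2)]) (use True k_def in simp)
    then obtain v where v: "v \<in> tangent M m" "tmap N \<pi> m v = e" using \<pi> m by (metis (no_types, lifting) fibration_def imageE)
    obtain a b where ab: "v = (\<lambda>g. a g + b g)" "a \<in> ker_tmap M N \<pi> m" "b \<in> ker_tmap M L F m"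
      using split[OF v(1)] by blast
    have eb: "e = tmap N \<pi> m b" using v(2) ab(2) unfolding ab(1) tmap_add by (simp add: ker_tmap_def)
    have "b (f j) = (if i = j then 1 else 0)" if "j < k" for j
      unfolding v\<pi>[OF that] eb[symmetric] e_def by (rule coord_vec_coord[OF gA A(2)]) (use True k_def in simp)
    then show ?thesis using ab(3) True by (intro bexI[of _ b]) (auto simp: ker_tmap_def)
  next
    case False
    define e where "e = coord_vec L B z (F m) (i - k)"
    have il: "i - k < mdim L" using False i l_def by simp
    have "e \<in> tangent L (F m)" unfolding e_def by (rule coord_vec_tangent[OF L gB B(2) il])
    then obtain v where v: "v \<in> tangent M m" "tmap L F m v = e" using F m by (metis (no_types, lifting) fibration_def imageE)
    obtain a b where ab: "v = (\<lambda>g. a g + b g)" "a \<in> ker_tmap M N \<pi> m" "b \<in> ker_tmap M L F m"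
      using split[OF v(1)] by blast
    have ea: "e = tmap L F m a" using v(2) ab(3) unfolding ab(1) tmap_add by (simp add: ker_tmap_def)
    have 1: "a (f j) = 0" if "j < k" for j unfolding v\<pi>[OF that] using ab(2) by (simp add: ker_tmap_def)
    have 2: "a (f j) = (if i - k = j - k then 1 else 0)" if "\<not> j < k" for j
      unfolding vF[OF that] ea[symmetric] e_def by (rule coord_vec_coord[OF gB B(2) il])
    have "a (f j) = 0" if "j < i" for j using 1[of j] 2[of j] that by (cases "j < k") auto
    then show ?thesis using ab(2) 2[OF False] by (intro bexI[of _ a]) (auto simp: ker_tmap_def)
  qed
  obtain V0 u where g0: "good_chart M V0 u" and mV: "m \<in> V0" and kl: "k + l \<le> mdim M"
    and uf: "\<And>x i. x \<in> V0 \<Longrightarrow> i < k + l \<Longrightarrow> u x i = f i x"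
    using complete_to_chart[where f = f and K = "k + l", OF M m fs indep] by blast
  have dim: "mdim M = k + l"
  proof (rule ccontr)
    \<comment> \<open>A further coordinate vector would be tangent to the fibres of both maps.\<close>
    assume "mdim M \<noteq> k + l"
    then have n: "k + l < mdim M" using kl by simp
    define e where "e = coord_vec M V0 u m (k + l)"
    have e: "e \<in> tangent M m" unfolding e_def by (rule coord_vec_tangent[OF M g0 mV n])
    have ef: "e (f i) = 0" if "i < k + l" for i
    proof -
      have "e (f i) = e (\<lambda>x. u x i)"
        by (rule tangent_cong[OF M chart_openin[OF good_chart_chart[OF g0]] mV _ e]) (simp add: uf that)
      also have "\<dots> = 0" unfolding e_def using coord_vec_coord[OF g0 mV n, of i] that by simp
      finally show ?thesis .
    qed
    have "e \<in> ker_tmap M N \<pi> m"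
      unfolding ker_tmap_coords[where f = \<pi> and x = m, OF M N s\<pi>[OF m] gA A(2)]
      using e ef by (auto simp: f1[symmetric] k_def)
    moreover have "e \<in> ker_tmap M L F m"
      unfolding ker_tmap_coords[where f = F and x = m, OF M L sF[OF m] gB B(2)]
    proof (intro CollectI conjI allI impI e)
      fix i assume "i < mdim L"
      then show "e (\<lambda>x. z (F x) i) = 0" using ef[of "k + i"] f2[of "k + i"] by (simp add: l_def)
    qed
    ultimately have "e = (\<lambda>g. 0)" using tr m unfolding transverse_def by blast
    moreover have "e (\<lambda>x. u x (k + l)) = 1" unfolding e_def using coord_vec_coord[OF g0 mV n] by simp
    ultimately show False by simp
  qed
  define R where "R = {x\<in>mcarrier M. \<pi> x \<in> A} \<inter> {x\<in>mcarrier M. F x \<in> B}"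
  have R: "openin (mtop M) R"
    unfolding R_def
    by (intro openin_Int openin_continuous_map_preimage[OF c\<pi>] openin_continuous_map_preimage[OF cF]
        chart_openin[OF manifold_chart[OF N A(1)]] chart_openin[OF manifold_chart[OF L B(1)]])
  define V where "V = V0 \<inter> R"
  have g: "good_chart M V u" unfolding V_def by (rule good_chart_restrict[OF g0 R])
  have mV: "m \<in> V" using mV m A(2) B(2) by (simp add: V_def R_def)
  have VM: "x \<in> mcarrier M" if "x \<in> V" for x using that by (simp add: V_def R_def)
  have K: "ker_tmap M L F x = {v\<in>tangent M x. \<forall>i<l. v (\<lambda>z. u z (mdim N + i)) = 0}" if x: "x \<in> V" for x
  proof -
    have "F x \<in> B" using x by (simp add: V_def R_def)
    from ker_tmap_coords[where f = F and x = x, OF M L sF[OF VM[OF x]] gB this]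
    have 1: "ker_tmap M L F x = {v\<in>tangent M x. \<forall>i<l. v (\<lambda>y. z (F y) i) = 0}" by (simp add: l_def)
    have eq: "v (\<lambda>y. z (F y) i) = v (\<lambda>z. u z (mdim N + i))" if v: "v \<in> tangent M x" and i: "i < l" for v i
      by (rule tangent_cong[OF M chart_openin[OF good_chart_chart[OF g]] x _ v])
        (use uf[of _ "k + i"] i f2[of "k + i"] in \<open>simp add: V_def k_def\<close>)
    show ?thesis
      unfolding 1 by (intro Collect_cong conj_cong refl all_cong1 imp_cong) (subst eq, assumption+, rule refl)
  qed
  have "\<exists>U. openin (mtop M) U \<and> m \<in> U \<and> openin (mtop N) (\<pi> ` U) \<and>
    fibration (open_mfd M U) (open_mfd N (\<pi> ` U)) \<pi> \<and>
    (\<exists>(L' :: (nat \<Rightarrow> real) mfd) \<Sigma>.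
      isotropic_integrable_solution (open_mfd M U) \<Xi> (open_mfd N (\<pi> ` U)) \<pi> X L' \<Sigma>)"
  proof (rule adapted_chart_imp_complete_solution[where K = "ker_tmap M L F", OF P N A(1) g mV _ _ _ K])
    show "mdim M = mdim N + l" using dim by (simp add: k_def)
    show "\<pi> x \<in> A" if "x \<in> V" for x using that by (simp add: V_def R_def)
    show "u x i = y (\<pi> x) i" if "x \<in> V" "i < mdim N" for x i
      using uf[of x i] f1[of i] that by (simp add: V_def k_def)
    show "isotropic M \<Xi> x (ker_tmap M L F x)" "X x \<in> ker_tmap M L F x" if "x \<in> V" for x
      using iso X VM[OF that] by blast+
    show "\<exists>S. x \<in> mcarrier S \<and> integral_submanifold M (sharp_ann M \<Xi> (ker_tmap M L F)) S" if "x \<in> V" for x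
      using int VM[OF that] unfolding integrable_dist_def by blast
  qed
  then show ?thesis by blast
qed

text \<open>Locally every fibration has a transverse one: complete the coordinates of \<open>F\<close> to a coordinate system
  and project to the added coordinates.\<close>

theorem nci_imp_complete_solution:
  assumes P: "poisson_manifold M \<Xi>" and nci: "nci M \<Xi> X" and m: "m \<in> mcarrier M"
  shows "\<exists>U. openin (mtop M) U \<and> m \<in> U \<and>
    (\<exists>(N' :: (nat \<Rightarrow> real) mfd) \<pi>' (L' :: (nat \<Rightarrow> real) mfd) \<Sigma>.
      manifold N' \<and> fibration (open_mfd M U) N' \<pi>' \<and>
      isotropic_integrable_solution (open_mfd M U) \<Xi> N' \<pi>' X L' \<Sigma>)"
proof -
  have M: "manifold M" using P by (simp add: poisson_manifold_def)
  obtain L :: "(nat \<Rightarrow> real) mfd" and F where by_F: "nci_by M \<Xi> X L F" using nci unfolding nci_def by blast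
  have L: "manifold L" and F: "fibration M L F"
    and iso: "\<And>x. x \<in> mcarrier M \<Longrightarrow> isotropic M \<Xi> x (ker_tmap M L F x)"
    and X: "\<And>x. x \<in> mcarrier M \<Longrightarrow> X x \<in> ker_tmap M L F x"
    and int: "integrable_dist M (sharp_ann M \<Xi> (ker_tmap M L F))"
    using by_F by (simp_all add: nci_by_def isotropic_fibration_def)
  have smF: "smooth_map M L F" using F by (simp add: fibration_def)
  have cF: "continuous_map (mtop M) (mtop L) F" using smF by (simp add: smooth_map_def)
  have Fm: "F m \<in> mcarrier L" using cF m by (auto simp: continuous_map_def)
  obtain B z where B: "(B, z) \<in> matlas L" "F m \<in> B" using manifold_atlas_at[OF L Fm] .
  note gB = atlas_good_chart[OF L B(1)] and sF = smooth_map_imp_smooth_at[OF M L smF]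
  define l where "l = mdim L"
  define f where "f = (\<lambda>i x. z (F x) i)"
  have fs: "smooth_near M m (f i)" for i
    unfolding f_def by (rule smooth_atD[OF sF[OF m] smooth_near_coord[OF gB B(2)]])
  have indep: "\<exists>v\<in>tangent M m. v (f i) \<noteq> 0 \<and> (\<forall>j<i. v (f j) = 0)" if i: "i < l" for i
  proof -
    define e where "e = coord_vec L B z (F m) i"
    have il: "i < mdim L" using i l_def by simp
    have "e \<in> tangent L (F m)" unfolding e_def by (rule coord_vec_tangent[OF L gB B(2) il])
    then obtain v where v: "v \<in> tangent M m" "tmap L F m v = e" using F m by (metis (no_types, lifting) fibration_def imageE)
    have "v (f j) = (if i = j then 1 else 0)" for j
      using tmap_coord[where f = F and p = m and v = v and i = j, OF gB B(2)] coord_vec_coord[OF gB B(2) il, of j] unfolding v(2) e_def f_def by simp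
    then show ?thesis using v(1) by (intro bexI[of _ v]) auto
  qed
  obtain V0 u where g0: "good_chart M V0 u" and mV: "m \<in> V0" and ln: "l \<le> mdim M"
    and uf: "\<And>x i. x \<in> V0 \<Longrightarrow> i < l \<Longrightarrow> u x i = f i x"
    using complete_to_chart[where f = f and K = l, OF M m fs indep] by blast
  define k where "k = mdim M - l"
  have n: "mdim M = l + k" using ln by (simp add: k_def)
  define R where "R = {x\<in>mcarrier M. F x \<in> B}"
  have R: "openin (mtop M) R"
    unfolding R_def by (rule openin_continuous_map_preimage[OF cF chart_openin[OF manifold_chart[OF L B(1)]]])
  define V where "V = V0 \<inter> R"
  define \<phi> where "\<phi> = (\<lambda>q. concat_coords k (snd_coords l (u q)) (fst_coords l (u q)))"
  have g: "good_chart M V \<phi>"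
    unfolding V_def \<phi>_def by (rule good_chart_rotate[OF good_chart_restrict[OF g0 R] n])
  have mV: "m \<in> V" using mV m B(2) by (simp add: V_def R_def)
  have VM: "x \<in> mcarrier M" if "x \<in> V" for x using that by (simp add: V_def R_def)
  define \<pi> where "\<pi> = (\<lambda>x. fst_coords k (\<phi> x))"
  have dE: "mdim (eucl_mfd k) = k" by (simp add: eucl_mfd_def)
  have K: "ker_tmap M L F x = {v\<in>tangent M x. \<forall>i<l. v (\<lambda>z. \<phi> z (mdim (eucl_mfd k) + i)) = 0}" if x: "x \<in> V" for x
  proof -
    have "F x \<in> B" using x by (simp add: V_def R_def)
    from ker_tmap_coords[where f = F and x = x, OF M L sF[OF VM[OF x]] gB this]
    have 1: "ker_tmap M L F x = {v\<in>tangent M x. \<forall>i<l. v (\<lambda>y. z (F y) i) = 0}" by (simp add: l_def)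
    have eq: "v (\<lambda>y. z (F y) i) = v (\<lambda>z. \<phi> z (mdim (eucl_mfd k) + i))" if v: "v \<in> tangent M x" and i: "i < l" for v i
      by (rule tangent_cong[OF M chart_openin[OF good_chart_chart[OF g]] x _ v])
        (use uf i in \<open>simp add: V_def dE \<phi>_def f_def concat_coords_nth fst_coords_def\<close>)
    show ?thesis
      unfolding 1 by (intro Collect_cong conj_cong refl all_cong1 imp_cong) (subst eq, assumption+, rule refl)
  qed
  have "\<exists>U. openin (mtop M) U \<and> m \<in> U \<and> openin (mtop (eucl_mfd k)) (\<pi> ` U) \<and>
    fibration (open_mfd M U) (open_mfd (eucl_mfd k) (\<pi> ` U)) \<pi> \<and>
    (\<exists>(L' :: (nat \<Rightarrow> real) mfd) \<Sigma>.
      isotropic_integrable_solution (open_mfd M U) \<Xi> (open_mfd (eucl_mfd k) (\<pi> ` U)) \<pi> X L' \<Sigma>)"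
  proof (rule adapted_chart_imp_complete_solution[where K = "ker_tmap M L F", OF P manifold_eucl_mfd _ g mV _ _ _ K])
    show "(topspace (Euclidean_space k), \<lambda>x. x) \<in> matlas (eucl_mfd k)" by (simp add: eucl_mfd_def)
    show "mdim M = mdim (eucl_mfd k) + l" by (simp add: dE n)
    show "\<pi> x \<in> topspace (Euclidean_space k)" for x unfolding \<pi>_def by (rule fst_coords_in_Euclidean)
    show "\<phi> x i = \<pi> x i" if "i < mdim (eucl_mfd k)" for x i
      using that by (simp add: dE \<pi>_def fst_coords_def)
    show "isotropic M \<Xi> x (ker_tmap M L F x)" "X x \<in> ker_tmap M L F x" if "x \<in> V" for x
      using iso X VM[OF that] by blast+
    show "\<exists>S. x \<in> mcarrier S \<and> integral_submanifold M (sharp_ann M \<Xi> (ker_tmap M L F)) S" if "x \<in> V" for x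
      using int VM[OF that] unfolding integrable_dist_def by blast
  qed
  then obtain U and L' :: "(nat \<Rightarrow> real) mfd" and \<Sigma> where U: "openin (mtop M) U" "m \<in> U"
    "openin (mtop (eucl_mfd k)) (\<pi> ` U)" "fibration (open_mfd M U) (open_mfd (eucl_mfd k) (\<pi> ` U)) \<pi>"
    "isotropic_integrable_solution (open_mfd M U) \<Xi> (open_mfd (eucl_mfd k) (\<pi> ` U)) \<pi> X L' \<Sigma>"
    by (elim exE conjE) (rule that)
  show ?thesis
    by (rule exI[of _ U], intro conjI U(1,2), rule exI[of _ "open_mfd (eucl_mfd k) (\<pi> ` U)"],
        rule exI[of _ \<pi>], rule exI[of _ L'], rule exI[of _ \<Sigma>],
        intro conjI manifold_open_mfd[OF manifold_eucl_mfd U(3)] U(4,5))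
qed

theorem theorem4p23:
  fixes M :: "'m mfd" and \<Xi> :: "'m bivector" and H :: "'m \<Rightarrow> real"
    and N :: "'n mfd" and \<pi> :: "'m \<Rightarrow> 'n"
  assumes "poisson_manifold M \<Xi>" and "smooth_fun_on M (mcarrier M) H"
    and "manifold N" and "fibration M N \<pi>"
  shows
    "((\<exists>(L :: 'l mfd) \<Sigma>.
         isotropic_complete_solution M \<Xi> N \<pi> (hamiltonian_vf M \<Xi> H) L \<Sigma> \<and>
         (let Q = prod_mfd N L in
           integrable_dist Q
             (sharp_ann Q (pullback_bivector Q M \<Xi> \<Sigma>) (dist_times_zero N L (tangent N)))))
       \<longrightarrow> (\<forall>m\<in>mcarrier M. \<exists>U. openin (mtop M) U \<and> m \<in> U \<and>
             nci (open_mfd M U) \<Xi> (hamiltonian_vf M \<Xi> H)))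
     \<and>
     (\<forall>(L :: 'k mfd) F. nci_by M \<Xi> (hamiltonian_vf M \<Xi> H) L F \<and> transverse M N L \<pi> F
       \<longrightarrow> (\<forall>m\<in>mcarrier M. \<exists>U. openin (mtop M) U \<and> m \<in> U \<and>
             (let M\<^sub>U = open_mfd M U; N\<^sub>U = open_mfd N (\<pi> ` U) in
               \<exists>(L' :: (nat \<Rightarrow> real) mfd) \<Sigma>.
                 isotropic_complete_solution M\<^sub>U \<Xi> N\<^sub>U \<pi> (hamiltonian_vf M \<Xi> H) L' \<Sigma> \<and>
                 (let Q = prod_mfd N\<^sub>U L' in
                   integrable_dist Q
                     (sharp_ann Q (pullback_bivector Q M\<^sub>U \<Xi> \<Sigma>)
                       (dist_times_zero N\<^sub>U L' (image_dist M\<^sub>U N\<^sub>U \<pi>)))))))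
     \<and>
     (nci M \<Xi> (hamiltonian_vf M \<Xi> H)
       \<longrightarrow> (\<forall>m\<in>mcarrier M. \<exists>U. openin (mtop M) U \<and> m \<in> U \<and>
             (let M\<^sub>U = open_mfd M U in
               \<exists>(N' :: (nat \<Rightarrow> real) mfd) \<pi>' (L' :: (nat \<Rightarrow> real) mfd) \<Sigma>.
                 manifold N' \<and> fibration M\<^sub>U N' \<pi>' \<and>
                 isotropic_complete_solution M\<^sub>U \<Xi> N' \<pi>' (hamiltonian_vf M \<Xi> H) L' \<Sigma> \<and>
                 (let Q = prod_mfd N' L' in
                   integrable_dist Q
                     (sharp_ann Q (pullback_bivector Q M\<^sub>U \<Xi> \<Sigma>)
                       (dist_times_zero N' L' (image_dist M\<^sub>U N' \<pi>')))))))"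
proof (intro conjI impI allI ballI)
  fix m assume m: "m \<in> mcarrier M"
    and "\<exists>(L :: 'l mfd) \<Sigma>. isotropic_complete_solution M \<Xi> N \<pi> (hamiltonian_vf M \<Xi> H) L \<Sigma> \<and>
      (let Q = prod_mfd N L in
        integrable_dist Q (sharp_ann Q (pullback_bivector Q M \<Xi> \<Sigma>) (dist_times_zero N L (tangent N))))"
  then obtain L :: "'l mfd" and \<Sigma> where
    "isotropic_complete_solution M \<Xi> N \<pi> (hamiltonian_vf M \<Xi> H) L \<Sigma>"
    "integrable_dist (prod_mfd N L) (sharp_ann (prod_mfd N L)
      (pullback_bivector (prod_mfd N L) M \<Xi> \<Sigma>) (dist_times_zero N L (tangent N)))"
    unfolding Let_def by (elim exE conjE)
  then show "\<exists>U. openin (mtop M) U \<and> m \<in> U \<and> nci (open_mfd M U) \<Xi> (hamiltonian_vf M \<Xi> H)"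
    by (rule complete_solution_imp_nci[OF assms(1,3,4) _ _ m])
qed (unfold Let_def, elim conjE,
    rule nci_transverse_imp_complete_solution[OF assms(1,3,4), unfolded isotropic_integrable_solution_def Let_def],
    assumption+,
    rule nci_imp_complete_solution[OF assms(1), unfolded isotropic_integrable_solution_def Let_def], assumption+)

end
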